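(* Assume that Assumption 1 and Assumption 2 (both stated in the context) hold. For $X\in\mathcal{B}_N$ let $\ell(X)$ be the length of a minimal factorization of $X$, and for each edge $e=(x,y)$ of $X$ let $|e|=|x-y|$ (primes on labels ignored) and let $\#T(e)$ be the number of edges of $X$ that cross $e$. Then for all $N$ and all $X\in\mathcal{B}_N$, $$\ell(X)=\ell_P(X):=\frac12\sum_{e\in X}\max\bigl(\#T(e),|e|\bigr).$$ Moreover $\ell_P(X)$ can be computed in time $\mathcal{O}(N^2)$, and in time $\mathcal{O}(N)$ if the values $\#T(e)$, $e\in X$, are already known.
   Context: For an integer $N\ge 0$, take upper nodes $1,\dots,N$ and lower nodes $1',\dots,N'$ arranged in two rows. A tangle is a set of $N$ edges such that each node is in exactly one edge (a perfect matching of the $2N$ nodes). The composition $X\circ Y$ is obtained by stacking $X$ on top of $Y$, identifying lower node $i'$ of $X$ with upper node $i$ of $Y$, tracing paths, and discarding internal loops. The Brauer monoid $\mathcal{B}_N$ is the monoid of all tangles, with identity $I_N=\{(i,i'):1\le i\le N\}$. It is generated by the primes, for $1\le i\le N-1$: the $T$-prime $T_i$, obtained from $I_N$ by replacing $(i,i'),(i+1,(i+1)')$ with $(i,(i+1)'),(i+1,i')$; and the $U$-prime $U_i$, obtained from $I_N$ by replacing these two edges with $(i,i+1),(i',(i+1)')$. A factorization of $X$ is a word in the primes whose composition is $X$ (the empty word is a factorization of $I_N$); it is minimal if no shorter word has the same composition. Two edges cross if they intersect in the diagram of the tangle drawn inside the rectangle with the minimum number of crossings (equivalently, their endpoints interleave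 in the cyclic order $1,\dots,N,N',\dots,1'$); the number of crossings of a tangle is the number of crossing pairs of edges. Rewriting rules on words. Delete rules (applied left to right): $T_iT_i\to$ empty word; $U_iU_i\to U_i$; $T_iU_i\to U_i$; $U_iT_i\to U_i$; and for $|i-j|=1$: $U_iU_jU_i\to U_i$; $U_iT_jU_i\to U_i$; $T_iU_jU_i\to T_jU_i$; $U_iU_jT_i\to U_iT_j$; $U_iT_jT_i\to U_iU_j$; $T_iT_jU_i\to U_jU_i$. Braid rules, for $|i-j|=1$: $T_iT_jT_i= T_jT_iT_j$; $T_iU_jT_i= T_jU_iT_j$. Swap rules, for $|i-j|>1$: any prime of index $i$ commutes with any prime of index $j$. Assumption 1: for every $N$, every factorization in $\mathcal{B}_N$ can be transformed into a minimal one by a sequence of delete, braid and swap rules (the length never needs to be increased). Assumption 2: if a tangle $X$ has $k$ crossings, then there exists a minimal factorization of $X$ with exactly $k$ $T$-primes, and no factorization of $X$ has fewer $T$-primes. Running time counts elementary operations on node labels as constant time. *)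

theory Defs
  imports Complex_Main "HOL-Library.Landau_Symbols"
begin

section \<open>Tangles and the Brauer monoid\<close>

datatype node = Upper nat | Lower nat

fun label :: "node \<Rightarrow> nat" where
  "label (Upper i) = i"
| "label (Lower i) = i"

definition nodes :: "nat \<Rightarrow> node set" where
  "nodes N = Upper ` {1..N} \<union> Lower ` {1..N}"

text \<open>An edge is the two-element set of its end points; a tangle is a set of edges.\<close>

type_synonym edge = "node set"

definition tangle :: "nat \<Rightarrow> edge set \<Rightarrow> bool" where
  "tangle N X \<longleftrightarrow>
     (\<forall>e\<in>X. \<exists>x\<in>nodes N. \<exists>y\<in>nodes N. x \<noteq> y \<and> e = {x, y}) \<and>
     (\<forall>x\<in>nodes N. \<exists>!e. e \<in> X \<and> x \<in> e)"

definition id_tangle :: "nat \<Rightarrow> edge set" where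
  "id_tangle N = {{Upper i, Lower i} |i. 1 \<le> i \<and> i \<le> N}"

text \<open>
  Stacking \<open>X\<close> on top of \<open>Y\<close> gives a graph on three rows of nodes, in which the lower row of
  \<open>X\<close> and the upper row of \<open>Y\<close> are merged into the middle row. An edge of the composition joins
  two distinct outer nodes that are connected by a path; internal loops meet no outer node.
\<close>

datatype snode = Top nat | Middle nat | Bottom nat

fun in_upper_factor :: "node \<Rightarrow> snode" where
  "in_upper_factor (Upper i) = Top i"
| "in_upper_factor (Lower i) = Middle i"

fun in_lower_factor :: "node \<Rightarrow> snode" where
  "in_lower_factor (Upper i) = Middle i"
| "in_lower_factor (Lower i) = Bottom i"

fun outer :: "node \<Rightarrow> snode" where
  "outer (Upper i) = Top i"
| "outer (Lower i) = Bottom i"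

definition stack_adj :: "edge set \<Rightarrow> edge set \<Rightarrow> (snode \<times> snode) set" where
  "stack_adj X Y =
     {(in_upper_factor x, in_upper_factor y) |x y. {x, y} \<in> X} \<union>
     {(in_lower_factor x, in_lower_factor y) |x y. {x, y} \<in> Y}"

definition tcomp :: "edge set \<Rightarrow> edge set \<Rightarrow> edge set" where
  "tcomp X Y = {{x, y} |x y. x \<noteq> y \<and> (outer x, outer y) \<in> (stack_adj X Y)\<^sup>*}"

section \<open>Primes and factorizations\<close>

datatype tprime = TPrime nat | UPrime nat

fun index :: "tprime \<Rightarrow> nat" where
  "index (TPrime i) = i"
| "index (UPrime i) = i"

fun is_T :: "tprime \<Rightarrow> bool" where
  "is_T (TPrime i) = True"
| "is_T (UPrime i) = False"

type_synonym tword = "tprime list"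

fun prime_tangle :: "nat \<Rightarrow> tprime \<Rightarrow> edge set" where
  "prime_tangle N (TPrime i) =
     (id_tangle N - {{Upper i, Lower i}, {Upper (i + 1), Lower (i + 1)}})
       \<union> {{Upper i, Lower (i + 1)}, {Upper (i + 1), Lower i}}"
| "prime_tangle N (UPrime i) =
     (id_tangle N - {{Upper i, Lower i}, {Upper (i + 1), Lower (i + 1)}})
       \<union> {{Upper i, Upper (i + 1)}, {Lower i, Lower (i + 1)}}"

definition is_word :: "nat \<Rightarrow> tword \<Rightarrow> bool" where
  "is_word N w \<longleftrightarrow> (\<forall>p\<in>set w. 1 \<le> index p \<and> index p < N)"

fun word_tangle :: "nat \<Rightarrow> tword \<Rightarrow> edge set" where
  "word_tangle N [] = id_tangle N"
| "word_tangle N (p # w) = tcomp (prime_tangle N p) (word_tangle N w)"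

definition factorization :: "nat \<Rightarrow> edge set \<Rightarrow> tword \<Rightarrow> bool" where
  "factorization N X w \<longleftrightarrow> is_word N w \<and> word_tangle N w = X"

definition minimal_word :: "nat \<Rightarrow> tword \<Rightarrow> bool" where
  "minimal_word N w \<longleftrightarrow> is_word N w \<and>
     (\<forall>v. factorization N (word_tangle N w) v \<longrightarrow> length w \<le> length v)"

definition num_T_primes :: "tword \<Rightarrow> nat" where
  "num_T_primes w = length (filter is_T w)"

definition tangle_length :: "nat \<Rightarrow> edge set \<Rightarrow> nat" where
  "tangle_length N X = (LEAST n. \<exists>w. factorization N X w \<and> length w = n)"

section \<open>Crossings and the length formula\<close>

text \<open>Position of a node in the cyclic order \<open>1, \<dots>, N, N', \<dots>, 1'\<close>.\<close>

fun cyclic_pos :: "nat \<Rightarrow> node \<Rightarrow> nat" where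
  "cyclic_pos N (Upper i) = i"
| "cyclic_pos N (Lower i) = 2 * N + 1 - i"

definition crosses :: "nat \<Rightarrow> edge \<Rightarrow> edge \<Rightarrow> bool" where
  "crosses N e f \<longleftrightarrow> (\<exists>a b c d. e = {a, b} \<and> f = {c, d} \<and>
     (cyclic_pos N a < cyclic_pos N c \<and> cyclic_pos N c < cyclic_pos N b \<and>
        cyclic_pos N b < cyclic_pos N d \<or>
      cyclic_pos N c < cyclic_pos N a \<and> cyclic_pos N a < cyclic_pos N d \<and>
        cyclic_pos N d < cyclic_pos N b))"

definition num_crossings :: "nat \<Rightarrow> edge set \<Rightarrow> nat" where
  "num_crossings N X = card {{e, f} |e f. e \<in> X \<and> f \<in> X \<and> crosses N e f}"

definition edge_crossings :: "nat \<Rightarrow> edge set \<Rightarrow> edge \<Rightarrow> nat" where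
  "edge_crossings N X e = card {f \<in> X. crosses N e f}"

definition edge_size :: "edge \<Rightarrow> nat" where
  "edge_size e = (THE d. \<exists>x y. e = {x, y} \<and> d = nat \<bar>int (label x) - int (label y)\<bar>)"

definition length_formula :: "nat \<Rightarrow> edge set \<Rightarrow> real" where
  "length_formula N X = 1 / 2 * (\<Sum>e\<in>X. real (max (edge_crossings N X e) (edge_size e)))"

section \<open>Rewriting rules\<close>

definition adjacent :: "nat \<Rightarrow> nat \<Rightarrow> bool" where
  "adjacent i j \<longleftrightarrow> \<bar>int i - int j\<bar> = 1"

definition distant :: "nat \<Rightarrow> nat \<Rightarrow> bool" where
  "distant i j \<longleftrightarrow> \<bar>int i - int j\<bar> > 1"

inductive delete_rule :: "tword \<Rightarrow> tword \<Rightarrow> bool" where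
  "delete_rule [TPrime i, TPrime i] []"
| "delete_rule [UPrime i, UPrime i] [UPrime i]"
| "delete_rule [TPrime i, UPrime i] [UPrime i]"
| "delete_rule [UPrime i, TPrime i] [UPrime i]"
| "adjacent i j \<Longrightarrow> delete_rule [UPrime i, UPrime j, UPrime i] [UPrime i]"
| "adjacent i j \<Longrightarrow> delete_rule [UPrime i, TPrime j, UPrime i] [UPrime i]"
| "adjacent i j \<Longrightarrow> delete_rule [TPrime i, UPrime j, UPrime i] [TPrime j, UPrime i]"
| "adjacent i j \<Longrightarrow> delete_rule [UPrime i, UPrime j, TPrime i] [UPrime i, TPrime j]"
| "adjacent i j \<Longrightarrow> delete_rule [UPrime i, TPrime j, TPrime i] [UPrime i, UPrime j]"
| "adjacent i j \<Longrightarrow> delete_rule [TPrime i, TPrime j, UPrime i] [UPrime j, UPrime i]"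

text \<open>The braid and swap rules are symmetric in \<open>i\<close> and \<open>j\<close>, so they apply in both directions.\<close>

inductive braid_rule :: "tword \<Rightarrow> tword \<Rightarrow> bool" where
  "adjacent i j \<Longrightarrow> braid_rule [TPrime i, TPrime j, TPrime i] [TPrime j, TPrime i, TPrime j]"
| "adjacent i j \<Longrightarrow> braid_rule [TPrime i, UPrime j, TPrime i] [TPrime j, UPrime i, TPrime j]"

inductive swap_rule :: "tword \<Rightarrow> tword \<Rightarrow> bool" where
  "distant (index p) (index q) \<Longrightarrow> swap_rule [p, q] [q, p]"

inductive rewrite_step :: "tword \<Rightarrow> tword \<Rightarrow> bool" where
  "delete_rule l r \<or> braid_rule l r \<or> swap_rule l r \<Longrightarrow> rewrite_step (u @ l @ v) (u @ r @ v)"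

section \<open>The two assumptions\<close>

definition rewriting_reaches_minimal :: bool where
  "rewriting_reaches_minimal \<longleftrightarrow>
     (\<forall>N w. is_word N w \<longrightarrow> (\<exists>v. rewrite_step\<^sup>*\<^sup>* w v \<and> minimal_word N v))"

definition crossings_are_T_primes :: bool where
  "crossings_are_T_primes \<longleftrightarrow>
     (\<forall>N X. tangle N X \<longrightarrow>
        (\<exists>w. factorization N X w \<and> minimal_word N w \<and> num_T_primes w = num_crossings N X) \<and>
        (\<forall>w. factorization N X w \<longrightarrow> num_crossings N X \<le> num_T_primes w))"

section \<open>Running time\<close>

text \<open>
  A word RAM with structured programs: registers and a memory, both holding natural numbers.
  Every elementary instruction and every test costs one unit. There is no multiplication, and an
  instruction only executes if its result is at most the word bound \<open>W\<close>, so that large numbers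
  cannot be used to pack many elementary operations into one. Subtraction is truncated at 0.
\<close>

type_synonym mstate = "(nat \<Rightarrow> nat) \<times> (nat \<Rightarrow> nat)"

datatype com =
    SetConst nat nat
  | Add nat nat nat
  | Sub nat nat nat
  | Half nat nat
  | Load nat nat
  | Store nat nat
  | Seq com com
  | IfLess nat nat com com
  | WhileLess nat nat com

text \<open>\<open>exec W c s t s'\<close>: started in \<open>s\<close>, the program \<open>c\<close> halts in \<open>s'\<close> at total cost \<open>t\<close>.\<close>

inductive exec :: "nat \<Rightarrow> com \<Rightarrow> mstate \<Rightarrow> nat \<Rightarrow> mstate \<Rightarrow> bool" for W where
  "n \<le> W \<Longrightarrow> exec W (SetConst r n) (R, M) 1 (R(r := n), M)"
| "R a + R b \<le> W \<Longrightarrow> exec W (Add r a b) (R, M) 1 (R(r := R a + R b), M)"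
| "exec W (Sub r a b) (R, M) 1 (R(r := R a - R b), M)"
| "exec W (Half r a) (R, M) 1 (R(r := R a div 2), M)"
| "exec W (Load r a) (R, M) 1 (R(r := M (R a)), M)"
| "exec W (Store a b) (R, M) 1 (R, M(R a := R b))"
| "exec W c1 s t1 s' \<Longrightarrow> exec W c2 s' t2 s'' \<Longrightarrow> exec W (Seq c1 c2) s (t1 + t2) s''"
| "R a < R b \<Longrightarrow> exec W c1 (R, M) t s' \<Longrightarrow> exec W (IfLess a b c1 c2) (R, M) (Suc t) s'"
| "\<not> R a < R b \<Longrightarrow> exec W c2 (R, M) t s' \<Longrightarrow> exec W (IfLess a b c1 c2) (R, M) (Suc t) s'"
| "\<not> R a < R b \<Longrightarrow> exec W (WhileLess a b c) (R, M) 1 (R, M)"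
| "R a < R b \<Longrightarrow> exec W c (R, M) t1 s' \<Longrightarrow> exec W (WhileLess a b c) s' t2 s'' \<Longrightarrow>
     exec W (WhileLess a b c) (R, M) (Suc (t1 + t2)) s''"

definition init_state :: "nat list \<Rightarrow> mstate" where
  "init_state xs = (\<lambda>_. 0, \<lambda>i. if i < length xs then xs ! i else 0)"

text \<open>
  \<open>P N xs r\<close> says that for the input \<open>xs\<close> of size parameter \<open>N\<close> the required output is \<open>r\<close>.
  One program serves all \<open>N\<close>; its words have \<open>O(log N)\<close> bits, and the output is read from
  register 0.
\<close>

definition computable_in_time :: "(nat \<Rightarrow> nat list \<Rightarrow> real \<Rightarrow> bool) \<Rightarrow> (nat \<Rightarrow> real) \<Rightarrow> bool" where
  "computable_in_time P g \<longleftrightarrow>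
     (\<exists>c d time. (\<lambda>N. real (time N)) \<in> O(g) \<and>
        (\<forall>N xs r. P N xs r \<longrightarrow>
           (\<exists>t R M. exec ((N + 2) ^ d) c (init_state xs) t (R, M) \<and> t \<le> time N \<and> real (R 0) = r)))"

text \<open>
  A tangle is given to the program as a list of its edges, in any order and with the two end
  points of each edge in any order; a node is its label together with the number of its row.
\<close>

definition edge_listing :: "edge set \<Rightarrow> (node \<times> node) list \<Rightarrow> bool" where
  "edge_listing X es \<longleftrightarrow>
     distinct (map (\<lambda>(x, y). {x, y}) es) \<and> set (map (\<lambda>(x, y). {x, y}) es) = X"

fun encode_node :: "node \<Rightarrow> nat list" where
  "encode_node (Upper i) = [i, 0]"
| "encode_node (Lower i) = [i, 1]"

definition encode_tangle :: "nat \<Rightarrow> (node \<times> node) list \<Rightarrow> nat list" where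
  "encode_tangle N es = N # concat (map (\<lambda>(x, y). encode_node x @ encode_node y) es)"

definition encode_with_crossings :: "nat \<Rightarrow> edge set \<Rightarrow> (node \<times> node) list \<Rightarrow> nat list" where
  "encode_with_crossings N X es =
     N # concat (map (\<lambda>(x, y). encode_node x @ encode_node y @ [edge_crossings N X {x, y}]) es)"

definition formula_from_tangle :: "nat \<Rightarrow> nat list \<Rightarrow> real \<Rightarrow> bool" where
  "formula_from_tangle N xs r \<longleftrightarrow>
     (\<exists>X es. tangle N X \<and> edge_listing X es \<and> xs = encode_tangle N es \<and> r = length_formula N X)"

definition formula_from_crossings :: "nat \<Rightarrow> nat list \<Rightarrow> real \<Rightarrow> bool" where
  "formula_from_crossings N xs r \<longleftrightarrow>
     (\<exists>X es. tangle N X \<and> edge_listing X es \<and> xs = encode_with_crossings N X es \<and>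
        r = length_formula N X)"

end

theory Submission
  imports Defs
begin

text \<open>
  Let \<open>L X = 2 * l_P X\<close> be the sum of the edge weights \<open>max (#T e) |e|\<close>. Multiplying by a \<open>T\<close>-prime moves
  two end points by one and toggles one crossing, and multiplying by a \<open>U\<close>-prime joins two edges into
  one whose size and crossings are at most the sums; either way \<open>L\<close> grows by at most 2, so
  \<open>l_P \<le> l\<close>. Conversely, every tangle other than the identity is a prime times a tangle whose \<open>L\<close> is
  smaller by 2, so \<open>l \<le> l_P\<close>.

  To find that prime, walk along the upper row to a place where an edge pointing right is followed by
  one that does not: these two edges cross, and a \<open>T\<close>-prime removes the crossing, or they form a hook
  \<open>{i, i + 1}\<close>. If no \<open>T\<close>-prime works, there is such a hook, and a \<open>U\<close>-prime can cut another edge above or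
  below it. A hook above it always serves, so assume all upper hooks join neighbours. The crossing number of
  a vertical edge \<open>(x, v')\<close> is \<open>v - x\<close> plus twice the difference of the numbers of certain vertical edges
  and hooks on its right, and symmetrically on its left. Using this count, a vertical edge over the hook
  with fewer crossings than its size serves if it is closest to the hook. If there is none, a counting
  argument provides a lower hook below \<open>{i, i + 1}\<close> that serves.
\<close>

subsection \<open>Tangles\<close>

text \<open>Why 2 is the right amount for a \<open>U\<close>-prime: if an edge \<open>e\<close> is
  cut at a hook \<open>{i, i + 1}\<close> that it spans, the sizes of the two pieces add up to
  \<open>|e| - 1\<close>, and the hook of weight 1 disappears. So the cut gains 2 as soon as neither
  piece has more crossings than its size and no other edge gains weight. The first condition is
  automatic for pieces that are hooks, since a hook covers fewer nodes than its size; for vertical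
  pieces it is read off from the crossing count. The second one can only fail at a vertical edge
  that crosses both pieces and so gains two crossings. Excluding such edges is what forces the
  extremal choices: the edge nearest to the hook, and a lower hook with no edge over it. Primes are
  composed only on top, so the search follows the upper row; the lower row enters through counting,
  mainly because both rows carry equally many hooks.\<close>

lemma Upper_in_nodes [simp]: "Upper i \<in> nodes N \<longleftrightarrow> 1 \<le> i \<and> i \<le> N"
  and Lower_in_nodes [simp]: "Lower i \<in> nodes N \<longleftrightarrow> 1 \<le> i \<and> i \<le> N"
  by (auto simp: nodes_def)

lemma finite_nodes [simp]: "finite (nodes N)"
  by (simp add: nodes_def)

lemma tangle_edgeE:
  assumes "tangle N X" "e \<in> X"
  obtains x y where "x \<in> nodes N" "y \<in> nodes N" "x \<noteq> y" "e = {x, y}"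
proof -
  have "\<exists>x\<in>nodes N. \<exists>y\<in>nodes N. x \<noteq> y \<and> e = {x, y}"
    using assms by (simp add: tangle_def)
  then show ?thesis using that by blast
qed

lemma tangle_edgeD:
  assumes "tangle N X" "{x, y} \<in> X"
  shows "x \<in> nodes N" "y \<in> nodes N" "x \<noteq> y"
proof -
  obtain u v where "u \<in> nodes N" "v \<in> nodes N" "u \<noteq> v" "{x, y} = {u, v}"
    by (rule tangle_edgeE[OF assms])
  then show "x \<in> nodes N" "y \<in> nodes N" "x \<noteq> y"
    by (auto simp: doubleton_eq_iff)
qed

lemma tangle_edge_unique:
  assumes "tangle N X" "e \<in> X" "f \<in> X" "x \<in> e" "x \<in> f"
  shows "e = f"
proof -
  have "x \<in> nodes N"
    using tangle_edgeE[OF assms(1,2)] assms(4) by (metis insert_iff singletonD)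
  then have "\<exists>!e. e \<in> X \<and> x \<in> e"
    using assms(1) by (simp add: tangle_def)
  then show ?thesis
    using assms by blast
qed

lemma tangle_partner_unique:
  assumes "tangle N X" "{x, y} \<in> X" "{x, z} \<in> X"
  shows "y = z"
  using tangle_edge_unique[OF assms, of x] by (auto simp: doubleton_eq_iff)

lemma tangle_partnerE:
  assumes "tangle N X" "x \<in> nodes N"
  obtains y where "{x, y} \<in> X"
proof -
  have "\<exists>!e. e \<in> X \<and> x \<in> e"
    using assms by (simp add: tangle_def)
  then obtain e where "e \<in> X" "x \<in> e" by blast
  then obtain y where "e = {x, y}"
    using tangle_edgeE[OF assms(1) \<open>e \<in> X\<close>] by (metis insert_commute insert_iff singletonD)
  then show ?thesis using that \<open>e \<in> X\<close> by simp
qed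

lemma tangleI:
  assumes "\<And>e. e \<in> X \<Longrightarrow> \<exists>x\<in>nodes N. \<exists>y\<in>nodes N. x \<noteq> y \<and> e = {x, y}"
    and "\<And>x. x \<in> nodes N \<Longrightarrow> \<exists>e\<in>X. x \<in> e"
    and "\<And>x e f. e \<in> X \<Longrightarrow> f \<in> X \<Longrightarrow> x \<in> e \<Longrightarrow> x \<in> f \<Longrightarrow> e = f"
  shows "tangle N X"
  using assms unfolding tangle_def by blast

lemma finite_tangle:
  assumes "tangle N X"
  shows "finite X"
proof (rule finite_subset)
  show "X \<subseteq> Pow (nodes N)"
    using tangle_edgeE[OF assms] by auto
qed simp

lemma tangle_id: "tangle N (id_tangle N)"
proof (rule tangleI)
  show "\<exists>x\<in>nodes N. \<exists>y\<in>nodes N. x \<noteq> y \<and> e = {x, y}" if e: "e \<in> id_tangle N" for e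
  proof -
    obtain i where "e = {Upper i, Lower i}" "1 \<le> i" "i \<le> N"
      using e unfolding id_tangle_def by auto
    then show ?thesis by (intro bexI[of _ "Upper i"] bexI[of _ "Lower i"]) auto
  qed
  show "\<exists>e\<in>id_tangle N. x \<in> e" if "x \<in> nodes N" for x
    using that unfolding id_tangle_def nodes_def
    by (intro bexI[of _ "{Upper (label x), Lower (label x)}"]) auto
qed (auto simp: id_tangle_def)

lemma id_tangle_iff [simp]:
  "{Upper i, Upper j} \<in> id_tangle N \<longleftrightarrow> False"
  "{Lower i, Lower j} \<in> id_tangle N \<longleftrightarrow> False"
  "{Upper i, Lower j} \<in> id_tangle N \<longleftrightarrow> i = j \<and> 1 \<le> i \<and> i \<le> N"
  "{Lower j, Upper i} \<in> id_tangle N \<longleftrightarrow> i = j \<and> 1 \<le> i \<and> i \<le> N"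
  by (auto simp: id_tangle_def doubleton_eq_iff)

text \<open>Both are perfect matchings of the same nodes, so the edge of \<open>X\<close> at an end
  of an edge of \<open>Y\<close> must be that edge. One inclusion thus suffices to identify a
  composition.\<close>

lemma tangle_subset_eq:
  assumes "tangle N X" "tangle N Y" "X \<subseteq> Y"
  shows "X = Y"
proof
  show "Y \<subseteq> X"
  proof
    fix e assume e: "e \<in> Y"
    then obtain x y where x: "x \<in> nodes N" "e = {x, y}"
      using tangle_edgeE[OF assms(2)] by metis
    obtain z where "{x, z} \<in> X"
      using tangle_partnerE[OF assms(1) x(1)] .
    then show "e \<in> X"
      using tangle_partner_unique[OF assms(2)] assms(3) x e by blast
  qed
qed (rule assms)

subsection \<open>Rewiring two edges\<close>

text \<open>The one local move behind both primes: the order of the arguments decides which ends are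
  joined, so that \<open>T\<close>- and \<open>U\<close>-primes act by the same operation, and its
  inverse has the same form.\<close>

definition rewire :: "edge set \<Rightarrow> node \<Rightarrow> node \<Rightarrow> node \<Rightarrow> node \<Rightarrow> edge set" where
  "rewire X p q r s = X - {{p, q}, {r, s}} \<union> {{p, r}, {q, s}}"

lemma rewire_nodes_distinct:
  assumes "tangle N X" "{p, q} \<in> X" "{r, s} \<in> X" "{p, q} \<noteq> {r, s}"
  shows "p \<noteq> q" "r \<noteq> s" "p \<noteq> r" "p \<noteq> s" "q \<noteq> r" "q \<noteq> s"
proof -
  have "x \<notin> {r, s}" if "x \<in> {p, q}" for x
    using tangle_edge_unique[OF assms(1-3) that] assms(4) by blast
  then show "p \<noteq> r" "p \<noteq> s" "q \<noteq> r" "q \<noteq> s" by auto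
  show "p \<noteq> q" "r \<noteq> s" using tangle_edgeD[OF assms(1)] assms(2,3) by auto
qed

lemma rewire_other_edges:
  assumes "tangle N X" "{p, q} \<in> X" "{r, s} \<in> X" "g \<in> X" "g \<noteq> {p, q}" "g \<noteq> {r, s}"
  shows "p \<notin> g" "q \<notin> g" "r \<notin> g" "s \<notin> g"
  using tangle_edge_unique[OF assms(1,4,2)] tangle_edge_unique[OF assms(1,4,3)] assms(5,6)
  by (metis insertI1 insertI2 singletonI)+

lemma tangle_rewire:
  assumes "tangle N X" "{p, q} \<in> X" "{r, s} \<in> X" "{p, q} \<noteq> {r, s}"
  shows "tangle N (rewire X p q r s)"
proof (rule tangleI)
  note d = rewire_nodes_distinct[OF assms]
  note o = rewire_other_edges[OF assms(1-3)]
  note n = tangle_edgeD[OF assms(1,2)] tangle_edgeD[OF assms(1,3)]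
  have cases: "e = {p, r} \<or> e = {q, s} \<or> e \<in> X \<and> p \<notin> e \<and> q \<notin> e \<and> r \<notin> e \<and> s \<notin> e"
    if "e \<in> rewire X p q r s" for e
    using that o[of e] unfolding rewire_def by auto
  show "\<exists>x\<in>nodes N. \<exists>y\<in>nodes N. x \<noteq> y \<and> e = {x, y}" if "e \<in> rewire X p q r s" for e
    using cases[OF that]
  proof (elim disjE conjE)
    assume "e \<in> X"
    then show ?thesis using tangle_edgeE[OF assms(1)] by metis
  next
    assume "e = {p, r}"
    then show ?thesis using n d by (intro bexI[of _ p] bexI[of _ r]) auto
  next
    assume "e = {q, s}"
    then show ?thesis using n d by (intro bexI[of _ q] bexI[of _ s]) auto
  qed
  show "\<exists>e\<in>rewire X p q r s. x \<in> e" if "x \<in> nodes N" for x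
  proof (cases "x \<in> {p, q, r, s}")
    case True
    then show ?thesis by (auto simp: rewire_def)
  next
    case False
    obtain y where "{x, y} \<in> X" using tangle_partnerE[OF assms(1) \<open>x \<in> nodes N\<close>] .
    then show ?thesis using False unfolding rewire_def by (intro bexI[of _ "{x, y}"]) auto
  qed
  show "e = f" if "e \<in> rewire X p q r s" "f \<in> rewire X p q r s" "x \<in> e" "x \<in> f" for x e f
  proof (cases "e \<in> X \<and> f \<in> X")
    case True
    then show ?thesis using tangle_edge_unique[OF assms(1)] that(3,4) by blast
  next
    case False
    then show ?thesis using cases[OF that(1)] cases[OF that(2)] that(3,4) d by auto
  qed
qed

lemma rewire_decomp:
  assumes "tangle N X" "{p, q} \<in> X" "{r, s} \<in> X" "{p, q} \<noteq> {r, s}"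
  defines "Z \<equiv> X - {{p, q}, {r, s}}"
  shows "finite Z" "X = insert {p, q} (insert {r, s} Z)"
    "rewire X p q r s = insert {p, r} (insert {q, s} Z)"
    "{p, q} \<notin> insert {r, s} Z" "{r, s} \<notin> Z" "{p, r} \<notin> insert {q, s} Z" "{q, s} \<notin> Z"
proof -
  note d = rewire_nodes_distinct[OF assms(1-4)]
  note o = rewire_other_edges[OF assms(1-3)]
  show "finite Z" using finite_tangle[OF assms(1)] unfolding Z_def by simp
  show "{q, s} \<notin> Z" using o(2)[of "{q, s}"] unfolding Z_def by blast
  have "{p, r} \<notin> Z" using o(1)[of "{p, r}"] unfolding Z_def by blast
  then show "{p, r} \<notin> insert {q, s} Z" using d by (auto simp: doubleton_eq_iff)
  show "X = insert {p, q} (insert {r, s} Z)" using assms unfolding Z_def by auto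
  show "rewire X p q r s = insert {p, r} (insert {q, s} Z)" by (simp add: rewire_def Z_def)
qed (use assms in auto)

lemma rewire_rewire:
  assumes "tangle N X" "{p, q} \<in> X" "{r, s} \<in> X" "{p, q} \<noteq> {r, s}"
  shows "rewire (rewire X p q r s) p r q s = X"
proof -
  note d = rewire_decomp[OF assms]
  show ?thesis
    unfolding rewire_def[of "rewire X p q r s"] using d(2,6,7) by (subst d(3)) auto
qed

subsection \<open>Crossings and edge weights\<close>

lemma cyclic_pos_inj:
  assumes "x \<in> nodes N" "y \<in> nodes N"
  shows "cyclic_pos N x = cyclic_pos N y \<longleftrightarrow> x = y"
  using assms by (cases x; cases y) auto

text \<open>Opening the circle between \<open>1'\<close> and \<open>1\<close> turns one of the two
  arcs from \<open>u\<close> to \<open>v\<close> into an interval of positions. Chords cross when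
  exactly one end of the second lies in that arc of the first.\<close>

definition separates :: "nat \<Rightarrow> node \<Rightarrow> node \<Rightarrow> node \<Rightarrow> bool" where
  "separates N u v x \<longleftrightarrow> min (cyclic_pos N u) (cyclic_pos N v) < cyclic_pos N x \<and>
     cyclic_pos N x < max (cyclic_pos N u) (cyclic_pos N v)"

lemma separates_commute: "separates N u v x = separates N v u x"
  by (simp add: separates_def min.commute max.commute)

lemma ex_doubletons:
  "(\<exists>a b c d. {u, v} = {a, b} \<and> {x, y} = {c, d} \<and> Q a b c d) \<longleftrightarrow>
    Q u v x y \<or> Q u v y x \<or> Q v u x y \<or> Q v u y x"
  unfolding doubleton_eq_iff by blast

text \<open>The four disjuncts are the four ways of naming the ends of two unordered edges in
  \<open>crosses\<close>. Since \<open>u \<le> v\<close> and no end is shared, every point is above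
  \<open>u\<close> or below \<open>v\<close>; the rest is propositional.\<close>

lemma interleave_iff_separated:
  fixes u v x y :: nat
  assumes "u \<noteq> x" "u \<noteq> y" "v \<noteq> x" "v \<noteq> y" "u \<le> v"
  shows "(u < x \<and> x < v \<and> v < y \<or> x < u \<and> u < y \<and> y < v) \<or>
      (u < y \<and> y < v \<and> v < x \<or> y < u \<and> u < x \<and> x < v) \<or>
      (v < x \<and> x < u \<and> u < y \<or> x < v \<and> v < y \<and> y < u) \<or>
      (v < y \<and> y < u \<and> u < x \<or> y < v \<and> v < x \<and> x < u)
    \<longleftrightarrow> ((u < x \<and> x < v) \<noteq> (u < y \<and> y < v))"
proof -
  have "x < u \<longleftrightarrow> \<not> u < x" "v < x \<longleftrightarrow> \<not> x < v" "y < u \<longleftrightarrow> \<not> u < y" "v < y \<longleftrightarrow> \<not> y < v"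
    "u < x \<or> x < v" "u < y \<or> y < v"
    using assms by linarith+
  then show ?thesis by argo
qed

lemma crosses_iff:
  assumes "u \<in> nodes N" "v \<in> nodes N" "x \<in> nodes N" "y \<in> nodes N"
    and "u \<notin> {x, y}" "v \<notin> {x, y}"
  shows "crosses N {u, v} {x, y} \<longleftrightarrow> separates N u v x \<noteq> separates N u v y"
proof -
  let ?P = "cyclic_pos N"
  have d: "?P u \<noteq> ?P x" "?P u \<noteq> ?P y" "?P v \<noteq> ?P x" "?P v \<noteq> ?P y"
    using assms by (auto simp: cyclic_pos_inj)
  have ordered: "crosses N {u, v} {x, y} \<longleftrightarrow> separates N u v x \<noteq> separates N u v y"
    if "?P u \<le> ?P v" "?P u \<noteq> ?P x" "?P u \<noteq> ?P y" "?P v \<noteq> ?P x" "?P v \<noteq> ?P y" for u v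
  proof -
    have "crosses N {u, v} {x, y} \<longleftrightarrow>
       (?P u < ?P x \<and> ?P x < ?P v \<and> ?P v < ?P y \<or> ?P x < ?P u \<and> ?P u < ?P y \<and> ?P y < ?P v) \<or>
       (?P u < ?P y \<and> ?P y < ?P v \<and> ?P v < ?P x \<or> ?P y < ?P u \<and> ?P u < ?P x \<and> ?P x < ?P v) \<or>
       (?P v < ?P x \<and> ?P x < ?P u \<and> ?P u < ?P y \<or> ?P x < ?P v \<and> ?P v < ?P y \<and> ?P y < ?P u) \<or>
       (?P v < ?P y \<and> ?P y < ?P u \<and> ?P u < ?P x \<or> ?P y < ?P v \<and> ?P v < ?P x \<and> ?P x < ?P u)"
      unfolding crosses_def by (rule ex_doubletons)
    also have "\<dots> \<longleftrightarrow> separates N u v x \<noteq> separates N u v y"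
      using that by (subst interleave_iff_separated) (simp_all add: separates_def)
    finally show ?thesis .
  qed
  show ?thesis
  proof (cases "?P u \<le> ?P v")
    case True
    then show ?thesis using ordered[of u v] d by simp
  next
    case False
    then show ?thesis
      using ordered[of v u] d by (simp add: insert_commute separates_commute[of N u v])
  qed
qed

lemma crosses_sym: "crosses N e f \<longleftrightarrow> crosses N f e"
  unfolding crosses_def by blast

lemma not_crosses_self [simp]: "\<not> crosses N e e"
  unfolding crosses_def by (auto simp: doubleton_eq_iff)

lemma edge_size_pair: "edge_size {x, y} = (label x - label y) + (label y - label x)"
proof -
  have "nat \<bar>int (label a) - int (label b)\<bar> = (label x - label y) + (label y - label x)"
    if "{x, y} = {a, b}" for a b
    using that by (auto simp: doubleton_eq_iff)
  then show ?thesis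
    unfolding edge_size_def by (intro the_equality) (metis, blast)
qed

lemma edge_crossings_insert:
  assumes "finite Z" "e \<notin> Z"
  shows "edge_crossings N (insert e Z) g = of_bool (crosses N g e) + edge_crossings N Z g"
proof -
  have "{f \<in> insert e Z. crosses N g f} =
      (if crosses N g e then insert e {f \<in> Z. crosses N g f} else {f \<in> Z. crosses N g f})"
    by auto
  then show ?thesis using assms by (simp add: edge_crossings_def)
qed

definition edge_weight :: "nat \<Rightarrow> edge set \<Rightarrow> edge \<Rightarrow> nat" where
  "edge_weight N X e = max (edge_crossings N X e) (edge_size e)"

definition total_weight :: "nat \<Rightarrow> edge set \<Rightarrow> nat" where
  "total_weight N X = (\<Sum>e\<in>X. edge_weight N X e)"

lemma length_formula_eq: "length_formula N X = real (total_weight N X) / 2"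
  by (simp add: length_formula_def total_weight_def edge_weight_def)

text \<open>The four rewired edges are the only ones that tell the two counts apart. Stated as an
  equation of sums, because subtraction on naturals truncates.\<close>

lemma edge_crossings_rewire:
  assumes "tangle N X" "{p, q} \<in> X" "{r, s} \<in> X" "{p, q} \<noteq> {r, s}"
  shows "edge_crossings N (rewire X p q r s) g + of_bool (crosses N g {p, q}) + of_bool (crosses N g {r, s})
    = edge_crossings N X g + of_bool (crosses N g {p, r}) + of_bool (crosses N g {q, s})"
proof -
  define Z where "Z = X - {{p, q}, {r, s}}"
  note d = rewire_decomp[OF assms, folded Z_def]
  have "edge_crossings N X g = of_bool (crosses N g {p, q}) + of_bool (crosses N g {r, s}) + edge_crossings N Z g"
    using d by (subst d(2)) (simp add: edge_crossings_insert)
  moreover have "edge_crossings N (rewire X p q r s) g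
      = of_bool (crosses N g {p, r}) + of_bool (crosses N g {q, s}) + edge_crossings N Z g"
    using d by (subst d(3)) (simp add: edge_crossings_insert)
  ultimately show ?thesis by simp
qed

text \<open>With \<open>k = 0\<close> and \<open>l = 2\<close> this bounds the growth under a prime;
  with \<open>k = 2\<close> and \<open>l = 0\<close> it yields a descent. Only the two exchanged
  edges need a precise comparison.\<close>

lemma total_weight_rewire_le:
  assumes "tangle N X" "{p, q} \<in> X" "{r, s} \<in> X" "{p, q} \<noteq> {r, s}"
    and "\<And>g. g \<in> X \<Longrightarrow> g \<in> rewire X p q r s \<Longrightarrow> edge_weight N (rewire X p q r s) g \<le> edge_weight N X g"
    and "edge_weight N (rewire X p q r s) {p, r} + edge_weight N (rewire X p q r s) {q, s} + k
       \<le> edge_weight N X {p, q} + edge_weight N X {r, s} + l"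
  shows "total_weight N (rewire X p q r s) + k \<le> total_weight N X + l"
proof -
  define Z where "Z = X - {{p, q}, {r, s}}"
  note d = rewire_decomp[OF assms(1-4), folded Z_def]
  define X' where "X' = rewire X p q r s"
  have "total_weight N X' = edge_weight N X' {p, r} + edge_weight N X' {q, s} + (\<Sum>g\<in>Z. edge_weight N X' g)"
    unfolding total_weight_def using d(1,6,7) by (subst (1) X'_def, subst d(3)) simp
  moreover have "total_weight N X = edge_weight N X {p, q} + edge_weight N X {r, s} + (\<Sum>g\<in>Z. edge_weight N X g)"
    unfolding total_weight_def using d(1,4,5) by (subst (1) d(2)) simp
  moreover have "(\<Sum>g\<in>Z. edge_weight N X' g) \<le> (\<Sum>g\<in>Z. edge_weight N X g)"
    using assms(5) d(2,3) unfolding X'_def by (intro sum_mono) blast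
  ultimately show ?thesis
    using assms(6) unfolding X'_def by linarith
qed

subsection \<open>The action of the primes on tangles\<close>

definition edge_at :: "edge set \<Rightarrow> node \<Rightarrow> edge" where
  "edge_at X x = (THE e. e \<in> X \<and> x \<in> e)"

lemma edge_at_eq:
  assumes "tangle N X" "e \<in> X" "x \<in> e"
  shows "edge_at X x = e"
  unfolding edge_at_def
proof (rule the_equality)
  show "f = e" if "f \<in> X \<and> x \<in> f" for f
    using tangle_edge_unique[OF assms(1) _ assms(2) _ assms(3)] that by simp
qed (use assms in simp)

lemma edge_at_in:
  assumes "tangle N X" "x \<in> nodes N"
  shows "edge_at X x \<in> X" "x \<in> edge_at X x"
proof -
  obtain y where "{x, y} \<in> X"
    by (rule tangle_partnerE[OF assms])
  then have "edge_at X x = {x, y}"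
    by (rule edge_at_eq[OF assms(1)]) simp
  then show "edge_at X x \<in> X" "x \<in> edge_at X x"
    using \<open>{x, y} \<in> X\<close> by auto
qed

lemma stack_adj_sym: "(s, t) \<in> stack_adj X Y \<Longrightarrow> (t, s) \<in> stack_adj X Y"
  unfolding stack_adj_def by (auto; metis insert_commute)

lemma stack_path_sym: "(s, t) \<in> (stack_adj X Y)\<^sup>* \<Longrightarrow> (t, s) \<in> (stack_adj X Y)\<^sup>*"
  by (metis stack_adj_sym symI symD sym_rtrancl)

lemma stack_adj_upper: "{x, y} \<in> X \<Longrightarrow> (in_upper_factor x, in_upper_factor y) \<in> (stack_adj X Y)\<^sup>*"
  and stack_adj_lower: "{x, y} \<in> Y \<Longrightarrow> (in_lower_factor x, in_lower_factor y) \<in> (stack_adj X Y)\<^sup>*"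
  unfolding stack_adj_def by blast+

lemma outer_eq [simp]: "outer x = outer y \<longleftrightarrow> x = y"
  by (cases x; cases y) auto

lemma outer_in_factor [simp]:
  "outer x = in_upper_factor z \<longleftrightarrow> x = z \<and> (\<exists>i. x = Upper i)"
  "outer x = in_lower_factor z \<longleftrightarrow> x = z \<and> (\<exists>i. x = Lower i)"
  by (cases x; cases z; auto)+

lemma stack_adj_outer_nodes:
  assumes "tangle N X" "tangle N Y" "(outer x, t) \<in> stack_adj X Y"
  shows "x \<in> nodes N"
  using assms(3) tangle_edgeD(1)[OF assms(1)] tangle_edgeD(1)[OF assms(2)]
  unfolding stack_adj_def by auto

text \<open>The map \<open>K\<close> labels every node of the stack with the composite edge its component becomes.\<close>

lemma tcomp_eqI:
  assumes "tangle N X" "tangle N Y" "tangle N R"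
    and K_upper: "\<And>x y. {x, y} \<in> X \<Longrightarrow> K (in_upper_factor x) = K (in_upper_factor y)"
    and K_lower: "\<And>x y. {x, y} \<in> Y \<Longrightarrow> K (in_lower_factor x) = K (in_lower_factor y)"
    and K_outer: "\<And>x. x \<in> nodes N \<Longrightarrow> x \<in> K (outer x) \<and> K (outer x) \<in> R"
    and path: "\<And>x y. {x, y} \<in> R \<Longrightarrow> (outer x, outer y) \<in> (stack_adj X Y)\<^sup>*"
  shows "tcomp X Y = R"
proof
  have K_const: "K s = K t" if "(s, t) \<in> (stack_adj X Y)\<^sup>*" for s t
    using that
  proof (induction rule: rtrancl_induct)
    case (step t u)
    then show ?case using K_upper K_lower unfolding stack_adj_def by auto
  qed simp
  show "tcomp X Y \<subseteq> R"
  proof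
    fix e assume "e \<in> tcomp X Y"
    then obtain x y where e: "e = {x, y}" "x \<noteq> y" "(outer x, outer y) \<in> (stack_adj X Y)\<^sup>*"
      unfolding tcomp_def by blast
    \<comment> \<open>An outer point without a node is isolated in the stack, so a nontrivial path
      cannot start there.\<close>
    have node: "x \<in> nodes N" if xy: "x \<noteq> y" "(outer x, outer y) \<in> (stack_adj X Y)\<^sup>*" for x y
    proof -
      obtain t where "(outer x, t) \<in> stack_adj X Y"
        using xy by (metis converse_rtranclE outer_eq)
      then show ?thesis
        by (rule stack_adj_outer_nodes[OF assms(1,2)])
    qed
    have "x \<in> nodes N" "y \<in> nodes N"
      using node[OF e(2,3)] node[of y x] e(2) stack_path_sym[OF e(3)] by auto
    then have K: "x \<in> K (outer x)" "y \<in> K (outer x)" "K (outer x) \<in> R"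
      using K_outer K_const[OF e(3)] by auto
    \<comment> \<open>The label is an edge with two ends and contains the distinct nodes
      \<open>x\<close> and \<open>y\<close>, hence equals \<open>{x, y}\<close>.\<close>
    obtain u v where "K (outer x) = {u, v}"
      by (rule tangle_edgeE[OF assms(3) K(3)])
    then have "K (outer x) = {x, y}"
      using K(1,2) e(2) by auto
    then show "e \<in> R" using e(1) K(3) by simp
  qed
  show "R \<subseteq> tcomp X Y"
  proof
    fix e assume e: "e \<in> R"
    obtain x y where "x \<noteq> y" "e = {x, y}"
      by (rule tangle_edgeE[OF assms(3) e])
    then show "e \<in> tcomp X Y"
      unfolding tcomp_def using path e by blast
  qed
qed

lemma prime_tangle_T:
  "prime_tangle N (TPrime i) = rewire (id_tangle N) (Upper i) (Lower i) (Lower (i + 1)) (Upper (i + 1))"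
  by (simp add: rewire_def insert_commute)

lemma prime_tangle_U:
  "prime_tangle N (UPrime i) = rewire (id_tangle N) (Upper i) (Lower i) (Upper (i + 1)) (Lower (i + 1))"
  by (simp add: rewire_def)

declare prime_tangle.simps [simp del]

lemma tangle_prime:
  assumes "1 \<le> index p" "index p < N"
  shows "tangle N (prime_tangle N p)"
proof (cases p)
  case (TPrime i)
  then show ?thesis
    unfolding TPrime prime_tangle_T using assms TPrime tangle_id
    by (intro tangle_rewire) (auto simp: doubleton_eq_iff)
next
  case (UPrime i)
  then show ?thesis
    unfolding UPrime prime_tangle_U using assms UPrime tangle_id
    by (intro tangle_rewire) (auto simp: doubleton_eq_iff)
qed

lemma prime_edge_cases:
  assumes "{x, y} \<in> prime_tangle N p"
  obtains (straight) j where "{x, y} = {Upper j, Lower j}" "j \<noteq> index p" "j \<noteq> index p + 1"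
  | (T) "p = TPrime (index p)" "{x, y} = {Upper (index p), Lower (index p + 1)}"
  | (T') "p = TPrime (index p)" "{x, y} = {Upper (index p + 1), Lower (index p)}"
  | (U) "p = UPrime (index p)" "{x, y} = {Upper (index p), Upper (index p + 1)}"
  | (U') "p = UPrime (index p)" "{x, y} = {Lower (index p), Lower (index p + 1)}"
proof -
  have id: "\<exists>j. {x, y} = {Upper j, Lower j} \<and> j \<noteq> i \<and> j \<noteq> i + 1"
    if "{x, y} \<in> id_tangle N - {{Upper i, Lower i}, {Upper (i + 1), Lower (i + 1)}}" for i
    using that unfolding id_tangle_def by auto
  show thesis
  proof (cases p)
    case (TPrime i)
    then show thesis
      using assms id[of i] straight T T' unfolding prime_tangle.simps TPrime index.simps by blast
  next
    case (UPrime i)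
    then show thesis
      using assms id[of i] straight U U' unfolding prime_tangle.simps UPrime index.simps by blast
  qed
qed

lemma prime_straight_edge:
  assumes "1 \<le> j" "j \<le> N" "j \<noteq> index p" "j \<noteq> index p + 1"
  shows "{Upper j, Lower j} \<in> prime_tangle N p"
  using assms by (cases p) (auto simp: prime_tangle.simps doubleton_eq_iff)

text \<open>A \<open>T\<close>-prime on top only renames two upper nodes. As an involution on nodes
  it acts on whole tangles by images, so applying it twice gives back the tangle.\<close>

fun swap_upper :: "nat \<Rightarrow> node \<Rightarrow> node" where
  "swap_upper i (Upper j) = Upper (if j = i then i + 1 else if j = i + 1 then i else j)"
| "swap_upper i (Lower j) = Lower j"

lemma swap_upper_swap_upper [simp]: "swap_upper i (swap_upper i x) = x"
  by (cases x) auto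

lemma swap_upper_in_nodes:
  assumes "1 \<le> i" "i < N"
  shows "swap_upper i x \<in> nodes N \<longleftrightarrow> x \<in> nodes N"
  using assms by (cases x) auto

lemma swap_upper_eq_iff: "swap_upper i x = swap_upper i y \<longleftrightarrow> x = y"
  by (metis swap_upper_swap_upper)

lemma swap_upper_image_image [simp]: "swap_upper i ` swap_upper i ` e = e"
  by (simp add: image_image)

lemma tangle_swap_upper:
  assumes "tangle N X" "1 \<le> i" "i < N"
  shows "tangle N ((`) (swap_upper i) ` X)"
proof (rule tangleI)
  note n = swap_upper_in_nodes[OF assms(2,3)]
  show "\<exists>x\<in>nodes N. \<exists>y\<in>nodes N. x \<noteq> y \<and> e = {x, y}" if "e \<in> (`) (swap_upper i) ` X" for e
  proof -
    obtain f where f: "f \<in> X" "e = swap_upper i ` f" using \<open>e \<in> (`) (swap_upper i) ` X\<close> by blast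
    obtain x y where "x \<in> nodes N" "y \<in> nodes N" "x \<noteq> y" "f = {x, y}"
      by (rule tangle_edgeE[OF assms(1) f(1)])
    then show ?thesis
      using f(2) by (intro bexI[of _ "swap_upper i x"] bexI[of _ "swap_upper i y"])
        (auto simp: n swap_upper_eq_iff)
  qed
  show "\<exists>e\<in>(`) (swap_upper i) ` X. x \<in> e" if "x \<in> nodes N" for x
  proof -
    have "swap_upper i x \<in> nodes N" using that n by simp
    then obtain y where "{swap_upper i x, y} \<in> X" by (rule tangle_partnerE[OF assms(1)])
    then show ?thesis by (rule rev_image_eqI[THEN bexI[rotated]]) auto
  qed
  show "e = f" if ef: "e \<in> (`) (swap_upper i) ` X" "f \<in> (`) (swap_upper i) ` X" "x \<in> e" "x \<in> f" for x e f
  proof -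
    obtain e' f' where "e' \<in> X" "e = swap_upper i ` e'" "f' \<in> X" "f = swap_upper i ` f'"
      using ef(1,2) by blast
    moreover from this have "swap_upper i x \<in> e'" "swap_upper i x \<in> f'"
      using ef(3,4) by (auto simp: swap_upper_eq_iff)
    ultimately show ?thesis using tangle_edge_unique[OF assms(1)] by blast
  qed
qed

lemma tcomp_T:
  assumes "tangle N X" "1 \<le> i" "i < N"
  shows "tcomp (prime_tangle N (TPrime i)) X = (`) (swap_upper i) ` X"
proof -
  let ?\<tau> = "swap_upper i" and ?P = "prime_tangle N (TPrime i)"
  \<comment> \<open>A top node continues through the prime to the middle node with exchanged label;
    the edge of \<open>X\<close> found there, renamed back, is the composite edge of the
    component.\<close>
  define K where "K s = ?\<tau> ` edge_at X
    (case s of Top j \<Rightarrow> ?\<tau> (Upper j) | Middle j \<Rightarrow> Upper j | Bottom j \<Rightarrow> Lower j)" for s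
  have K: "K (outer x) = ?\<tau> ` edge_at X (?\<tau> x)" "K (in_lower_factor x) = ?\<tau> ` edge_at X x" for x
    by (cases x; simp add: K_def)+
  show ?thesis
  proof (rule tcomp_eqI[where K = K])
    show "tangle N ?P" using assms by (intro tangle_prime) auto
    show "K (in_upper_factor x) = K (in_upper_factor y)" if "{x, y} \<in> ?P" for x y
      using that by (cases rule: prime_edge_cases) (auto simp: K_def doubleton_eq_iff)
    show "K (in_lower_factor x) = K (in_lower_factor y)" if "{x, y} \<in> X" for x y
      using that edge_at_eq[OF assms(1) that] by (simp add: K)
    show "x \<in> K (outer x) \<and> K (outer x) \<in> (`) ?\<tau> ` X" if "x \<in> nodes N" for x
      using edge_at_in[OF assms(1), of "?\<tau> x"] that swap_upper_in_nodes[OF assms(2,3), of x]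
      unfolding K by (metis imageI swap_upper_swap_upper)
    have lift: "(outer (?\<tau> x), in_lower_factor x) \<in> (stack_adj ?P X)\<^sup>*" if "x \<in> nodes N" for x
    proof (cases x)
      case (Upper j)
      have "{?\<tau> (Upper j), Lower j} \<in> ?P"
        using that Upper prime_straight_edge[of j N "TPrime i"] by (auto simp: prime_tangle.simps)
      from stack_adj_upper[OF this] show ?thesis
        using Upper by simp
    qed simp
    show "(outer x, outer y) \<in> (stack_adj ?P X)\<^sup>*" if "{x, y} \<in> (`) ?\<tau> ` X" for x y
    proof -
      have "{?\<tau> x, ?\<tau> y} \<in> X"
      proof -
        obtain f where "f \<in> X" "{x, y} = ?\<tau> ` f" using \<open>{x, y} \<in> (`) ?\<tau> ` X\<close> by blast
        then have "?\<tau> ` {x, y} = f" by simp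
        then show ?thesis using \<open>f \<in> X\<close> by simp
      qed
      note e = this tangle_edgeD[OF assms(1) this]
      have "(outer x, in_lower_factor (?\<tau> x)) \<in> (stack_adj ?P X)\<^sup>*"
        using lift[OF e(2)] by simp
      also have "(in_lower_factor (?\<tau> x), in_lower_factor (?\<tau> y)) \<in> (stack_adj ?P X)\<^sup>*"
        by (rule stack_adj_lower[OF e(1)])
      also have "(in_lower_factor (?\<tau> y), outer y) \<in> (stack_adj ?P X)\<^sup>*"
        using stack_path_sym[OF lift[OF e(3)]] by simp
      finally show ?thesis .
    qed
  qed (use assms tangle_swap_upper in auto)
qed

lemma swap_upper_fixes: "x \<noteq> Upper i \<Longrightarrow> x \<noteq> Upper (i + 1) \<Longrightarrow> swap_upper i x = x"
  by (cases x) auto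

lemma tcomp_T_rewire:
  assumes "tangle N X" "1 \<le> i" "i < N" "{Upper i, a} \<in> X" "{b, Upper (i + 1)} \<in> X" "a \<noteq> Upper (i + 1)"
  shows "tcomp (prime_tangle N (TPrime i)) X = rewire X (Upper i) a b (Upper (i + 1))"
proof -
  have ne: "{Upper i, a} \<noteq> {b, Upper (i + 1)}"
    using assms(6) by (auto simp: doubleton_eq_iff)
  note d = rewire_nodes_distinct[OF assms(1,4,5) ne]
  have "rewire X (Upper i) a b (Upper (i + 1)) \<subseteq> (`) (swap_upper i) ` X"
  proof
    fix g assume "g \<in> rewire X (Upper i) a b (Upper (i + 1))"
    then consider "g \<in> X" "g \<noteq> {Upper i, a}" "g \<noteq> {b, Upper (i + 1)}"
      | "g = {Upper i, b}" | "g = {a, Upper (i + 1)}"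
      unfolding rewire_def by blast
    then show "g \<in> (`) (swap_upper i) ` X"
    proof cases
      case 1
      have "swap_upper i ` g = g"
        using rewire_other_edges(1,4)[OF assms(1,4,5) 1] swap_upper_fixes[of _ i]
        by (metis (no_types, lifting) image_cong image_ident)
      then show ?thesis using 1(1) by (metis imageI)
    next
      case 2
      have "g = swap_upper i ` {b, Upper (i + 1)}"
        using swap_upper_fixes[of b i] 2 d by auto
      then show ?thesis using assms(5) by blast
    next
      case 3
      have "g = swap_upper i ` {Upper i, a}"
        using swap_upper_fixes[of a i] 3 d by auto
      then show ?thesis using assms(4) by blast
    qed
  qed
  then show ?thesis
    using tangle_subset_eq tangle_rewire[OF assms(1,4,5) ne] tangle_swap_upper[OF assms(1-3)]
      tcomp_T[OF assms(1-3)] by metis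
qed

lemma tcomp_T_hook:
  assumes "tangle N X" "1 \<le> i" "i < N" "{Upper i, Upper (i + 1)} \<in> X"
  shows "tcomp (prime_tangle N (TPrime i)) X = X"
proof -
  have "X \<subseteq> (`) (swap_upper i) ` X"
  proof
    fix g assume g: "g \<in> X"
    have "swap_upper i ` g = g"
    proof (cases "g = {Upper i, Upper (i + 1)}")
      case False
      then have "Upper i \<notin> g" "Upper (i + 1) \<notin> g"
        using tangle_edge_unique[OF assms(1) g assms(4)] by blast+
      then show ?thesis
        using swap_upper_fixes[of _ i] by (metis (no_types, lifting) image_cong image_ident)
    qed auto
    then show "g \<in> (`) (swap_upper i) ` X" using g by (metis imageI)
  qed
  then show ?thesis
    using tangle_subset_eq assms(1) tangle_swap_upper[OF assms(1-3)] tcomp_T[OF assms(1-3)] by metis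
qed

text \<open>Lets a \<open>T\<close>-prime be split off: applying it to \<open>X\<close> gives a
  tangle from which the same prime leads back to \<open>X\<close>.\<close>

lemma tcomp_T_T:
  assumes "tangle N X" "1 \<le> i" "i < N"
  shows "tcomp (prime_tangle N (TPrime i)) (tcomp (prime_tangle N (TPrime i)) X) = X"
  using tcomp_T[OF assms] tcomp_T[OF tangle_swap_upper[OF assms] assms(2,3)] by (simp add: image_image)

text \<open>The hook of \<open>X\<close> and the lower arc of the prime close up to a discarded
  loop, and the upper arc of the prime takes the place of the hook. Labelling the loop with this
  hook does no harm.\<close>

lemma tcomp_U_hook:
  assumes "tangle N X" "1 \<le> i" "i < N" "{Upper i, Upper (i + 1)} \<in> X"
  shows "tcomp (prime_tangle N (UPrime i)) X = X"
proof -
  let ?P = "prime_tangle N (UPrime i)"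
  define K where "K s = edge_at X
    (case s of Top j \<Rightarrow> Upper j | Middle j \<Rightarrow> Upper j | Bottom j \<Rightarrow> Lower j)" for s
  have K: "K (outer x) = edge_at X x" "K (in_lower_factor x) = edge_at X x" for x
    by (cases x; simp add: K_def)+
  have hook: "edge_at X (Upper i) = edge_at X (Upper (Suc i))"
    using edge_at_eq[OF assms(1,4)] by simp
  show ?thesis
  proof (rule tcomp_eqI[where K = K])
    show "tangle N ?P" using assms by (intro tangle_prime) auto
    show "K (in_upper_factor x) = K (in_upper_factor y)" if "{x, y} \<in> ?P" for x y
      using that by (cases rule: prime_edge_cases) (auto simp: K_def doubleton_eq_iff hook)
    show "K (in_lower_factor x) = K (in_lower_factor y)" if "{x, y} \<in> X" for x y
      using that edge_at_eq[OF assms(1) that] by (simp add: K)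
    show "x \<in> K (outer x) \<and> K (outer x) \<in> X" if "x \<in> nodes N" for x
      using edge_at_in[OF assms(1) that] by (simp add: K)
    have lift: "(outer x, in_lower_factor x) \<in> (stack_adj ?P X)\<^sup>*"
      if "x \<in> nodes N" "x \<noteq> Upper i" "x \<noteq> Upper (i + 1)" for x
    proof (cases x)
      case (Upper j)
      have "{Upper j, Lower j} \<in> ?P"
        using that Upper by (intro prime_straight_edge) auto
      from stack_adj_upper[OF this] show ?thesis
        using Upper by simp
    qed simp
    show "(outer x, outer y) \<in> (stack_adj ?P X)\<^sup>*" if e: "{x, y} \<in> X" for x y
    proof (cases "{x, y} = {Upper i, Upper (i + 1)}")
      case True
      then have "{x, y} \<in> ?P" by (auto simp: prime_tangle.simps)
      from stack_adj_upper[OF this] show ?thesis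
        using True by (auto simp: doubleton_eq_iff)
    next
      case False
      then have "x \<notin> {Upper i, Upper (i + 1)}" "y \<notin> {Upper i, Upper (i + 1)}"
        using tangle_edge_unique[OF assms(1) e assms(4)] by blast+
      then have "(outer x, in_lower_factor x) \<in> (stack_adj ?P X)\<^sup>*"
        "(in_lower_factor y, outer y) \<in> (stack_adj ?P X)\<^sup>*"
        using lift stack_path_sym tangle_edgeD[OF assms(1) e] by auto
      then show ?thesis
        using stack_adj_lower[OF e] by (meson rtrancl_trans)
    qed
  qed (use assms in auto)
qed

lemma tcomp_U_rewire:
  assumes "tangle N X" "1 \<le> i" "i < N" "{Upper i, a} \<in> X" "{Upper (i + 1), b} \<in> X" "a \<noteq> Upper (i + 1)"
  shows "tcomp (prime_tangle N (UPrime i)) X = rewire X (Upper i) a (Upper (i + 1)) b"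
proof -
  let ?P = "prime_tangle N (UPrime i)" and ?R = "rewire X (Upper i) a (Upper (i + 1)) b"
  let ?e = "{Upper i, a}" and ?f = "{Upper (i + 1), b}"
  have ne: "?e \<noteq> ?f"
    using assms(6) by (auto simp: doubleton_eq_iff)
  note d = rewire_nodes_distinct[OF assms(1,4,5) ne]
  note o = rewire_other_edges[OF assms(1,4,5)]
  \<comment> \<open>The edges at \<open>i\<close> and \<open>i + 1\<close> are connected through the
    lower arc of the prime, so both are labelled with the joined edge \<open>{a, b}\<close>. The two
    top nodes \<open>i\<close> and \<open>i + 1\<close> form a component of their own, which
    \<open>K\<close> treats separately.\<close>
  define E where "E x = (if edge_at X x \<in> {?e, ?f} then {a, b} else edge_at X x)" for x
  define K where "K s = (case s of
      Top j \<Rightarrow> if j \<in> {i, i + 1} then {Upper i, Upper (i + 1)} else E (Upper j)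
    | Middle j \<Rightarrow> E (Upper j) | Bottom j \<Rightarrow> E (Lower j))" for s
  have K: "K (outer x) = (if x \<in> {Upper i, Upper (i + 1)} then {Upper i, Upper (i + 1)} else E x)"
    "K (in_lower_factor x) = E x" for x
    by (cases x; simp add: K_def)+
  have E: "E (Upper i) = {a, b}" "E (Upper (Suc i)) = {a, b}"
    using edge_at_eq[OF assms(1,4)] edge_at_eq[OF assms(1,5)] by (simp_all add: E_def)
  show ?thesis
  proof (rule tcomp_eqI[where K = K])
    show "tangle N ?P" using assms by (intro tangle_prime) auto
    show "tangle N ?R" by (rule tangle_rewire[OF assms(1,4,5) ne])
    show "K (in_upper_factor x) = K (in_upper_factor y)" if "{x, y} \<in> ?P" for x y
      using that by (cases rule: prime_edge_cases) (auto simp: K_def doubleton_eq_iff E)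
    show "K (in_lower_factor x) = K (in_lower_factor y)" if "{x, y} \<in> X" for x y
      using that edge_at_eq[OF assms(1) that] by (simp add: K E_def)
    show "x \<in> K (outer x) \<and> K (outer x) \<in> ?R" if "x \<in> nodes N" for x
    proof (cases "x \<in> {Upper i, Upper (i + 1)}")
      case True
      then show ?thesis by (auto simp: K rewire_def)
    next
      case False
      note x = edge_at_in[OF assms(1) that]
      show ?thesis
      proof (cases "edge_at X x \<in> {?e, ?f}")
        case True
        then have "x \<in> {a, b}" using x(2) False by auto
        then show ?thesis using True False by (auto simp: K E_def rewire_def)
      next
        case no: False
        then show ?thesis using False x by (auto simp: K E_def rewire_def)
      qed
    qed
    have lift: "(outer x, in_lower_factor x) \<in> (stack_adj ?P X)\<^sup>*"
      if "x \<in> nodes N" "x \<noteq> Upper i" "x \<noteq> Upper (i + 1)" for x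
    proof (cases x)
      case (Upper j)
      have "{Upper j, Lower j} \<in> ?P"
        using that Upper by (intro prime_straight_edge) auto
      from stack_adj_upper[OF this] show ?thesis
        using Upper by simp
    qed simp
    note n = tangle_edgeD[OF assms(1,4)] tangle_edgeD[OF assms(1,5)]
    have "{Lower i, Lower (i + 1)} \<in> ?P" by (auto simp: prime_tangle.simps)
    from stack_adj_upper[OF this]
    have cap: "(Middle i, Middle (i + 1)) \<in> (stack_adj ?P X)\<^sup>*" by simp
    have "(outer a, Middle i) \<in> (stack_adj ?P X)\<^sup>*"
      using rtrancl_trans[OF lift[of a] stack_path_sym[OF stack_adj_lower[OF assms(4)]]] n d by simp
    moreover have "(Middle (i + 1), outer b) \<in> (stack_adj ?P X)\<^sup>*"
      using rtrancl_trans[OF stack_adj_lower[OF assms(5)] stack_path_sym[OF lift[of b]]] n d by simp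
    ultimately have ab: "(outer a, outer b) \<in> (stack_adj ?P X)\<^sup>*"
      using cap by (meson rtrancl_trans)
    have "{Upper i, Upper (i + 1)} \<in> ?P" by (auto simp: prime_tangle.simps)
    from stack_adj_upper[OF this]
    have hook: "(outer (Upper i), outer (Upper (i + 1))) \<in> (stack_adj ?P X)\<^sup>*" by simp
    show "(outer x, outer y) \<in> (stack_adj ?P X)\<^sup>*" if xy: "{x, y} \<in> ?R" for x y
    proof -
      consider "{x, y} \<in> X" "{x, y} \<noteq> ?e" "{x, y} \<noteq> ?f" | "{x, y} = {Upper i, Upper (i + 1)}" | "{x, y} = {a, b}"
        using xy unfolding rewire_def by blast
      then show ?thesis
      proof cases
        case 1
        have "(outer x, in_lower_factor x) \<in> (stack_adj ?P X)\<^sup>*"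
          "(in_lower_factor y, outer y) \<in> (stack_adj ?P X)\<^sup>*"
          using lift stack_path_sym tangle_edgeD[OF assms(1) 1(1)] o(1,3)[OF 1] by auto
        then show ?thesis
          using stack_adj_lower[OF 1(1)] by (meson rtrancl_trans)
      next
        case 2
        then show ?thesis using hook stack_path_sym[OF hook] by (auto simp: doubleton_eq_iff)
      next
        case 3
        then show ?thesis using ab stack_path_sym[OF ab] by (auto simp: doubleton_eq_iff)
      qed
    qed
  qed (use assms in auto)
qed

lemma tangle_tcomp_prime:
  assumes "tangle N X" "1 \<le> index p" "index p < N"
  shows "tangle N (tcomp (prime_tangle N p) X)"
proof (cases p)
  case (TPrime i)
  then show ?thesis using assms tcomp_T[of N X i] tangle_swap_upper[of N X i] by simp
next
  case (UPrime i)
  have n: "Upper i \<in> nodes N" "Upper (i + 1) \<in> nodes N" using assms UPrime by auto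
  obtain a where a: "{Upper i, a} \<in> X" by (rule tangle_partnerE[OF assms(1) n(1)])
  obtain b where b: "{Upper (i + 1), b} \<in> X" by (rule tangle_partnerE[OF assms(1) n(2)])
  show ?thesis
  proof (cases "a = Upper (i + 1)")
    case True
    then show ?thesis using tcomp_U_hook[of N X i] a assms UPrime by simp
  next
    case False
    then have "{Upper i, a} \<noteq> {Upper (i + 1), b}" by (auto simp: doubleton_eq_iff)
    then show ?thesis
      using tcomp_U_rewire[of N X i a b] tangle_rewire[OF assms(1) a b] a b False assms UPrime by simp
  qed
qed

lemma tangle_word:
  assumes "is_word N w"
  shows "tangle N (word_tangle N w)"
  using assms
proof (induction w)
  case Nil
  show ?case by (simp add: tangle_id)
next
  case (Cons p w)
  then show ?case by (auto simp: is_word_def intro: tangle_tcomp_prime)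
qed

section \<open>Growth of the total weight under a prime\<close>

lemma crosses_edge_iff:
  assumes "tangle N X" "{u, v} \<in> X" "x \<in> nodes N" "y \<in> nodes N" "x \<notin> {u, v}" "y \<notin> {u, v}"
  shows "crosses N {u, v} {x, y} \<longleftrightarrow> separates N u v x \<noteq> separates N u v y"
  using assms tangle_edgeD[OF assms(1,2)] by (intro crosses_iff) auto

text \<open>The two nodes are consecutive in the cyclic order, so an edge that ends at neither has
  both on the same side.\<close>

lemma separates_adjacent:
  assumes "u \<in> nodes N" "v \<in> nodes N" "1 \<le> i" "i < N"
    and "Upper i \<notin> {u, v}" "Upper (i + 1) \<notin> {u, v}"
  shows "separates N u v (Upper i) \<longleftrightarrow> separates N u v (Upper (i + 1))"
proof -
  have pos: "cyclic_pos N u \<noteq> i" "cyclic_pos N u \<noteq> i + 1" "cyclic_pos N v \<noteq> i" "cyclic_pos N v \<noteq> i + 1"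
    using assms cyclic_pos_inj[of u N "Upper i"] cyclic_pos_inj[of u N "Upper (i + 1)"]
      cyclic_pos_inj[of v N "Upper i"] cyclic_pos_inj[of v N "Upper (i + 1)"] by auto
  have "(p < i \<longleftrightarrow> p < i + 1) \<and> (i < p \<longleftrightarrow> i + 1 < p)" if "p \<noteq> i" "p \<noteq> i + 1" for p :: nat
    using that by auto
  from this[OF pos(1,2)] this[OF pos(3,4)] show ?thesis
    unfolding separates_def cyclic_pos.simps min_less_iff_disj less_max_iff_disj by simp
qed

lemma rewire_common_edge:
  assumes "tangle N X" "{p, q} \<in> X" "{r, s} \<in> X" "{p, q} \<noteq> {r, s}"
    and "g \<in> rewire X p q r s"
  shows "g \<noteq> {p, q}" "g \<noteq> {r, s}"
  using rewire_nodes_distinct[OF assms(1-4)] assms(5) by (auto simp: rewire_def doubleton_eq_iff)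

lemma edge_crossings_other:
  assumes "finite X" "f \<in> X" "e \<noteq> f"
  shows "edge_crossings N X e = of_bool (crosses N e f) + edge_crossings N (X - {e, f}) e"
proof -
  have "edge_crossings N X e = edge_crossings N (insert f (X - {f})) e"
    using assms by (simp add: insert_absorb)
  also have "\<dots> = of_bool (crosses N e f) + edge_crossings N (X - {f}) e"
    using assms by (subst edge_crossings_insert) auto
  also have "edge_crossings N (X - {f}) e = edge_crossings N (X - {e, f}) e"
    unfolding edge_crossings_def by (intro arg_cong[where f = card]) auto
  finally show ?thesis .
qed

text \<open>A new edge crosses the other new edge or edges common to both tangles; the crossings
  with the common part can then be compared with those of the old edges.\<close>

lemma edge_crossings_rewire_new:
  assumes "tangle N X" "{p, q} \<in> X" "{r, s} \<in> X" "{p, q} \<noteq> {r, s}"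
  shows "edge_crossings N (rewire X p q r s) {p, r} =
      of_bool (crosses N {p, r} {q, s}) + edge_crossings N (X - {{p, q}, {r, s}}) {p, r}"
    "edge_crossings N (rewire X p q r s) {q, s} =
      of_bool (crosses N {p, r} {q, s}) + edge_crossings N (X - {{p, q}, {r, s}}) {q, s}"
proof -
  define Z where "Z = X - {{p, q}, {r, s}}"
  note d = rewire_decomp[OF assms, folded Z_def]
  have ne: "{p, r} \<noteq> {q, s}" using d(6) by auto
  have Z: "rewire X p q r s - {{p, r}, {q, s}} = Z"
    using d(3,6,7) by auto
  have fin: "finite (rewire X p q r s)" using d(1,3) by simp
  have mem: "{p, r} \<in> rewire X p q r s" "{q, s} \<in> rewire X p q r s" using d(3) by auto
  show "edge_crossings N (rewire X p q r s) {p, r} = of_bool (crosses N {p, r} {q, s}) + edge_crossings N (X - {{p, q}, {r, s}}) {p, r}"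
    using edge_crossings_other[OF fin mem(2) ne] Z by (simp add: Z_def)
  show "edge_crossings N (rewire X p q r s) {q, s} = of_bool (crosses N {p, r} {q, s}) + edge_crossings N (X - {{p, q}, {r, s}}) {q, s}"
    using edge_crossings_other[OF fin mem(1) ne[symmetric]] Z
    by (simp add: Z_def crosses_sym[of N "{q, s}"] insert_commute)
qed

lemma edge_crossings_cong:
  assumes "\<And>g. g \<in> Z \<Longrightarrow> crosses N g e \<longleftrightarrow> crosses N g f"
  shows "edge_crossings N Z e = edge_crossings N Z f"
proof -
  have "{g \<in> Z. crosses N e g} = {g \<in> Z. crosses N f g}"
    using assms crosses_sym by blast
  then show ?thesis by (simp add: edge_crossings_def)
qed

text \<open>Exchanging two consecutive end points changes whether the four ends interleave:
  \<open>b\<close> keeps its side, while the other neighbouring end changes it.\<close>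

lemma swap_toggles_crossing:
  assumes "a \<in> nodes N" "b \<in> nodes N" "1 \<le> i" "i < N"
    and "a \<noteq> b" "a \<notin> {Upper i, Upper (i + 1)}" "b \<notin> {Upper i, Upper (i + 1)}"
  shows "crosses N {Upper i, b} {a, Upper (i + 1)} \<longleftrightarrow> \<not> crosses N {Upper i, a} {b, Upper (i + 1)}"
proof -
  let ?P = "cyclic_pos N"
  have d: "?P a \<noteq> i" "?P a \<noteq> i + 1" "?P b \<noteq> i" "?P b \<noteq> i + 1" "?P a \<noteq> ?P b"
    using assms cyclic_pos_inj[of a N "Upper i"] cyclic_pos_inj[of a N "Upper (i + 1)"]
      cyclic_pos_inj[of b N "Upper i"] cyclic_pos_inj[of b N "Upper (i + 1)"] cyclic_pos_inj[of a N b]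
    by auto
  have "crosses N {Upper i, a} {b, Upper (i + 1)} \<longleftrightarrow>
      separates N (Upper i) a b \<noteq> separates N (Upper i) a (Upper (i + 1))"
    using assms by (intro crosses_iff) auto
  moreover have "crosses N {a, Upper (i + 1)} {Upper i, b} \<longleftrightarrow>
      separates N a (Upper (i + 1)) (Upper i) \<noteq> separates N a (Upper (i + 1)) b"
    using assms by (intro crosses_iff) auto
  moreover have "separates N (Upper i) a b \<longleftrightarrow> separates N a (Upper (i + 1)) b"
    using d unfolding separates_def by (auto simp: min_def max_def)
  moreover have "separates N (Upper i) a (Upper (i + 1)) \<longleftrightarrow> \<not> separates N a (Upper (i + 1)) (Upper i)"
    using d unfolding separates_def by (auto simp: min_def max_def)
  ultimately show ?thesis
    using crosses_sym by metis
qed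

text \<open>Every third edge has \<open>i\<close> and \<open>i + 1\<close> on one side, so only the
  crossing between the two moved edges is toggled. Each new edge is compared with the old one that
  has the same far end, \<open>b\<close> or \<open>a\<close>.\<close>

lemma T_rewire_crossings:
  assumes "tangle N X" "1 \<le> i" "i < N" "{Upper i, a} \<in> X" "{b, Upper (i + 1)} \<in> X" "a \<noteq> Upper (i + 1)"
  defines "X' \<equiv> rewire X (Upper i) a b (Upper (i + 1))"
  shows "g \<in> X \<Longrightarrow> g \<in> X' \<Longrightarrow> edge_crossings N X' g = edge_crossings N X g"
    "edge_crossings N X' {Upper i, b} + of_bool (crosses N {Upper i, a} {b, Upper (i + 1)}) =
      edge_crossings N X {b, Upper (i + 1)} + of_bool (\<not> crosses N {Upper i, a} {b, Upper (i + 1)})"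
    "edge_crossings N X' {a, Upper (i + 1)} + of_bool (crosses N {Upper i, a} {b, Upper (i + 1)}) =
      edge_crossings N X {Upper i, a} + of_bool (\<not> crosses N {Upper i, a} {b, Upper (i + 1)})"
proof -
  let ?e = "{Upper i, a}" and ?f = "{b, Upper (i + 1)}"
  have ne: "?e \<noteq> ?f"
    using assms(6) by (auto simp: doubleton_eq_iff)
  note d = rewire_nodes_distinct[OF assms(1,4,5) ne]
  note n = tangle_edgeD[OF assms(1,4)] tangle_edgeD[OF assms(1,5)]
  note o = rewire_other_edges[OF assms(1,4,5)]
  have Z: "crosses N g {Upper i, x} \<longleftrightarrow> crosses N g {x, Upper (i + 1)}"
    if "g \<in> X" "g \<noteq> ?e" "g \<noteq> ?f" "x \<in> {a, b}" for g x
  proof -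
    obtain u v where g: "g = {u, v}" "u \<in> nodes N" "v \<in> nodes N"
      using tangle_edgeE[OF assms(1) \<open>g \<in> X\<close>] by metis
    have x: "x \<in> nodes N" "x \<notin> {u, v}"
      using that n o[OF that(1-3)] g by auto
    have i: "Upper i \<notin> {u, v}" "Upper (i + 1) \<notin> {u, v}"
      using o[OF that(1-3)] g by auto
    show ?thesis
      using separates_adjacent[OF g(2,3) assms(2,3) i] i x n crosses_edge_iff[OF assms(1), of u v] g that(1)
      by auto
  qed
  show "edge_crossings N X' g = edge_crossings N X g" if "g \<in> X" "g \<in> X'"
    using edge_crossings_rewire[OF assms(1,4,5) ne, of g] Z[of g a] Z[of g b] that
      rewire_common_edge[OF assms(1,4,5) ne] unfolding X'_def by simp
  have toggle: "crosses N {Upper i, b} {a, Upper (i + 1)} \<longleftrightarrow> \<not> crosses N ?e ?f"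
    using n d assms(2,3,6) by (intro swap_toggles_crossing) auto
  have fin: "finite X" by (rule finite_tangle[OF assms(1)])
  have "edge_crossings N (X - {?e, ?f}) {Upper i, b} = edge_crossings N (X - {?e, ?f}) ?f"
    using Z[of _ b] by (intro edge_crossings_cong) auto
  then show "edge_crossings N X' {Upper i, b} + of_bool (crosses N ?e ?f) =
      edge_crossings N X ?f + of_bool (\<not> crosses N ?e ?f)"
    using edge_crossings_rewire_new(1)[OF assms(1,4,5) ne] toggle
      edge_crossings_other[OF fin assms(4) ne[symmetric], of N] crosses_sym[of N ?e ?f]
    unfolding X'_def by (simp add: insert_commute)
  have "edge_crossings N (X - {?e, ?f}) {a, Upper (i + 1)} = edge_crossings N (X - {?e, ?f}) ?e"
    using Z[of _ a] by (intro edge_crossings_cong) auto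
  then show "edge_crossings N X' {a, Upper (i + 1)} + of_bool (crosses N ?e ?f) =
      edge_crossings N X ?e + of_bool (\<not> crosses N ?e ?f)"
    using edge_crossings_rewire_new(2)[OF assms(1,4,5) ne] toggle
      edge_crossings_other[OF fin assms(5) ne, of N]
    unfolding X'_def by simp
qed

lemma total_weight_T_le:
  assumes "tangle N X" "1 \<le> i" "i < N"
  shows "total_weight N (tcomp (prime_tangle N (TPrime i)) X) \<le> total_weight N X + 2"
proof -
  have n: "Upper i \<in> nodes N" "Upper (i + 1) \<in> nodes N" using assms by auto
  obtain a where a: "{Upper i, a} \<in> X" by (rule tangle_partnerE[OF assms(1) n(1)])
  obtain b where "{Upper (i + 1), b} \<in> X" by (rule tangle_partnerE[OF assms(1) n(2)])
  then have b: "{b, Upper (i + 1)} \<in> X" by (simp add: insert_commute)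
  show ?thesis
  proof (cases "a = Upper (i + 1)")
    case True
    then show ?thesis using tcomp_T_hook[OF assms] a by simp
  next
    case False
    then have ne: "{Upper i, a} \<noteq> {b, Upper (i + 1)}" by (auto simp: doubleton_eq_iff)
    note T = T_rewire_crossings[OF assms a b False]
    let ?X' = "rewire X (Upper i) a b (Upper (i + 1))"
    have "total_weight N ?X' + 0 \<le> total_weight N X + 2"
    proof (rule total_weight_rewire_le[OF assms(1) a b ne])
      show "edge_weight N ?X' g \<le> edge_weight N X g" if "g \<in> X" "g \<in> ?X'" for g
        using T(1)[OF that] by (simp add: edge_weight_def)
      have c: "edge_crossings N ?X' {Upper i, b} \<le> edge_crossings N X {b, Upper (i + 1)} + 1"
        "edge_crossings N ?X' {a, Upper (i + 1)} \<le> edge_crossings N X {Upper i, a} + 1"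
        using T(2,3) by (auto simp: of_bool_def split: if_splits)
      have s: "edge_size {Upper i, b} \<le> edge_size {b, Upper (i + 1)} + 1"
        "edge_size {a, Upper (i + 1)} \<le> edge_size {Upper i, a} + 1"
        by (simp_all add: edge_size_pair)
      show "edge_weight N ?X' {Upper i, b} + edge_weight N ?X' {a, Upper (i + 1)} + 0
          \<le> edge_weight N X {Upper i, a} + edge_weight N X {b, Upper (i + 1)} + 2"
        unfolding edge_weight_def using c s by linarith
    qed
    then show ?thesis using tcomp_T_rewire[OF assms a b False] by simp
  qed
qed

text \<open>Of the growth by 2, one unit is the weight of the new hook, which nothing crosses; the
  other is the gap between \<open>i\<close> and \<open>i + 1\<close>, which enters the size of the
  joined edge.\<close>

lemma total_weight_U_le:
  assumes "tangle N X" "1 \<le> i" "i < N"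
  shows "total_weight N (tcomp (prime_tangle N (UPrime i)) X) \<le> total_weight N X + 2"
proof -
  have n: "Upper i \<in> nodes N" "Upper (i + 1) \<in> nodes N" using assms by auto
  obtain a where a: "{Upper i, a} \<in> X" by (rule tangle_partnerE[OF assms(1) n(1)])
  obtain b where b: "{Upper (i + 1), b} \<in> X" by (rule tangle_partnerE[OF assms(1) n(2)])
  show ?thesis
  proof (cases "a = Upper (i + 1)")
    case True
    then show ?thesis using tcomp_U_hook[OF assms] a by simp
  next
    case False
    let ?e = "{Upper i, a}" and ?f = "{Upper (i + 1), b}" and ?h = "{Upper i, Upper (i + 1)}"
    have ne: "?e \<noteq> ?f" using False by (auto simp: doubleton_eq_iff)
    note d = rewire_nodes_distinct[OF assms(1) a b ne]
    note n = tangle_edgeD[OF assms(1) a] tangle_edgeD[OF assms(1) b]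
    note o = rewire_other_edges[OF assms(1) a b]
    let ?X' = "rewire X (Upper i) a (Upper (i + 1)) b" and ?Z = "X - {?e, ?f}"
    \<comment> \<open>A third edge \<open>g\<close> has \<open>i\<close> and \<open>i + 1\<close> on
      the same side. If it has \<open>a\<close> and \<open>b\<close> on different sides, one of them
      is opposite to \<open>i\<close> and \<open>i + 1\<close>.\<close>
    have Z: "\<not> crosses N g ?h" "crosses N g {a, b} \<Longrightarrow> crosses N g ?e \<or> crosses N g ?f"
      if "g \<in> X" "g \<noteq> ?e" "g \<noteq> ?f" for g
    proof -
      obtain u v where g: "g = {u, v}" "u \<in> nodes N" "v \<in> nodes N"
        using tangle_edgeE[OF assms(1) \<open>g \<in> X\<close>] by metis
      have ab: "a \<notin> {u, v}" "b \<notin> {u, v}"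
        using o[OF that] g by auto
      have i: "Upper i \<notin> {u, v}" "Upper (i + 1) \<notin> {u, v}"
        using o[OF that] g by auto
      note c = crosses_edge_iff[OF assms(1), of u v] separates_adjacent[OF g(2,3) assms(2,3) i]
      show "\<not> crosses N g ?h" using c i n g that(1) by auto
      show "crosses N g ?e \<or> crosses N g ?f" if "crosses N g {a, b}"
        using that c(2) c(1)[of a b] c(1)[of "Upper i" a] c(1)[of "Upper (i + 1)" b] i ab n g \<open>g \<in> X\<close>
        by auto
    qed
    have h: "\<not> crosses N ?h {a, b}"
    proof -
      have "\<not> separates N (Upper i) (Upper (i + 1)) x" for x
        by (simp add: separates_def)
      then show ?thesis using n d by (subst crosses_iff) auto
    qed
    have "total_weight N ?X' + 0 \<le> total_weight N X + 2"
    proof (rule total_weight_rewire_le[OF assms(1) a b ne])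
      show "edge_weight N ?X' g \<le> edge_weight N X g" if "g \<in> X" "g \<in> ?X'" for g
      proof -
        note g = that(1) rewire_common_edge[OF assms(1) a b ne that(2)]
        have "edge_crossings N ?X' g \<le> edge_crossings N X g"
          using edge_crossings_rewire[OF assms(1) a b ne, of g] Z[OF g]
          by (auto simp: of_bool_def split: if_splits)
        then show ?thesis by (auto simp: edge_weight_def)
      qed
      have "{g \<in> ?Z. crosses N ?h g} = {}"
        using Z(1) crosses_sym by blast
      then have "edge_crossings N ?Z ?h = 0"
        unfolding edge_crossings_def by (simp only: card.empty)
      then have "edge_weight N ?X' ?h = 1"
        using edge_crossings_rewire_new(1)[OF assms(1) a b ne] h
        by (simp add: edge_weight_def edge_size_pair)
      moreover have "edge_crossings N ?X' {a, b} \<le> edge_crossings N X ?e + edge_crossings N X ?f"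
      proof -
        have "{g \<in> ?Z. crosses N {a, b} g} \<subseteq> {g \<in> X. crosses N ?e g} \<union> {g \<in> X. crosses N ?f g}"
          using Z(2) crosses_sym by blast
        then have "card {g \<in> ?Z. crosses N {a, b} g} \<le> card ({g \<in> X. crosses N ?e g} \<union> {g \<in> X. crosses N ?f g})"
          using finite_tangle[OF assms(1)] by (intro card_mono) auto
        also have "\<dots> \<le> card {g \<in> X. crosses N ?e g} + card {g \<in> X. crosses N ?f g}"
          by (rule card_Un_le)
        finally show ?thesis
          using edge_crossings_rewire_new(2)[OF assms(1) a b ne] h by (simp add: edge_crossings_def)
      qed
      moreover have "edge_size {a, b} \<le> edge_size ?e + edge_size ?f + 1"
        by (simp add: edge_size_pair)
      ultimately show "edge_weight N ?X' ?h + edge_weight N ?X' {a, b} + 0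
          \<le> edge_weight N X ?e + edge_weight N X ?f + 2"
        unfolding edge_weight_def by linarith
    qed
    then show ?thesis using tcomp_U_rewire[OF assms a b False] by simp
  qed
qed

lemma total_weight_id: "total_weight N (id_tangle N) = 0"
proof -
  have "edge_weight N (id_tangle N) e = 0" if "e \<in> id_tangle N" for e
  proof -
    have "\<not> crosses N e f" if f: "f \<in> id_tangle N" for f
    proof -
      obtain i where i: "e = {Upper i, Lower i}" "1 \<le> i" "i \<le> N"
        using \<open>e \<in> id_tangle N\<close> unfolding id_tangle_def by auto
      obtain j where j: "f = {Upper j, Lower j}" "1 \<le> j" "j \<le> N"
        using f unfolding id_tangle_def by auto
      show ?thesis
      proof (cases "i = j")
        case False
        then have "crosses N e f \<longleftrightarrow> separates N (Upper i) (Lower i) (Upper j) \<noteq> separates N (Upper i) (Lower i) (Lower j)"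
          unfolding i(1) j(1) using i j by (intro crosses_iff) auto
        then show ?thesis using i j False by (auto simp: separates_def)
      qed (use i j in simp)
    qed
    then have "{f \<in> id_tangle N. crosses N e f} = {}" by blast
    then have "edge_crossings N (id_tangle N) e = 0"
      unfolding edge_crossings_def by (simp only: card.empty)
    then show ?thesis
      using that by (auto simp: edge_weight_def edge_size_pair id_tangle_def)
  qed
  then show ?thesis by (simp add: total_weight_def)
qed

lemma total_weight_word_le:
  assumes "is_word N w"
  shows "total_weight N (word_tangle N w) \<le> 2 * length w"
  using assms
proof (induction w)
  case Nil
  show ?case by (simp add: total_weight_id)
next
  case (Cons p w)
  then have w: "is_word N w" "1 \<le> index p" "index p < N" by (auto simp: is_word_def)
  have "total_weight N (tcomp (prime_tangle N p) (word_tangle N w)) \<le> total_weight N (word_tangle N w) + 2"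
    using w tangle_word[OF w(1)] total_weight_T_le total_weight_U_le by (cases p) auto
  then show ?case using Cons.IH w by simp
qed

subsection \<open>Counting crossings\<close>

text \<open>\<open>R\<close> is a partial matching, so its pairs may be counted by either component.
  It is used to count hooks by left or right ends and vertical edges by upper or lower ends.\<close>

lemma card_matched:
  assumes "\<And>y w w'. R y w \<Longrightarrow> R y w' \<Longrightarrow> w = w'" "\<And>y y' w. R y w \<Longrightarrow> R y' w \<Longrightarrow> y = y'"
  shows "card {y. \<exists>w. R y w} = card {w. \<exists>y. R y w}"
proof (rule bij_betw_same_card)
  have f: "(SOME w. R y w) = w" if "R y w" for y w
  proof (rule some_equality)
    show "w' = w" if "R y w'" for w' using assms(1) \<open>R y w\<close> that by blast
  qed (rule that)
  show "bij_betw (\<lambda>y. SOME w. R y w) {y. \<exists>w. R y w} {w. \<exists>y. R y w}"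
    unfolding bij_betw_def
  proof
    show "inj_on (\<lambda>y. SOME w. R y w) {y. \<exists>w. R y w}"
    proof (rule inj_onI)
      fix y y' assume yy: "y \<in> {y. \<exists>w. R y w}" "y' \<in> {y. \<exists>w. R y w}" "(SOME w. R y w) = (SOME w. R y' w)"
      then obtain w w' where "R y w" "R y' w'" by blast
      then show "y = y'" using f[of y w] f[of y' w'] yy(3) assms(2)[of y w y'] by simp
    qed
    show "(\<lambda>y. SOME w. R y w) ` {y. \<exists>w. R y w} = {w. \<exists>y. R y w}"
    proof (intro equalityI subsetI)
      fix w assume "w \<in> {w. \<exists>y. R y w}"
      then obtain y where "R y w" by blast
      then show "w \<in> (\<lambda>y. SOME w. R y w) ` {y. \<exists>w. R y w}"
        using f[of y w] by (intro image_eqI[of _ _ y]) auto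
    qed (use f in auto)
  qed
qed

lemma card_eq_sum_of_bool:
  assumes "finite A" "{y. P y} \<subseteq> A"
  shows "card {y. P y} = (\<Sum>y\<in>A. of_bool (P y))"
proof -
  have "(\<Sum>y\<in>A. of_bool (P y) :: nat) = (\<Sum>y\<in>{y\<in>A. P y}. 1)"
    using assms(1) by (intro sum.mono_neutral_cong_right) auto
  also have "{y \<in> A. P y} = {y. P y}" using assms(2) by auto
  finally show ?thesis by simp
qed

lemma card_nodes:
  assumes "finite A"
  shows "card A = card {y. Upper y \<in> A} + card {w. Lower w \<in> A}"
proof -
  have fin: "finite {y. Upper y \<in> A}" "finite {w. Lower w \<in> A}"
    using finite_vimageI[OF assms, of Upper] finite_vimageI[OF assms, of Lower]
    by (simp_all add: inj_def vimage_def)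
  have "A = Upper ` {y. Upper y \<in> A} \<union> Lower ` {w. Lower w \<in> A}"
  proof (intro equalityI subsetI)
    fix z assume "z \<in> A"
    then show "z \<in> Upper ` {y. Upper y \<in> A} \<union> Lower ` {w. Lower w \<in> A}" by (cases z) auto
  qed auto
  then have "card A = card (Upper ` {y. Upper y \<in> A} \<union> Lower ` {w. Lower w \<in> A})" by simp
  also have "\<dots> = card (Upper ` {y. Upper y \<in> A}) + card (Lower ` {w. Lower w \<in> A})"
    using fin by (intro card_Un_disjoint) auto
  finally show ?thesis by (simp add: card_image inj_on_def)
qed

text \<open>The conventions differ on purpose: upper hooks count only if they lie wholly on one side
  of \<open>x\<close>, lower hooks also if they span \<open>v\<close>. On the left, say, a spanning
  upper hook adds one to the crossings and one to \<open>x\<close>, which cancels; a spanning lower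
  hook adds one to the crossings and one to \<open>v\<close>, and so weighs as much as a hook wholly
  on the left.\<close>

definition upper_hooks_left :: "edge set \<Rightarrow> nat \<Rightarrow> nat" where
  "upper_hooks_left X x = card {j. \<exists>k. {Upper k, Upper j} \<in> X \<and> k < j \<and> j < x}"

definition upper_hooks_right :: "edge set \<Rightarrow> nat \<Rightarrow> nat" where
  "upper_hooks_right X x = card {j. \<exists>k. {Upper j, Upper k} \<in> X \<and> j < k \<and> x < j}"

definition lower_hooks_left :: "edge set \<Rightarrow> nat \<Rightarrow> nat" where
  "lower_hooks_left X v = card {c. \<exists>d. {Lower c, Lower d} \<in> X \<and> c < d \<and> c < v}"

definition lower_hooks_right :: "edge set \<Rightarrow> nat \<Rightarrow> nat" where
  "lower_hooks_right X v = card {d. \<exists>c. {Lower c, Lower d} \<in> X \<and> c < d \<and> v < d}"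

definition rightward_over :: "edge set \<Rightarrow> nat \<Rightarrow> nat \<Rightarrow> nat" where
  "rightward_over X x v = card {y. \<exists>w. {Upper y, Lower w} \<in> X \<and> y < x \<and> v < w}"

definition leftward_over :: "edge set \<Rightarrow> nat \<Rightarrow> nat \<Rightarrow> nat" where
  "leftward_over X x v = card {w. \<exists>y. {Upper y, Lower w} \<in> X \<and> x < y \<and> w < v}"

definition hook_count :: "edge set \<Rightarrow> nat" where
  "hook_count X = card {j. \<exists>k. {Upper k, Upper j} \<in> X \<and> k < j}"

fun left_of :: "nat \<Rightarrow> nat \<Rightarrow> node \<Rightarrow> bool" where
  "left_of x v (Upper y) \<longleftrightarrow> y < x"
| "left_of x v (Lower w) \<longleftrightarrow> w < v"

text \<open>The cyclic positions strictly between \<open>Upper x\<close> and \<open>Lower v\<close>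
  are those of the nodes to the right of the edge, so crossing means changing sides.\<close>

lemma crosses_vertical_iff:
  assumes "tangle N X" "{Upper x, Lower v} \<in> X" "p \<in> nodes N" "q \<in> nodes N"
    "p \<notin> {Upper x, Lower v}" "q \<notin> {Upper x, Lower v}"
  shows "crosses N {Upper x, Lower v} {p, q} \<longleftrightarrow> left_of x v p \<noteq> left_of x v q"
proof -
  have n: "1 \<le> x" "x \<le> N" "1 \<le> v" "v \<le> N"
    using tangle_edgeD[OF assms(1,2)] by auto
  have "separates N (Upper x) (Lower v) z \<longleftrightarrow> \<not> left_of x v z"
    if "z \<in> nodes N" "z \<notin> {Upper x, Lower v}" for z
    using that n by (cases z) (auto simp: separates_def)
  then show ?thesis
    using crosses_edge_iff[OF assms] assms(3-6) by blast
qed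

text \<open>A crossing edge has exactly one end on the left. Counting by that end and distinguishing
  the rows of both ends gives the four summands.\<close>

lemma edge_crossings_vertical:
  assumes "tangle N X" "{Upper x, Lower v} \<in> X"
  shows "edge_crossings N X {Upper x, Lower v} = rightward_over X x v + leftward_over X x v
    + card {y. \<exists>z. {Upper y, Upper z} \<in> X \<and> y < x \<and> x < z}
    + card {w. \<exists>z. {Lower w, Lower z} \<in> X \<and> w < v \<and> v < z}"
proof -
  let ?e = "{Upper x, Lower v}"
  \<comment> \<open>The left ends of the edges that cross \<open>?e\<close>.\<close>
  define A where "A = {z. left_of x v z \<and> (\<exists>t. {z, t} \<in> X \<and> t \<notin> ?e \<and> \<not> left_of x v t)}"
  note u = tangle_partner_unique[OF assms(1)] and n = tangle_edgeD[OF assms(1)]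
  have fin: "finite A"
    by (rule finite_subset[OF _ finite_nodes[of N]]) (use n in \<open>auto simp: A_def\<close>)
  have "bij_betw (edge_at X) A {f \<in> X. crosses N ?e f}"
    unfolding bij_betw_def
  proof
    have at: "\<exists>t. edge_at X z = {z, t} \<and> {z, t} \<in> X \<and> left_of x v z \<and> \<not> left_of x v t \<and> t \<notin> ?e \<and> z \<notin> ?e"
      if "z \<in> A" for z
      using that edge_at_eq[OF assms(1)] unfolding A_def by fastforce
    show "inj_on (edge_at X) A"
    proof (rule inj_onI)
      fix z z' assume z: "z \<in> A" "z' \<in> A" "edge_at X z = edge_at X z'"
      then show "z = z'" using at[OF z(1)] at[OF z(2)] by (metis doubleton_eq_iff)
    qed
    show "edge_at X ` A = {f \<in> X. crosses N ?e f}"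
    proof (intro equalityI subsetI)
      fix f assume "f \<in> edge_at X ` A"
      then obtain z where "z \<in> A" "f = edge_at X z" by blast
      then obtain t where "f = {z, t}" "{z, t} \<in> X" "left_of x v z \<noteq> left_of x v t" "t \<notin> ?e" "z \<notin> ?e"
        using at by metis
      then show "f \<in> {f \<in> X. crosses N ?e f}"
        using crosses_vertical_iff[OF assms] n by auto
    next
      fix f assume "f \<in> {f \<in> X. crosses N ?e f}"
      then have f: "f \<in> X" "crosses N ?e f" by auto
      obtain p q where pq: "f = {p, q}" "p \<in> nodes N" "q \<in> nodes N"
        using tangle_edgeE[OF assms(1) f(1)] by metis
      have "f \<noteq> ?e" using f(2) by auto
      then have ne: "p \<notin> ?e" "q \<notin> ?e"
        using tangle_edge_unique[OF assms(1) f(1) assms(2)] pq(1) by blast+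
      have "left_of x v p \<noteq> left_of x v q"
        using crosses_vertical_iff[OF assms pq(2,3) ne] f(2) pq(1) by simp
      moreover have "f \<in> edge_at X ` A" if "f = {p, q}" "left_of x v p" "\<not> left_of x v q" "q \<notin> ?e" for p q
      proof -
        have "p \<in> A" using that f(1) unfolding A_def by blast
        moreover have "edge_at X p = f" using that f(1) edge_at_eq[OF assms(1)] by simp
        ultimately show ?thesis by blast
      qed
      ultimately show "f \<in> edge_at X ` A"
        using pq(1) ne by (metis insert_commute)
    qed
  qed
  then have "edge_crossings N X ?e = card A"
    unfolding edge_crossings_def by (metis bij_betw_same_card)
  also have "\<dots> = card {y. Upper y \<in> A} + card {w. Lower w \<in> A}"
    by (rule card_nodes[OF fin])
  also have "{y. Upper y \<in> A} = {y. \<exists>z. {Upper y, Upper z} \<in> X \<and> y < x \<and> x < z}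
      \<union> {y. \<exists>w. {Upper y, Lower w} \<in> X \<and> y < x \<and> v < w}" (is "_ = ?U \<union> ?V")
  proof (rule set_eqI)
    fix y
    have "(\<exists>t. {Upper y, t} \<in> X \<and> t \<notin> ?e \<and> \<not> left_of x v t) \<longleftrightarrow>
        (\<exists>z. {Upper y, Upper z} \<in> X \<and> x < z) \<or> (\<exists>w. {Upper y, Lower w} \<in> X \<and> v < w)"
      by (auto, (metis left_of.simps node.exhaust nat_neq_iff)+)
    then show "y \<in> {y. Upper y \<in> A} \<longleftrightarrow> y \<in> ?U \<union> ?V"
      unfolding A_def by auto
  qed
  also have "card (?U \<union> ?V) = card ?U + card ?V"
  proof (rule card_Un_disjoint)
    show "finite ?U" "finite ?V" by (rule finite_subset[of _ "{..<x}"]; auto)+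
    show "?U \<inter> ?V = {}" using u by blast
  qed
  also have "{w. Lower w \<in> A} = {w. \<exists>z. {Lower w, Lower z} \<in> X \<and> w < v \<and> v < z}
      \<union> {w. \<exists>y. {Upper y, Lower w} \<in> X \<and> x < y \<and> w < v}" (is "_ = ?S \<union> ?T")
  proof (rule set_eqI)
    fix w
    have "(\<exists>t. {Lower w, t} \<in> X \<and> t \<notin> ?e \<and> \<not> left_of x v t) \<longleftrightarrow>
        (\<exists>z. {Lower w, Lower z} \<in> X \<and> v < z) \<or> (\<exists>y. {Upper y, Lower w} \<in> X \<and> x < y)"
      by (auto simp: insert_commute, (metis left_of.simps node.exhaust nat_neq_iff insert_commute)+)
    then show "w \<in> {w. Lower w \<in> A} \<longleftrightarrow> w \<in> ?S \<union> ?T"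
      unfolding A_def by auto
  qed
  also have "card (?S \<union> ?T) = card ?S + card ?T"
  proof (rule card_Un_disjoint)
    show "finite ?S" "finite ?T" by (rule finite_subset[of _ "{..<v}"]; auto)+
    show "?S \<inter> ?T = {}" using u by (auto simp: insert_commute)
  qed
  finally show ?thesis by (simp add: rightward_over_def leftward_over_def)
qed

lemma tangle_edge_iff:
  assumes "tangle N X" "{p, t} \<in> X"
  shows "{p, q} \<in> X \<longleftrightarrow> q = t" "{q, p} \<in> X \<longleftrightarrow> q = t"
  using tangle_partner_unique[OF assms(1)] assms(2) by (metis insert_commute)+

lemma tangle_partner_unique':
  assumes "tangle N X" "{x, z} \<in> X" "{y, z} \<in> X"
  shows "x = y"
  using tangle_partner_unique[OF assms(1), of z x y] assms(2,3) by (simp add: insert_commute)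

text \<open>Sorts the \<open>x - 1\<close> upper nodes on the left by their edges: a hook wholly on
  the left contributes both ends, a spanning hook one, and a vertical edge one, on whichever side of
  \<open>v\<close> it ends.\<close>

lemma upper_position:
  assumes "tangle N X" "{Upper x, Lower v} \<in> X"
  shows "x = 1 + 2 * upper_hooks_left X x + card {y. \<exists>z. {Upper y, Upper z} \<in> X \<and> y < x \<and> x < z}
    + card {y. \<exists>w. {Upper y, Lower w} \<in> X \<and> y < x \<and> w < v} + rightward_over X x v"
proof -
  note u = tangle_partner_unique[OF assms(1)] and u' = tangle_partner_unique'[OF assms(1)]
    and n = tangle_edgeD[OF assms(1)]
  \<comment> \<open>\<open>?I\<close> and \<open>?H\<close> are the left and right ends of hooks
    wholly on the left, \<open>?G\<close> the left ends of spanning hooks, \<open>?S\<close> the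
    vertical edges that stay on the left, \<open>?B\<close> those that cross.\<close>
  let ?I = "\<lambda>y. \<exists>z. {Upper y, Upper z} \<in> X \<and> y < z \<and> z < x"
  let ?G = "\<lambda>y. \<exists>z. {Upper y, Upper z} \<in> X \<and> y < x \<and> x < z"
  let ?H = "\<lambda>y. \<exists>k. {Upper k, Upper y} \<in> X \<and> k < y \<and> y < x"
  let ?S = "\<lambda>y. \<exists>w. {Upper y, Lower w} \<in> X \<and> y < x \<and> w < v"
  let ?B = "\<lambda>y. \<exists>w. {Upper y, Lower w} \<in> X \<and> y < x \<and> v < w"
  have one: "of_bool (?I y) + of_bool (?G y) + of_bool (?H y) + of_bool (?S y) + of_bool (?B y) = (1::nat)"
    if y: "y \<in> {1..<x}" for y
  proof -
    have "Upper y \<in> nodes N" using y n[OF assms(2)] by auto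
    then obtain t where t: "{Upper y, t} \<in> X" by (rule tangle_partnerE[OF assms(1)])
    have "t \<noteq> Upper y" "t \<noteq> Upper x" "t \<noteq> Lower v"
      using t n(3)[OF t] y assms(2) tangle_edge_iff(2)[OF assms, of "Upper y"]
        tangle_edge_iff(2)[OF assms(1), of "Lower v" "Upper x" "Upper y"]
      by (metis insert_commute, metis node.distinct(1) atLeastLessThan_iff less_irrefl,
          metis node.inject(1) insert_commute atLeastLessThan_iff less_irrefl)
    then show ?thesis
      using y unfolding tangle_edge_iff[OF assms(1) t] by (cases t) (auto simp: of_bool_def)
  qed
  have c: "(\<Sum>y\<in>{1..<x}. of_bool (P y)) = card {y. P y}"
    if "\<And>y. P y \<Longrightarrow> Upper y \<in> nodes N \<and> y < x" for P
    by (rule card_eq_sum_of_bool[symmetric]) (use that in auto)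
  have "x = 1 + (\<Sum>y\<in>{1..<x}. 1)" using n[OF assms(2)] by auto
  also have "(\<Sum>y\<in>{1..<x}. 1::nat) = (\<Sum>y\<in>{1..<x}. of_bool (?I y) + of_bool (?G y) + of_bool (?H y) + of_bool (?S y) + of_bool (?B y))"
    using one by (intro sum.cong) auto
  also have "\<dots> = card {y. ?I y} + card {y. ?G y} + card {y. ?H y} + card {y. ?S y} + card {y. ?B y}"
    unfolding sum.distrib
    by (intro arg_cong2[where f = "(+)"] c; elim exE conjE; intro conjI; (erule n(1) | erule n(2) | simp))
  also have "card {y. ?I y} = card {y. ?H y}"
    by (rule card_matched) (use u u' in \<open>metis node.inject\<close>)+
  finally show ?thesis unfolding upper_hooks_left_def rightward_over_def by simp
qed

lemma lower_position:
  assumes "tangle N X" "{Upper x, Lower v} \<in> X"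
  shows "v = 1 + 2 * card {d. \<exists>c. {Lower c, Lower d} \<in> X \<and> c < d \<and> d < v}
    + card {w. \<exists>z. {Lower w, Lower z} \<in> X \<and> w < v \<and> v < z}
    + card {w. \<exists>y. {Upper y, Lower w} \<in> X \<and> y < x \<and> w < v} + leftward_over X x v"
proof -
  note u = tangle_partner_unique[OF assms(1)] and u' = tangle_partner_unique'[OF assms(1)]
    and n = tangle_edgeD[OF assms(1)]
  let ?I = "\<lambda>y. \<exists>z. {Lower y, Lower z} \<in> X \<and> y < z \<and> z < v"
  let ?G = "\<lambda>y. \<exists>z. {Lower y, Lower z} \<in> X \<and> y < v \<and> v < z"
  let ?H = "\<lambda>y. \<exists>k. {Lower k, Lower y} \<in> X \<and> k < y \<and> y < v"
  let ?S = "\<lambda>w. \<exists>y. {Upper y, Lower w} \<in> X \<and> y < x \<and> w < v"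
  let ?B = "\<lambda>w. \<exists>y. {Upper y, Lower w} \<in> X \<and> x < y \<and> w < v"
  have one: "of_bool (?I y) + of_bool (?G y) + of_bool (?H y) + of_bool (?S y) + of_bool (?B y) = (1::nat)"
    if y: "y \<in> {1..<v}" for y
  proof -
    have "Lower y \<in> nodes N" using y n[OF assms(2)] by auto
    then obtain t where t: "{Lower y, t} \<in> X" by (rule tangle_partnerE[OF assms(1)])
    have "t \<noteq> Lower y" "t \<noteq> Upper x" "t \<noteq> Lower v"
      using t n(3)[OF t] y assms(2) tangle_edge_iff(2)[OF assms, of "Lower y"]
        tangle_edge_iff(2)[OF assms(1), of "Lower v" "Upper x" "Lower y"]
      by (metis insert_commute, metis node.inject(2) atLeastLessThan_iff less_irrefl,
          metis node.distinct(1) insert_commute atLeastLessThan_iff less_irrefl)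
    then show ?thesis
      using y unfolding tangle_edge_iff[OF assms(1) t] by (cases t) (auto simp: of_bool_def)
  qed
  have c: "(\<Sum>y\<in>{1..<v}. of_bool (P y)) = card {y. P y}"
    if "\<And>y. P y \<Longrightarrow> Lower y \<in> nodes N \<and> y < v" for P
    by (rule card_eq_sum_of_bool[symmetric]) (use that in auto)
  have "v = 1 + (\<Sum>y\<in>{1..<v}. 1)" using n[OF assms(2)] by auto
  also have "(\<Sum>y\<in>{1..<v}. 1::nat) = (\<Sum>y\<in>{1..<v}. of_bool (?I y) + of_bool (?G y) + of_bool (?H y) + of_bool (?S y) + of_bool (?B y))"
    using one by (intro sum.cong) auto
  also have "\<dots> = card {y. ?I y} + card {y. ?G y} + card {y. ?H y} + card {y. ?S y} + card {y. ?B y}"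
    unfolding sum.distrib
    by (intro arg_cong2[where f = "(+)"] c; elim exE conjE; intro conjI; (erule n(1) | erule n(2) | simp))
  also have "card {y. ?I y} = card {y. ?H y}"
    by (rule card_matched) (use u u' in \<open>metis node.inject\<close>)+
  finally show ?thesis unfolding leftward_over_def by simp
qed

text \<open>Both rows have \<open>N\<close> nodes and lose the same number to vertical edges; the
  remaining nodes of each row are paired by hooks.\<close>

lemma hook_count_lower:
  assumes "tangle N X"
  shows "hook_count X = card {d. \<exists>c. {Lower c, Lower d} \<in> X \<and> c < d}"
proof -
  note u = tangle_partner_unique[OF assms(1)] and u' = tangle_partner_unique'[OF assms(1)]
    and n = tangle_edgeD[OF assms(1)]
  have fin: "(\<Sum>y\<in>{1..N}. of_bool (P y)) = card {y. P y}"
    if "\<And>y. P y \<Longrightarrow> F y \<in> nodes N" "F = Upper \<or> F = Lower" for P F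
    by (rule card_eq_sum_of_bool[symmetric]) (use that in auto)
  have split: "N = card {y. \<exists>z. {F y, F z} \<in> X \<and> y < z} + card {y. \<exists>z. {F z, F y} \<in> X \<and> z < y}
      + card {y. \<exists>w. {F y, G w} \<in> X}" (is "N = card {y. ?I y} + card {y. ?H y} + card {y. ?V y}")
    if FG: "F = Upper \<and> G = Lower \<or> F = Lower \<and> G = Upper" for F G
  proof -
    have one: "of_bool (?I y) + of_bool (?H y) + of_bool (?V y) = (1::nat)" if y: "y \<in> {1..N}" for y
    proof -
      have "F y \<in> nodes N" using y FG by auto
      then obtain t where t: "{F y, t} \<in> X" by (rule tangle_partnerE[OF assms(1)])
      have "t \<noteq> F y" using n(3)[OF t] by auto
      then show ?thesis
        using FG unfolding tangle_edge_iff[OF assms(1) t] by (cases t) (auto simp: of_bool_def)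
    qed
    have "N = (\<Sum>y\<in>{1..N}. 1)" by simp
    also have "\<dots> = (\<Sum>y\<in>{1..N}. of_bool (?I y) + of_bool (?H y) + of_bool (?V y))"
      using one by (intro sum.cong) auto
    also have "\<dots> = card {y. ?I y} + card {y. ?H y} + card {y. ?V y}"
      unfolding sum.distrib
      by (intro arg_cong2[where f = "(+)"] fin[where F = F]; (elim exE conjE)?; (erule n(1) | erule n(2) | use FG in blast))
    finally show ?thesis .
  qed
  have eq: "card {y. \<exists>z. {F y, F z} \<in> X \<and> y < z} = card {y. \<exists>z. {F z, F y} \<in> X \<and> z < y}"
    if "F = Upper \<or> F = Lower" for F
    by (rule card_matched) (use u u' that in \<open>metis node.inject\<close>)+
  have "card {y. \<exists>w. {Upper y, Lower w} \<in> X} = card {w. \<exists>y. {Upper y, Lower w} \<in> X}"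
    by (rule card_matched) (use u u' in \<open>metis node.inject\<close>)+
  moreover have "{w. \<exists>y. {Upper y, Lower w} \<in> X} = {w. \<exists>y. {Lower w, Upper y} \<in> X}"
    by (simp add: insert_commute)
  ultimately show ?thesis
    using split[of Upper Lower] split[of Lower Upper] eq[of Upper] eq[of Lower]
    unfolding hook_count_def by simp
qed

lemma finite_hooks:
  assumes "tangle N X"
  shows "finite {j. \<exists>k. {Upper k, Upper j} \<in> X \<and> P j k}" "finite {j. \<exists>k. {Upper j, Upper k} \<in> X \<and> P j k}"
    "finite {d. \<exists>c. {Lower c, Lower d} \<in> X \<and> P c d}" "finite {c. \<exists>d. {Lower c, Lower d} \<in> X \<and> P c d}"
    "finite {y. \<exists>w. {Upper y, Lower w} \<in> X \<and> P y w}" "finite {w. \<exists>y. {Upper y, Lower w} \<in> X \<and> P y w}"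
  by (rule finite_subset[of _ "{..N}"]; use tangle_edgeD[OF assms] in force)+

text \<open>Inserting both position formulas into the crossing count; the vertical edges staying on
  the left are counted from either end and cancel.\<close>

lemma edge_crossings_vertical_left:
  assumes "tangle N X" "{Upper x, Lower v} \<in> X"
  shows "edge_crossings N X {Upper x, Lower v} + v + 2 * upper_hooks_left X x
    = x + 2 * (leftward_over X x v + lower_hooks_left X v)"
proof -
  note u = tangle_partner_unique[OF assms(1)] and u' = tangle_partner_unique'[OF assms(1)]
  have s: "card {y. \<exists>w. {Upper y, Lower w} \<in> X \<and> y < x \<and> w < v}
      = card {w. \<exists>y. {Upper y, Lower w} \<in> X \<and> y < x \<and> w < v}"
    by (rule card_matched) (use u u' in \<open>metis node.inject\<close>)+
  have "{c. \<exists>d. {Lower c, Lower d} \<in> X \<and> c < d \<and> c < v} =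
     {c. \<exists>d. {Lower c, Lower d} \<in> X \<and> c < d \<and> d < v} \<union> {c. \<exists>d. {Lower c, Lower d} \<in> X \<and> c < v \<and> v < d}"
    using tangle_edge_iff(2)[OF assms(1) assms(2)[unfolded insert_commute[of "Upper x"]]]
    by (auto; metis nat_neq_iff node.distinct(1))
  then have "lower_hooks_left X v = card ({c. \<exists>d. {Lower c, Lower d} \<in> X \<and> c < d \<and> d < v} \<union>
      {c. \<exists>d. {Lower c, Lower d} \<in> X \<and> c < v \<and> v < d})"
    unfolding lower_hooks_left_def by simp
  also have "\<dots> = card {c. \<exists>d. {Lower c, Lower d} \<in> X \<and> c < d \<and> d < v}
      + card {c. \<exists>d. {Lower c, Lower d} \<in> X \<and> c < v \<and> v < d}"
  proof (rule card_Un_disjoint)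
    show "{c. \<exists>d. {Lower c, Lower d} \<in> X \<and> c < d \<and> d < v} \<inter>
      {c. \<exists>d. {Lower c, Lower d} \<in> X \<and> c < v \<and> v < d} = {}" using u by fastforce
  qed (rule finite_hooks[OF assms(1)])+
  also have "card {c. \<exists>d. {Lower c, Lower d} \<in> X \<and> c < d \<and> d < v}
      = card {d. \<exists>c. {Lower c, Lower d} \<in> X \<and> c < d \<and> d < v}"
    by (rule card_matched) (use u u' in \<open>metis node.inject\<close>)+
  finally have l: "lower_hooks_left X v = card {d. \<exists>c. {Lower c, Lower d} \<in> X \<and> c < d \<and> d < v}
      + card {c. \<exists>d. {Lower c, Lower d} \<in> X \<and> c < v \<and> v < d}" .
  have arith: "c + v + 2 * UL = x + 2 * (al + LL)"
    if "LL = I + d" "c = be + al + g + d" "x = 1 + 2 * UL + g + s + be" "v = 1 + 2 * I + d + s' + al" "s = s'"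
    for c v UL x al LL I d be g s s' :: nat
    using that by simp
  show ?thesis
    by (rule arith[OF l edge_crossings_vertical[OF assms] upper_position[OF assms] lower_position[OF assms] s])
qed

text \<open>No mirrored count is made: equality of the hook numbers of the two rows turns the hooks
  on the left in the position formulas into hooks on the right.\<close>

lemma edge_crossings_vertical_right:
  assumes "tangle N X" "{Upper x, Lower v} \<in> X"
  shows "edge_crossings N X {Upper x, Lower v} + x + 2 * upper_hooks_right X x
    = v + 2 * (rightward_over X x v + lower_hooks_right X v)"
proof -
  note u = tangle_partner_unique[OF assms(1)] and u' = tangle_partner_unique'[OF assms(1)]
  have s: "card {y. \<exists>w. {Upper y, Lower w} \<in> X \<and> y < x \<and> w < v}
      = card {w. \<exists>y. {Upper y, Lower w} \<in> X \<and> y < x \<and> w < v}"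
    by (rule card_matched) (use u u' in \<open>metis node.inject\<close>)+
  have x: "{Upper k, Upper x} \<notin> X" "{Upper x, Upper k} \<notin> X" for k
    using tangle_edge_iff[OF assms(1,2)] by auto
  have v: "{Lower k, Lower v} \<notin> X" for k
    using tangle_edge_iff(2)[OF assms(1), of "Lower v" "Upper x" "Lower k"] assms(2) by (simp add: insert_commute)
  let ?L = "{j. \<exists>k. {Upper j, Upper k} \<in> X \<and> j < k \<and> k < x}" and
    ?M = "{j. \<exists>k. {Upper j, Upper k} \<in> X \<and> j < x \<and> x < k}" and
    ?R = "{j. \<exists>k. {Upper j, Upper k} \<in> X \<and> j < k \<and> x < j}"
  have "hook_count X = card {j. \<exists>k. {Upper j, Upper k} \<in> X \<and> j < k}"
    unfolding hook_count_def by (rule card_matched[symmetric]) (use u u' in \<open>metis node.inject\<close>)+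
  also have "{j. \<exists>k. {Upper j, Upper k} \<in> X \<and> j < k} = ?L \<union> ?M \<union> ?R"
  proof (rule set_eqI)
    fix j
    show "j \<in> {j. \<exists>k. {Upper j, Upper k} \<in> X \<and> j < k} \<longleftrightarrow> j \<in> ?L \<union> ?M \<union> ?R"
    proof
      assume "j \<in> {j. \<exists>k. {Upper j, Upper k} \<in> X \<and> j < k}"
      then obtain k where k: "{Upper j, Upper k} \<in> X" "j < k" by blast
      then have "j \<noteq> x" "k \<noteq> x" using x by auto
      then consider "k < x" | "j < x" "x < k" | "x < j" using k(2) by linarith
      then show "j \<in> ?L \<union> ?M \<union> ?R" using k by cases auto
    qed auto
  qed
  also have "card \<dots> = card (?L \<union> ?M) + card ?R"
  proof (rule card_Un_disjoint)
    show "(?L \<union> ?M) \<inter> ?R = {}" by auto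
  qed (intro finite_UnI finite_hooks[OF assms(1)])+
  also have "card (?L \<union> ?M) = card ?L + card ?M"
  proof (rule card_Un_disjoint)
    show "?L \<inter> ?M = {}" using u by fastforce
  qed (rule finite_hooks[OF assms(1)])+
  also have "card ?L = card {k. \<exists>j. {Upper j, Upper k} \<in> X \<and> j < k \<and> k < x}"
    by (rule card_matched) (use u u' in \<open>metis node.inject\<close>)+
  finally have HU: "hook_count X = upper_hooks_left X x + card ?M + upper_hooks_right X x"
    unfolding upper_hooks_left_def upper_hooks_right_def .
  let ?D = "{d. \<exists>c. {Lower c, Lower d} \<in> X \<and> c < d \<and> d < v}" and ?E = "{d. \<exists>c. {Lower c, Lower d} \<in> X \<and> c < d \<and> v < d}"
  have "hook_count X = card {d. \<exists>c. {Lower c, Lower d} \<in> X \<and> c < d}"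
    by (rule hook_count_lower[OF assms(1)])
  also have "{d. \<exists>c. {Lower c, Lower d} \<in> X \<and> c < d} = ?D \<union> ?E"
    using v by (auto; metis nat_neq_iff)
  also have "card (?D \<union> ?E) = card ?D + card ?E"
  proof (rule card_Un_disjoint)
    show "?D \<inter> ?E = {}" by auto
  qed (rule finite_hooks[OF assms(1)])+
  finally have HL: "hook_count X = card ?D + lower_hooks_right X v"
    unfolding lower_hooks_right_def .
  have arith: "c + x + 2 * UR = v + 2 * (be + LR)"
    if "H = UL + g + UR" "H = I + LR" "c = be + al + g + d" "x = 1 + 2 * UL + g + s + be"
      "v = 1 + 2 * I + d + s' + al" "s = s'"
    for c v UL x al LR UR H I d be g s s' :: nat
    using that by simp
  show ?thesis
    by (rule arith[OF HU HL edge_crossings_vertical[OF assms] upper_position[OF assms] lower_position[OF assms] s])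
qed

subsection \<open>Hooks\<close>

text \<open>A crossing edge has an end strictly between \<open>u\<close> and \<open>v\<close> and is
  determined by it.\<close>

lemma edge_crossings_le_separated:
  assumes "tangle N X" "{u, v} \<in> X"
  shows "edge_crossings N X {u, v} \<le> card {z \<in> nodes N. separates N u v z}"
proof -
  have "{f \<in> X. crosses N {u, v} f} \<subseteq> edge_at X ` {z \<in> nodes N. separates N u v z}"
  proof
    fix f assume "f \<in> {f \<in> X. crosses N {u, v} f}"
    then have f: "f \<in> X" "crosses N {u, v} f" by auto
    obtain p q where pq: "f = {p, q}" "p \<in> nodes N" "q \<in> nodes N"
      using tangle_edgeE[OF assms(1) f(1)] by metis
    have "f \<noteq> {u, v}" using f(2) by auto
    then have "p \<notin> {u, v}" "q \<notin> {u, v}"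
      using tangle_edge_unique[OF assms(1) f(1) assms(2)] pq(1) by blast+
    then have "separates N u v p \<noteq> separates N u v q"
      using crosses_edge_iff[OF assms pq(2,3)] f(2) pq(1) by simp
    then consider "separates N u v p" | "separates N u v q" by blast
    then show "f \<in> edge_at X ` {z \<in> nodes N. separates N u v z}"
    proof cases
      case 1
      then show ?thesis
        using edge_at_eq[OF assms(1) f(1), of p] pq by (intro image_eqI[of _ _ p]) auto
    next
      case 2
      then show ?thesis
        using edge_at_eq[OF assms(1) f(1), of q] pq by (intro image_eqI[of _ _ q]) auto
    qed
  qed
  then show ?thesis
    unfolding edge_crossings_def by (rule surj_card_le[rotated]) simp
qed

text \<open>A hook from \<open>a\<close> to \<open>b\<close> has only \<open>b - a - 1\<close> nodes
  under it, so its crossings stay below its size. A rewiring therefore never changes the weight of a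
  hook that it keeps.\<close>

lemma edge_weight_hook:
  assumes "tangle N X" "{F a, F b} \<in> X" "F = Upper \<or> F = Lower"
  shows "edge_weight N X {F a, F b} = edge_size {F a, F b}"
proof -
  have *: "edge_crossings N X {F a, F b} \<le> edge_size {F a, F b}" if ab: "{F a, F b} \<in> X" "a < b" for a b
  proof -
    have "{z \<in> nodes N. separates N (F a) (F b) z} \<subseteq> F ` {a<..<b}"
    proof
      fix z assume "z \<in> {z \<in> nodes N. separates N (F a) (F b) z}"
      then show "z \<in> F ` {a<..<b}"
        using assms(3) ab(2) tangle_edgeD[OF assms(1) ab(1)]
        by (cases z) (auto simp: separates_def image_iff)
    qed
    then have "card {z \<in> nodes N. separates N (F a) (F b) z} \<le> card {a<..<b}"
      by (rule surj_card_le[rotated]) simp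
    then show ?thesis
      using edge_crossings_le_separated[OF assms(1) ab(1)] assms(3) ab(2) by (auto simp: edge_size_pair)
  qed
  have "a \<noteq> b" using tangle_edgeD(3)[OF assms(1,2)] by auto
  then consider "a < b" | "b < a" by linarith
  then have "edge_crossings N X {F a, F b} \<le> edge_size {F a, F b}"
  proof cases
    case 2
    then show ?thesis using *[of b a] assms(2) by (simp add: insert_commute)
  qed (use * assms(2) in auto)
  then show ?thesis by (simp add: edge_weight_def)
qed

subsection \<open>Descents\<close>

text \<open>A drop by 2 is the most that one prime allows, so each descent uses up exactly one
  letter of a shortest word.\<close>

definition has_descent :: "nat \<Rightarrow> edge set \<Rightarrow> bool" where
  "has_descent N X \<longleftrightarrow> (\<exists>p X'. 1 \<le> index p \<and> index p < N \<and> tangle N X' \<and>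
     tcomp (prime_tangle N p) X' = X \<and> total_weight N X' + 2 \<le> total_weight N X)"

text \<open>Both crossing numbers fall by one, while a size may fall or rise by one. If it rises,
  \<open>edge_size + 1\<close> must not exceed \<open>edge_crossings - 1\<close>, which is the slack
  of 2.\<close>

lemma T_descent:
  assumes "tangle N X" "1 \<le> i" "i < N" "{Upper i, a} \<in> X" "{b, Upper (i + 1)} \<in> X" "a \<noteq> Upper (i + 1)"
    and cross: "crosses N {Upper i, a} {b, Upper (i + 1)}"
    and right: "i < label a \<or> edge_size {Upper i, a} + 2 \<le> edge_crossings N X {Upper i, a}"
    and left: "label b < i + 1 \<or> edge_size {b, Upper (i + 1)} + 2 \<le> edge_crossings N X {b, Upper (i + 1)}"
  shows "has_descent N X"
proof -
  let ?X' = "rewire X (Upper i) a b (Upper (i + 1))"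
  have ne: "{Upper i, a} \<noteq> {b, Upper (i + 1)}" using assms(6) by (auto simp: doubleton_eq_iff)
  note T = T_rewire_crossings[OF assms(1-6)]
  have "total_weight N ?X' + 2 \<le> total_weight N X + 0"
  proof (rule total_weight_rewire_le[OF assms(1,4,5) ne])
    show "edge_weight N ?X' g \<le> edge_weight N X g" if "g \<in> X" "g \<in> ?X'" for g
      using T(1)[OF that] by (simp add: edge_weight_def)
    have c: "edge_crossings N ?X' {Upper i, b} + 1 = edge_crossings N X {b, Upper (i + 1)}"
      "edge_crossings N ?X' {a, Upper (i + 1)} + 1 = edge_crossings N X {Upper i, a}"
      using T(2,3) cross by auto
    have "edge_weight N ?X' {Upper i, b} + 1 \<le> edge_weight N X {b, Upper (i + 1)}"
      using c(1) left unfolding edge_weight_def by (auto simp: edge_size_pair)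
    moreover have "edge_weight N ?X' {a, Upper (i + 1)} + 1 \<le> edge_weight N X {Upper i, a}"
      using c(2) right unfolding edge_weight_def by (auto simp: edge_size_pair)
    ultimately show "edge_weight N ?X' {Upper i, b} + edge_weight N ?X' {a, Upper (i + 1)} + 2
        \<le> edge_weight N X {Upper i, a} + edge_weight N X {b, Upper (i + 1)} + 0"
      by linarith
  qed
  then show ?thesis
    unfolding has_descent_def
    using assms(2,3) tangle_rewire[OF assms(1,4,5) ne] tcomp_T_T[OF assms(1-3)] tcomp_T_rewire[OF assms(1-6)]
    by (intro exI[of _ "TPrime i"] exI[of _ ?X']) simp
qed

text \<open>Undoes a \<open>U\<close>-prime by cutting \<open>{a, b}\<close> at the hook.
  \<open>less\<close> provides one unit and the vanishing hook the other; \<open>vert\<close> rules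
  out vertical edges that would gain two crossings.\<close>

lemma U_descent:
  assumes "tangle N X" "1 \<le> i" "i < N" "{Upper i, Upper (i + 1)} \<in> X" "{a, b} \<in> X"
    and ne: "{Upper i, Upper (i + 1)} \<noteq> {a, b}"
    and vert: "\<And>x v. {Upper x, Lower v} \<in> X \<Longrightarrow> {Upper x, Lower v} \<noteq> {a, b} \<Longrightarrow>
      crosses N {Upper x, Lower v} {Upper i, a} \<Longrightarrow> crosses N {Upper x, Lower v} {Upper (i + 1), b} \<Longrightarrow> False"
    and less: "edge_weight N (rewire X (Upper i) (Upper (i + 1)) a b) {Upper i, a}
      + edge_weight N (rewire X (Upper i) (Upper (i + 1)) a b) {Upper (i + 1), b} + 1 \<le> edge_weight N X {a, b}"
  shows "has_descent N X"
proof -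
  let ?X' = "rewire X (Upper i) (Upper (i + 1)) a b" and ?h = "{Upper i, Upper (i + 1)}"
  note d = rewire_nodes_distinct[OF assms(1,4,5) ne]
  note n = tangle_edgeD[OF assms(1,4)] tangle_edgeD[OF assms(1,5)]
  have tX': "tangle N ?X'" by (rule tangle_rewire[OF assms(1,4,5) ne])
  have "total_weight N ?X' + 2 \<le> total_weight N X + 0"
  proof (rule total_weight_rewire_le[OF assms(1,4,5) ne])
    show "edge_weight N ?X' g \<le> edge_weight N X g" if g: "g \<in> X" "g \<in> ?X'" for g
    proof -
      obtain p q where pq: "g = {p, q}"
        using tangle_edgeE[OF assms(1) g(1)] by metis
      consider F a b where "F = Upper \<or> F = Lower" "g = {F a, F b}" | x v where "g = {Upper x, Lower v}"
        using pq by (cases p; cases q) (blast, blast, metis insert_commute, blast)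
      then show ?thesis
      proof cases
        case 1
        then show ?thesis
          using edge_weight_hook[OF assms(1)] edge_weight_hook[OF tX'] g by simp
      next
        case (2 x v)
        note nc = rewire_common_edge[OF assms(1,4,5) ne g(2)]
        note o = rewire_other_edges[OF assms(1,4,5) g(1) nc]
        note c = crosses_edge_iff[OF assms(1) g(1)[unfolded 2]]
        have gn: "Upper x \<in> nodes N" "Lower v \<in> nodes N"
          using tangle_edgeD[OF assms(1) g(1)[unfolded 2]] by auto
        \<comment> \<open>Hence \<open>g\<close> misses the hook, and it crosses
          \<open>{a, b}\<close> exactly when it crosses one of the two pieces but not the
          other.\<close>
        have s: "separates N (Upper x) (Lower v) (Upper i) = separates N (Upper x) (Lower v) (Upper (i + 1))"
          using o(1,2) 2 by (intro separates_adjacent[OF gn assms(2,3)]) auto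
        have "crosses N g {Upper i, a} \<longleftrightarrow> separates N (Upper x) (Lower v) (Upper i) \<noteq> separates N (Upper x) (Lower v) a"
          "crosses N g {Upper (i + 1), b} \<longleftrightarrow> separates N (Upper x) (Lower v) (Upper (i + 1)) \<noteq> separates N (Upper x) (Lower v) b"
          "crosses N g {a, b} \<longleftrightarrow> separates N (Upper x) (Lower v) a \<noteq> separates N (Upper x) (Lower v) b"
          "\<not> crosses N g ?h"
          unfolding 2 using o[unfolded 2] n s by (subst c; simp)+
        moreover have "\<not> (crosses N g {Upper i, a} \<and> crosses N g {Upper (i + 1), b})"
          using vert[of x v] g(1) 2 nc by auto
        ultimately have "edge_crossings N ?X' g \<le> edge_crossings N X g"
          using edge_crossings_rewire[OF assms(1,4,5) ne, of g] s
          by (auto simp: of_bool_def split: if_splits)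
        then show ?thesis by (auto simp: edge_weight_def)
      qed
    qed
    have "edge_weight N X ?h \<ge> 1" by (simp add: edge_weight_def edge_size_pair)
    then show "edge_weight N ?X' {Upper i, a} + edge_weight N ?X' {Upper (i + 1), b} + 2
        \<le> edge_weight N X ?h + edge_weight N X {a, b} + 0"
      using less by linarith
  qed
  moreover have "tcomp (prime_tangle N (UPrime i)) ?X' = X"
  proof -
    have "{Upper i, a} \<in> ?X'" "{Upper (i + 1), b} \<in> ?X'" by (auto simp: rewire_def)
    then show ?thesis
      using tcomp_U_rewire[OF tX' assms(2,3)] d rewire_rewire[OF assms(1,4,5) ne] by metis
  qed
  ultimately show ?thesis
    unfolding has_descent_def using assms(2,3) tX'
    by (intro exI[of _ "UPrime i"] exI[of _ ?X']) simp
qed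

section \<open>Turning points and upper hooks\<close>

definition points_right :: "edge set \<Rightarrow> nat \<Rightarrow> bool" where
  "points_right X i \<longleftrightarrow> (\<exists>a. {Upper i, a} \<in> X \<and> i < label a)"

text \<open>Unless they form a hook, the edges at \<open>i\<close> and \<open>i + 1\<close> cross. A straight edge at \<open>i + 1\<close> has an
  even crossing number, so being crossed once it is crossed twice and the \<open>T\<close>-prime lowers its weight.\<close>

lemma turning_point:
  assumes "tangle N X" "\<not> has_descent N X" "1 \<le> i" "i < N" "points_right X i" "\<not> points_right X (i + 1)"
  shows "{Upper i, Upper (i + 1)} \<in> X"
proof (rule ccontr)
  assume no_hook: "{Upper i, Upper (i + 1)} \<notin> X"
  obtain a where a: "{Upper i, a} \<in> X" "i < label a"
    using assms(5) unfolding points_right_def by blast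
  have n: "Upper (i + 1) \<in> nodes N" using assms by auto
  obtain b where b': "{Upper (i + 1), b} \<in> X" by (rule tangle_partnerE[OF assms(1) n])
  then have b: "{b, Upper (i + 1)} \<in> X" by (simp add: insert_commute)
  have lb: "label b \<le> i + 1"
    using assms(6) b' unfolding points_right_def by (metis not_le)
  have ai: "a \<noteq> Upper (i + 1)" using no_hook a by auto
  then have ne: "{Upper i, a} \<noteq> {b, Upper (i + 1)}" by (auto simp: doubleton_eq_iff)
  note d = rewire_nodes_distinct[OF assms(1) a(1) b ne]
  note n = tangle_edgeD[OF assms(1) a(1)] tangle_edgeD[OF assms(1) b]
  have sep: "separates N (Upper i) a (Upper (i + 1))"
    using a(2) ai n(2) assms(4) by (cases a) (auto simp: separates_def)
  have nsep: "\<not> separates N (Upper i) a b"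
    using a(2) lb ai d n by (cases a; cases b) (auto simp: separates_def)
  have cross: "crosses N {Upper i, a} {b, Upper (i + 1)}"
    using crosses_edge_iff[OF assms(1) a(1) n(4,5)] d sep nsep by auto
  have "has_descent N X"
  proof (rule T_descent[OF assms(1,3,4) a(1) b ai cross])
    show "i < label a \<or> edge_size {Upper i, a} + 2 \<le> edge_crossings N X {Upper i, a}" using a by simp
    show "label b < i + 1 \<or> edge_size {b, Upper (i + 1)} + 2 \<le> edge_crossings N X {b, Upper (i + 1)}"
    proof (cases "label b = i + 1")
      case True
      then have bl: "b = Lower (i + 1)" using d(6) n(6) by (cases b) auto
      let ?f = "{Upper (i + 1), Lower (i + 1)}"
      \<comment> \<open>For a straight edge the labels cancel and all remaining terms are
        even.\<close>
      have "edge_crossings N X ?f + (i + 1) + 2 * upper_hooks_right X (i + 1)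
          = (i + 1) + 2 * (rightward_over X (i + 1) (i + 1) + lower_hooks_right X (i + 1))"
        using b' bl by (intro edge_crossings_vertical_right[OF assms(1)]) simp
      then have "even (edge_crossings N X ?f)" by presburger
      moreover have "edge_crossings N X ?f \<noteq> 0"
      proof -
        have "{Upper i, a} \<in> {f \<in> X. crosses N ?f f}"
          using cross a(1) bl crosses_sym by (auto simp: insert_commute)
        then show ?thesis
          using finite_tangle[OF assms(1)] unfolding edge_crossings_def by (auto simp: card_eq_0_iff)
      qed
      ultimately have "2 \<le> edge_crossings N X ?f" by presburger
      then show ?thesis using bl by (simp add: edge_size_pair insert_commute)
    qed (use lb in simp)
  qed
  then show False using assms(2) by simp
qed

lemma last_before_change:
  fixes a b :: nat
  assumes "P a" "\<not> P b" "a < b"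
  shows "\<exists>i. a \<le> i \<and> i < b \<and> P i \<and> \<not> P (i + 1)"
  using assms
proof (induction "b - a" arbitrary: b)
  case (Suc k)
  then obtain b' where b: "b = Suc b'" by (cases b) auto
  show ?case
  proof (cases "P b'")
    case True
    then show ?thesis using Suc b by (intro exI[of _ b']) auto
  next
    case False
    then have "a < b'" using Suc b by (metis less_SucE)
    moreover from this have "k = b' - a" using Suc.hyps(2) b by linarith
    ultimately obtain i where "a \<le> i" "i < b'" "P i" "\<not> P (i + 1)"
      using Suc.hyps(1)[of b'] Suc.prems(1) False by blast
    then show ?thesis using b by (intro exI[of _ i]) auto
  qed
qed simp

text \<open>Going from left to right, the partner of \<open>Upper i\<close> cannot be an earlier
  upper node, which would point right, nor an earlier lower node, which is already matched straight;
  only \<open>Lower i\<close> is left.\<close>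

lemma no_right_pointing_id:
  assumes "tangle N X" "\<And>i. 1 \<le> i \<Longrightarrow> i \<le> N \<Longrightarrow> \<not> points_right X i"
  shows "X = id_tangle N"
proof -
  have "{Upper i, Lower i} \<in> X" if "1 \<le> i" "i \<le> N" for i
    using that
  proof (induction i rule: less_induct)
    case (less i)
    then have "Upper i \<in> nodes N" by simp
    then obtain t where t: "{Upper i, t} \<in> X" by (rule tangle_partnerE[OF assms(1)])
    note n = tangle_edgeD[OF assms(1) t]
    have l: "label t \<le> i" using assms(2)[of i] less t unfolding points_right_def by (metis not_le)
    show ?case
    proof (cases t)
      case (Upper k)
      then have "k < i" "1 \<le> k" using l n by auto
      then have "points_right X k"
        using t Upper unfolding points_right_def by (intro exI[of _ "Upper i"]) (simp add: insert_commute)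
      then show ?thesis using assms(2)[of k] \<open>1 \<le> k\<close> \<open>k < i\<close> less by simp
    next
      case (Lower v)
      show ?thesis
      proof (cases "v = i")
        case False
        then have "{Upper v, Lower v} \<in> X" using less l n Lower by auto
        then have "Upper v = Upper i" using tangle_partner_unique'[OF assms(1) _ t] Lower by simp
        then show ?thesis using False by simp
      qed (use t Lower in simp)
    qed
  qed
  then have "id_tangle N \<subseteq> X" unfolding id_tangle_def by auto
  then show ?thesis using tangle_subset_eq[OF tangle_id assms(1)] by simp
qed

text \<open>Some upper node points right, but the last one cannot, so there is a turning point in
  between.\<close>

lemma ex_adjacent_hook:
  assumes "tangle N X" "\<not> has_descent N X" "X \<noteq> id_tangle N"
  shows "\<exists>i\<ge>1. i < N \<and> {Upper i, Upper (i + 1)} \<in> X"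
proof -
  obtain i where i: "1 \<le> i" "i \<le> N" "points_right X i"
    using no_right_pointing_id[OF assms(1)] assms(3) by blast
  have N: "\<not> points_right X N"
  proof
    assume "points_right X N"
    then obtain a where "{Upper N, a} \<in> X" "N < label a" unfolding points_right_def by blast
    then show False using tangle_edgeD(2)[OF assms(1), of "Upper N" a] by (cases a) auto
  qed
  then have "i < N" using i by (metis le_neq_implies_less)
  then obtain j where "i \<le> j" "j < N" "points_right X j" "\<not> points_right X (j + 1)"
    using last_before_change[of "points_right X" i N] i N by blast
  then show ?thesis using turning_point[OF assms(1,2), of j] i by (intro exI[of _ j]) auto
qed

text \<open>A longer hook has a turning point strictly inside, since \<open>a\<close> points right
  and \<open>b\<close> does not. Cutting it there gives hooks of sizes \<open>i - a\<close> and
  \<open>b - (i + 1)\<close> over disjoint ranges, and a vertical edge has its upper end under at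
  most one of them.\<close>

lemma hooks_adjacent:
  assumes "tangle N X" "\<not> has_descent N X" "{Upper a, Upper b} \<in> X" "a < b"
  shows "b = a + 1"
proof (rule ccontr)
  assume "b \<noteq> a + 1"
  note n = tangle_edgeD[OF assms(1,3)]
  have "points_right X a" using assms(3,4) unfolding points_right_def by force
  moreover have "\<not> points_right X b"
    using tangle_edge_iff(1)[OF assms(1), of "Upper b" "Upper a"] assms(3,4)
    unfolding points_right_def by (auto simp: insert_commute)
  ultimately obtain i where i: "a \<le> i" "i < b" "points_right X i" "\<not> points_right X (i + 1)"
    using last_before_change[of "points_right X" a b] assms(4) by blast
  have "1 \<le> i" "i < N" using i n by auto
  note iN = this
  have hook: "{Upper i, Upper (i + 1)} \<in> X"
    using turning_point[OF assms(1,2) iN i(3,4)] .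
  have "i \<noteq> a"
    using tangle_partner_unique[OF assms(1,3), of "Upper (i + 1)"] hook \<open>b \<noteq> a + 1\<close> by auto
  moreover have "i + 1 \<noteq> b"
    using tangle_edge_iff(1)[OF assms(1), of "Upper b" "Upper a"] hook assms(3) \<open>i \<noteq> a\<close> by (auto simp: insert_commute)
  ultimately have lt: "a < i" "i + 1 < b" using i by auto
  have ne: "{Upper i, Upper (i + 1)} \<noteq> {Upper a, Upper b}" using lt by (auto simp: doubleton_eq_iff)
  note tX' = tangle_rewire[OF assms(1) hook assms(3) ne]
  have mem: "{Upper i, Upper a} \<in> rewire X (Upper i) (Upper (i + 1)) (Upper a) (Upper b)"
    "{Upper (i + 1), Upper b} \<in> rewire X (Upper i) (Upper (i + 1)) (Upper a) (Upper b)"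
    by (auto simp: rewire_def)
  have "has_descent N X"
  proof (rule U_descent[OF assms(1) iN hook assms(3) ne])
    fix x v assume xv: "{Upper x, Lower v} \<in> X" "{Upper x, Lower v} \<noteq> {Upper a, Upper b}"
      "crosses N {Upper x, Lower v} {Upper i, Upper a}" "crosses N {Upper x, Lower v} {Upper (i + 1), Upper b}"
    have x: "x \<noteq> i" "x \<noteq> i + 1" "x \<noteq> a" "x \<noteq> b"
      using tangle_edge_unique[OF assms(1) xv(1) hook, of "Upper x"]
        tangle_edge_unique[OF assms(1) xv(1) assms(3), of "Upper x"]
      by (auto simp: doubleton_eq_iff)
    show False
      using xv(3,4) x lt n iN crosses_vertical_iff[OF assms(1) xv(1), of "Upper i" "Upper a"]
        crosses_vertical_iff[OF assms(1) xv(1), of "Upper (i + 1)" "Upper b"] by auto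
  next
    have "edge_weight N X {Upper a, Upper b} = edge_size {Upper a, Upper b}"
      by (rule edge_weight_hook[OF assms(1,3)]) simp
    moreover note edge_weight_hook[OF tX' mem(1)] edge_weight_hook[OF tX' mem(2)]
    ultimately show "edge_weight N (rewire X (Upper i) (Upper (i + 1)) (Upper a) (Upper b)) {Upper i, Upper a}
      + edge_weight N (rewire X (Upper i) (Upper (i + 1)) (Upper a) (Upper b)) {Upper (i + 1), Upper b} + 1
      \<le> edge_weight N X {Upper a, Upper b}"
      using lt by (simp add: edge_size_pair)
  qed
  then show False using assms(2) by simp
qed

section \<open>Cutting a vertical edge above a hook\<close>

lemma vertical_not_hook_end:
  assumes "tangle N X" "{Upper i, Upper j} \<in> X" "{Upper x, Lower v} \<in> X"
  shows "x \<noteq> i" "x \<noteq> j"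
  using tangle_edge_unique[OF assms(1) assms(3,2), of "Upper x"] by (auto simp: doubleton_eq_iff)

lemma hook_left_end_not_right_end:
  assumes "tangle N X" "{Upper i, Upper j} \<in> X" "{Upper j, Upper k} \<in> X"
  shows "k = i"
  using tangle_partner_unique[OF assms(1), of "Upper j" "Upper i" "Upper k"] assms(2,3)
  by (simp add: insert_commute)

lemma edge_weight_vertical_leI:
  assumes "edge_crossings N X {Upper x, Lower v} \<le> k" "v \<le> x + k" "x \<le> v + k"
  shows "edge_weight N X {Upper x, Lower v} \<le> k"
  using assms by (simp add: edge_weight_def edge_size_pair)

text \<open>By the crossing identity, \<open>strict\<close> says that the edge has fewer crossings
  than its size \<open>v - a\<close>. The vertical piece at \<open>i + 1\<close> keeps the counts of
  the edge, except that the hook at \<open>i\<close> is no longer on its right; strictness pays for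
  this. \<open>no_over\<close> excludes edges crossing both pieces.\<close>

lemma vertical_descent_right:
  assumes "tangle N X" "1 \<le> i" "i < N" "{Upper i, Upper (i + 1)} \<in> X"
    and adj: "\<And>j k. {Upper j, Upper k} \<in> X \<Longrightarrow> j < k \<Longrightarrow> k = j + 1"
    and av: "{Upper a, Lower v} \<in> X" "a < i" "i < v"
    and strict: "rightward_over X a v + lower_hooks_right X v < upper_hooks_right X a"
    and no_hook: "\<And>j. a < j \<Longrightarrow> j < i \<Longrightarrow> {Upper j, Upper (j + 1)} \<notin> X"
    and no_over: "\<And>x w. {Upper x, Lower w} \<in> X \<Longrightarrow> a < x \<Longrightarrow> x < i \<Longrightarrow> v < w \<Longrightarrow> False"
  shows "has_descent N X"
proof (rule U_descent[OF assms(1-4) av(1)])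
  let ?X' = "rewire X (Upper i) (Upper (i + 1)) (Upper a) (Lower v)"
  show ne: "{Upper i, Upper (i + 1)} \<noteq> {Upper a, Lower v}" by (auto simp: doubleton_eq_iff)
  note tX' = tangle_rewire[OF assms(1,4) av(1) ne]
  note fin = finite_hooks[OF assms(1)] finite_hooks[OF tX']
  note n = tangle_edgeD[OF assms(1) av(1)]
  show False if xw: "{Upper x, Lower w} \<in> X" "{Upper x, Lower w} \<noteq> {Upper a, Lower v}"
    "crosses N {Upper x, Lower w} {Upper i, Upper a}" "crosses N {Upper x, Lower w} {Upper (i + 1), Lower v}" for x w
  proof -
    have x: "x \<noteq> i" "x \<noteq> i + 1" using vertical_not_hook_end[OF assms(1,4) xw(1)] by auto
    have "x \<noteq> a" "w \<noteq> v"
      using tangle_edge_unique[OF assms(1) xw(1) av(1)] xw(2) by blast+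
    then show False
      using xw x n av assms(2,3) crosses_vertical_iff[OF assms(1) xw(1), of "Upper i" "Upper a"]
        crosses_vertical_iff[OF assms(1) xw(1), of "Upper (i + 1)" "Lower v"] no_over[OF xw(1)] by auto
  qed
  have mem: "{Upper i, Upper a} \<in> ?X'" "{Upper (i + 1), Lower v} \<in> ?X'"
    by (auto simp: rewire_def)
  have w1: "edge_weight N ?X' {Upper i, Upper a} = i - a"
    using edge_weight_hook[OF tX' mem(1)] av by (simp add: edge_size_pair)
  have "rightward_over ?X' (i + 1) v \<le> rightward_over X a v"
    unfolding rightward_over_def
  proof (rule card_mono[OF fin(5)], rule subsetI)
    fix y assume "y \<in> {y. \<exists>w. {Upper y, Lower w} \<in> ?X' \<and> y < i + 1 \<and> v < w}"
    then obtain w where w: "{Upper y, Lower w} \<in> ?X'" "y < i + 1" "v < w" by blast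
    then have yw: "{Upper y, Lower w} \<in> X" by (auto simp: rewire_def doubleton_eq_iff)
    have "y \<noteq> i" using vertical_not_hook_end[OF assms(1,4) yw] by auto
    moreover have "y \<noteq> a" using tangle_partner_unique[OF assms(1) av(1), of "Lower w"] yw w by auto
    ultimately have "y < a" using no_over[OF yw] w by (metis Suc_eq_plus1 less_SucE linorder_neqE_nat)
    then show "y \<in> {y. \<exists>w. {Upper y, Lower w} \<in> X \<and> y < a \<and> v < w}" using yw w by blast
  qed
  moreover have "lower_hooks_right ?X' v \<le> lower_hooks_right X v"
    unfolding lower_hooks_right_def
    by (rule card_mono[OF fin(3)]) (auto simp: rewire_def doubleton_eq_iff)
  \<comment> \<open>Hooks to the right of \<open>a\<close> start at \<open>i\<close> or beyond
    \<open>i + 1\<close>; only the one at \<open>i\<close> is cut away.\<close>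
  moreover have "upper_hooks_right X a \<le> upper_hooks_right ?X' (i + 1) + 1"
  proof -
    have "upper_hooks_right X a \<le> card (insert i {j. \<exists>k. {Upper j, Upper k} \<in> ?X' \<and> j < k \<and> i + 1 < j})"
      unfolding upper_hooks_right_def
    proof (rule card_mono, simp add: fin(8) del: One_nat_def, rule subsetI)
      fix j assume "j \<in> {j. \<exists>k. {Upper j, Upper k} \<in> X \<and> j < k \<and> a < j}"
      then obtain k where k: "{Upper j, Upper k} \<in> X" "j < k" "a < j" by blast
      then have k1: "k = j + 1" using adj by blast
      then have "\<not> j < i" using no_hook k by blast
      moreover have "j \<noteq> i + 1"
        using hook_left_end_not_right_end[OF assms(1,4), of k] k by auto
      moreover have "{Upper j, Upper k} \<in> ?X'" if "i + 1 < j"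
        using that k av by (auto simp: rewire_def doubleton_eq_iff)
      ultimately show "j \<in> insert i {j. \<exists>k. {Upper j, Upper k} \<in> ?X' \<and> j < k \<and> i + 1 < j}"
        using k by (cases "j = i") auto
    qed
    also have "\<dots> \<le> upper_hooks_right ?X' (i + 1) + 1"
      unfolding upper_hooks_right_def using card_insert_if[OF fin(8)] by simp
    finally show ?thesis .
  qed
  moreover note edge_crossings_vertical_right[OF tX' mem(2)] strict
  ultimately have "edge_weight N ?X' {Upper (i + 1), Lower v} \<le> v - (i + 1)"
    using av by (intro edge_weight_vertical_leI) auto
  moreover have "v - a \<le> edge_weight N X {Upper a, Lower v}"
    by (simp add: edge_weight_def edge_size_pair)
  ultimately show "edge_weight N ?X' {Upper i, Upper a} + edge_weight N ?X' {Upper (i + 1), Lower v} + 1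
      \<le> edge_weight N X {Upper a, Lower v}"
    using w1 av by linarith
qed

text \<open>The mirror image. The vertical piece now starts at \<open>i\<close> instead of
  \<open>i + 1\<close>, which is why \<open>w \<le> i\<close> suffices where the right version needs
  \<open>i < v\<close>.\<close>

lemma vertical_descent_left:
  assumes "tangle N X" "1 \<le> i" "i < N" "{Upper i, Upper (i + 1)} \<in> X"
    and adj: "\<And>j k. {Upper j, Upper k} \<in> X \<Longrightarrow> j < k \<Longrightarrow> k = j + 1"
    and bw: "{Upper b, Lower w} \<in> X" "i + 1 < b" "w \<le> i"
    and strict: "leftward_over X b w + lower_hooks_left X w < upper_hooks_left X b"
    and no_hook: "\<And>j. i < j \<Longrightarrow> j < b \<Longrightarrow> {Upper j, Upper (j + 1)} \<notin> X"
    and no_over: "\<And>x u. {Upper x, Lower u} \<in> X \<Longrightarrow> i + 1 < x \<Longrightarrow> x < b \<Longrightarrow> u < w \<Longrightarrow> False"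
  shows "has_descent N X"
proof -
  let ?X' = "rewire X (Upper i) (Upper (i + 1)) (Lower w) (Upper b)"
  have wb: "{Lower w, Upper b} \<in> X" using bw(1) by (simp add: insert_commute)
  have ne: "{Upper i, Upper (i + 1)} \<noteq> {Lower w, Upper b}" by (auto simp: doubleton_eq_iff)
  note tX' = tangle_rewire[OF assms(1,4) wb ne]
  note fin = finite_hooks[OF assms(1)] finite_hooks[OF tX']
  note n = tangle_edgeD[OF assms(1) wb]
  show ?thesis
  proof (rule U_descent[OF assms(1-4) wb ne])
    show False if xu: "{Upper x, Lower u} \<in> X" "{Upper x, Lower u} \<noteq> {Lower w, Upper b}"
      "crosses N {Upper x, Lower u} {Upper i, Lower w}" "crosses N {Upper x, Lower u} {Upper (i + 1), Upper b}" for x u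
    proof -
      have x: "x \<noteq> i" "x \<noteq> i + 1" using vertical_not_hook_end[OF assms(1,4) xu(1)] by auto
      have "x \<noteq> b" "u \<noteq> w"
        using tangle_edge_unique[OF assms(1) xu(1) wb] xu(2) by blast+
      then show False
        using xu x n bw assms(2,3) crosses_vertical_iff[OF assms(1) xu(1), of "Upper i" "Lower w"]
          crosses_vertical_iff[OF assms(1) xu(1), of "Upper (i + 1)" "Upper b"] no_over[OF xu(1)] by auto
    qed
    have mem: "{Upper i, Lower w} \<in> ?X'" "{Upper (i + 1), Upper b} \<in> ?X'"
      by (auto simp: rewire_def)
    have w1: "edge_weight N ?X' {Upper (i + 1), Upper b} = b - (i + 1)"
      using edge_weight_hook[OF tX' mem(2)] bw by (simp add: edge_size_pair)
    have "leftward_over ?X' i w \<le> leftward_over X b w"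
      unfolding leftward_over_def
    proof (rule card_mono[OF fin(6)], rule subsetI)
      fix u assume "u \<in> {u. \<exists>y. {Upper y, Lower u} \<in> ?X' \<and> i < y \<and> u < w}"
      then obtain y where y: "{Upper y, Lower u} \<in> ?X'" "i < y" "u < w" by blast
      then have yu: "{Upper y, Lower u} \<in> X" by (auto simp: rewire_def doubleton_eq_iff)
      have "y \<noteq> i + 1" using vertical_not_hook_end[OF assms(1,4) yu] by auto
      moreover have "y \<noteq> b" using tangle_partner_unique[OF assms(1) bw(1), of "Lower u"] yu y by auto
      ultimately have "b < y" using no_over[OF yu] y by (metis Suc_eq_plus1 Suc_lessI linorder_neqE_nat)
      then show "u \<in> {u. \<exists>y. {Upper y, Lower u} \<in> X \<and> b < y \<and> u < w}" using yu y by blast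
    qed
    moreover have "lower_hooks_left ?X' w \<le> lower_hooks_left X w"
      unfolding lower_hooks_left_def
      by (rule card_mono[OF fin(4)]) (auto simp: rewire_def doubleton_eq_iff)
    moreover have "upper_hooks_left X b \<le> upper_hooks_left ?X' i + 1"
    proof -
      have "upper_hooks_left X b \<le> card (insert (i + 1) {j. \<exists>k. {Upper k, Upper j} \<in> ?X' \<and> k < j \<and> j < i})"
        unfolding upper_hooks_left_def
      proof (rule card_mono, simp add: fin(7) del: One_nat_def, rule subsetI)
        fix j assume "j \<in> {j. \<exists>k. {Upper k, Upper j} \<in> X \<and> k < j \<and> j < b}"
        then obtain k where k: "{Upper k, Upper j} \<in> X" "k < j" "j < b" by blast
        then have k1: "j = k + 1" using adj by blast
        then have "\<not> i < k" using no_hook[of k] k by auto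
        moreover have "j \<noteq> i"
          using hook_left_end_not_right_end[OF assms(1) k(1), of "i + 1"] k assms(4) by auto
        moreover have "{Upper k, Upper j} \<in> ?X'" if "j < i"
          using that k bw by (auto simp: rewire_def doubleton_eq_iff)
        ultimately show "j \<in> insert (i + 1) {j. \<exists>k. {Upper k, Upper j} \<in> ?X' \<and> k < j \<and> j < i}"
          using k k1 by (cases "j = i + 1") auto
      qed
      also have "\<dots> \<le> upper_hooks_left ?X' i + 1"
        unfolding upper_hooks_left_def using card_insert_if[OF fin(7)] by simp
      finally show ?thesis .
    qed
    moreover note edge_crossings_vertical_left[OF tX' mem(1)] strict
    ultimately have "edge_weight N ?X' {Upper i, Lower w} \<le> i - w"
      using bw by (intro edge_weight_vertical_leI) auto
    moreover have "b - w \<le> edge_weight N X {Lower w, Upper b}"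
      by (simp add: edge_weight_def edge_size_pair)
    ultimately show "edge_weight N ?X' {Upper i, Lower w} + edge_weight N ?X' {Upper (i + 1), Upper b} + 1
        \<le> edge_weight N X {Lower w, Upper b}"
      using w1 bw by linarith
  qed
qed

text \<open>A violation with \<open>i - a\<close> minimal admits a descent, as nothing lies between \<open>a\<close> and \<open>i\<close>.\<close>

lemma no_strict_right:
  assumes "tangle N X" "\<not> has_descent N X"
    and "1 \<le> i" "i < N" "{Upper i, Upper (i + 1)} \<in> X" "{Upper a, Lower v} \<in> X" "a < i" "i < v"
  shows "upper_hooks_right X a \<le> rightward_over X a v + lower_hooks_right X v"
  using assms(3-8)
proof (induction "i - a" arbitrary: i a v rule: less_induct)
  case less
  note adj = hooks_adjacent[OF assms(1,2)]
  note fin = finite_hooks[OF assms(1)]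
  show ?case
  proof (rule ccontr)
    assume "\<not> upper_hooks_right X a \<le> rightward_over X a v + lower_hooks_right X v"
    then have strict: "rightward_over X a v + lower_hooks_right X v < upper_hooks_right X a" by simp
    \<comment> \<open>At a hook closer to \<open>a\<close>, the same edge would be a smaller
      violation.\<close>
    have no_hook: "{Upper j, Upper (j + 1)} \<notin> X" if "a < j" "j < i" for j
      using less.hyps[of j a v] less.prems that strict by fastforce
    have "has_descent N X"
    proof (rule vertical_descent_right[OF assms(1) less.prems(1-3) adj less.prems(4-6) strict no_hook])
      fix x w assume xw: "{Upper x, Lower w} \<in> X" "a < x" "x < i" "v < w"
      \<comment> \<open>Among the edges over \<open>(a, v')\<close> that start between
        \<open>a\<close> and \<open>i\<close>, the one with the largest lower end is a violation
        nearer to \<open>i\<close>: nothing new lies over it, no lower hook is added, and no upper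
        hook lies between \<open>a\<close> and \<open>i\<close>.\<close>
      define S where "S = {w. \<exists>x. {Upper x, Lower w} \<in> X \<and> a < x \<and> x < i \<and> v < w}"
      have "finite S" unfolding S_def by (rule fin(6))
      moreover have "S \<noteq> {}" using xw unfolding S_def by blast
      ultimately have "Max S \<in> S" and max: "\<And>w. w \<in> S \<Longrightarrow> w \<le> Max S" by auto
      then obtain y where y: "{Upper y, Lower (Max S)} \<in> X" "a < y" "y < i" "v < Max S"
        unfolding S_def by blast
      let ?w = "Max S"
      have "rightward_over X y ?w \<le> rightward_over X a v"
        unfolding rightward_over_def
      proof (rule card_mono[OF fin(5)], rule subsetI)
        fix z assume "z \<in> {z. \<exists>w. {Upper z, Lower w} \<in> X \<and> z < y \<and> ?w < w}"
        then obtain w where w: "{Upper z, Lower w} \<in> X" "z < y" "?w < w" by blast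
        have "w \<notin> S" using max w(3) by (meson not_le)
        then have "\<not> a < z" using w y unfolding S_def by (auto dest: less_trans)
        moreover have "z \<noteq> a" using tangle_partner_unique[OF assms(1) less.prems(4), of "Lower w"] w y by auto
        ultimately show "z \<in> {z. \<exists>w. {Upper z, Lower w} \<in> X \<and> z < a \<and> v < w}"
          using w y by (auto intro!: exI[of _ w])
      qed
      moreover have "lower_hooks_right X ?w \<le> lower_hooks_right X v"
        unfolding lower_hooks_right_def by (rule card_mono[OF fin(3)]) (use y in auto)
      moreover have "upper_hooks_right X a \<le> upper_hooks_right X y"
        unfolding upper_hooks_right_def
      proof (rule card_mono[OF fin(2)], rule subsetI)
        fix j assume "j \<in> {j. \<exists>k. {Upper j, Upper k} \<in> X \<and> j < k \<and> a < j}"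
        then obtain k where k: "{Upper j, Upper k} \<in> X" "j < k" "a < j" by blast
        have "\<not> j < i" using no_hook[of j] k adj[OF k(1,2)] by auto
        then show "j \<in> {j. \<exists>k. {Upper j, Upper k} \<in> X \<and> j < k \<and> y < j}"
          using k y by (auto intro!: exI[of _ k])
      qed
      moreover have "upper_hooks_right X y \<le> rightward_over X y ?w + lower_hooks_right X ?w"
        using less.hyps[of i y ?w] less.prems y by auto
      ultimately show False using strict by linarith
    qed
    then show False using assms(2) by simp
  qed
qed

text \<open>Mirror image of \<open>no_strict_right\<close>, by induction on \<open>b - i\<close>: a
  violation nearest to its hook could be cut.\<close>

lemma no_strict_left:
  assumes "tangle N X" "\<not> has_descent N X"
    and "1 \<le> i" "i < N" "{Upper i, Upper (i + 1)} \<in> X" "{Upper b, Lower w} \<in> X" "i + 1 < b" "w \<le> i"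
  shows "upper_hooks_left X b \<le> leftward_over X b w + lower_hooks_left X w"
  using assms(3-8)
proof (induction "b - i" arbitrary: i b w rule: less_induct)
  case less
  note adj = hooks_adjacent[OF assms(1,2)]
  note fin = finite_hooks[OF assms(1)]
  show ?case
  proof (rule ccontr)
    assume "\<not> upper_hooks_left X b \<le> leftward_over X b w + lower_hooks_left X w"
    then have strict: "leftward_over X b w + lower_hooks_left X w < upper_hooks_left X b" by simp
    have no_hook: "{Upper j, Upper (j + 1)} \<notin> X" if "i < j" "j < b" for j
    proof
      assume hook: "{Upper j, Upper (j + 1)} \<in> X"
      have "j + 1 \<noteq> b" using vertical_not_hook_end[OF assms(1) hook less.prems(4)] by simp
      moreover have "j < N" using tangle_edgeD(2)[OF assms(1) hook] by simp
      ultimately show False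
        using less.hyps[of b j w] less.prems that strict hook by fastforce
    qed
    have "has_descent N X"
    proof (rule vertical_descent_left[OF assms(1) less.prems(1-3) adj less.prems(4-6) strict no_hook])
      fix x u assume xu: "{Upper x, Lower u} \<in> X" "i + 1 < x" "x < b" "u < w"
      \<comment> \<open>Here the smallest lower end gives the violation nearer to the hook.\<close>
      define S where "S = {u. \<exists>x. {Upper x, Lower u} \<in> X \<and> i + 1 < x \<and> x < b \<and> u < w}"
      have "finite S" unfolding S_def by (rule fin(6))
      moreover have "S \<noteq> {}" using xu unfolding S_def by blast
      ultimately have "Min S \<in> S" and min: "\<And>u. u \<in> S \<Longrightarrow> Min S \<le> u" by auto
      then obtain y where y: "{Upper y, Lower (Min S)} \<in> X" "i + 1 < y" "y < b" "Min S < w"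
        unfolding S_def by blast
      let ?u = "Min S"
      have "leftward_over X y ?u \<le> leftward_over X b w"
        unfolding leftward_over_def
      proof (rule card_mono[OF fin(6)], rule subsetI)
        fix u assume "u \<in> {u. \<exists>z. {Upper z, Lower u} \<in> X \<and> y < z \<and> u < ?u}"
        then obtain z where z: "{Upper z, Lower u} \<in> X" "y < z" "u < ?u" by blast
        have "u \<notin> S" using min z(3) by (meson not_le)
        then have "\<not> z < b" using z y unfolding S_def by (auto dest: less_trans)
        moreover have "z \<noteq> b" using tangle_partner_unique[OF assms(1) less.prems(4), of "Lower u"] z y by auto
        ultimately show "u \<in> {u. \<exists>z. {Upper z, Lower u} \<in> X \<and> b < z \<and> u < w}"
          using z y by (auto intro!: exI[of _ z])
      qed
      moreover have "lower_hooks_left X ?u \<le> lower_hooks_left X w"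
        unfolding lower_hooks_left_def by (rule card_mono[OF fin(4)]) (use y in auto)
      moreover have "upper_hooks_left X b \<le> upper_hooks_left X y"
        unfolding upper_hooks_left_def
      proof (rule card_mono[OF fin(1)], rule subsetI)
        fix j assume "j \<in> {j. \<exists>k. {Upper k, Upper j} \<in> X \<and> k < j \<and> j < b}"
        then obtain k where k: "{Upper k, Upper j} \<in> X" "k < j" "j < b" by blast
        have "\<not> i < k" using no_hook[of k] k adj[OF k(1,2)] by auto
        then show "j \<in> {j. \<exists>k. {Upper k, Upper j} \<in> X \<and> k < j \<and> j < y}"
          using k y adj[OF k(1,2)] by (auto intro!: exI[of _ k])
      qed
      moreover have "upper_hooks_left X y \<le> leftward_over X y ?u + lower_hooks_left X ?u"
        using less.hyps[of y i ?u] less.prems y by auto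
      ultimately show False using strict by linarith
    qed
    then show False using assms(2) by simp
  qed
qed

section \<open>A lower hook below an upper hook\<close>

lemma card_large_rank:
  fixes f :: "'a \<Rightarrow> nat"
  assumes "finite A" "inj_on f A" "f ` A \<subseteq> {..<card A}" "k < card A"
  shows "card {x \<in> A. k < f x} + (k + 1) \<le> card A"
proof -
  have "card {x \<in> A. k < f x} = card (f ` {x \<in> A. k < f x})"
    using assms(2) by (intro card_image[symmetric]) (auto simp: inj_on_def)
  also have "\<dots> \<le> card {k<..<card A}"
    using assms(3) by (intro card_mono) auto
  finally show ?thesis using assms(4) by simp
qed

text \<open>The rank inside a finite set is injective and stays below the cardinality, so at most
  \<open>card A - k - 1\<close> elements have a rank above \<open>k\<close>.\<close>

lemma card_below_rank:
  fixes A :: "nat set"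
  assumes "finite A" "k < card A"
  shows "card {x \<in> A. k < card {y \<in> A. y < x}} + (k + 1) \<le> card A"
proof (rule card_large_rank[OF assms(1) _ _ assms(2)])
  have less: "card {z \<in> A. z < x} < card {z \<in> A. z < y}" if "x \<in> A" "x < y" for x y
    using assms(1) that by (intro psubset_card_mono) auto
  show "inj_on (\<lambda>x. card {y \<in> A. y < x}) A"
  proof (rule inj_onI)
    fix x y assume "x \<in> A" "y \<in> A" "card {z \<in> A. z < x} = card {z \<in> A. z < y}"
    then show "x = y" using less[of x y] less[of y x] by (metis less_irrefl linorder_neqE_nat)
  qed
  show "(\<lambda>x. card {y \<in> A. y < x}) ` A \<subseteq> {..<card A}"
    using assms(1) by (auto intro!: psubset_card_mono)
qed

lemma card_above_rank:
  fixes A :: "nat set"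
  assumes "finite A" "k < card A"
  shows "card {x \<in> A. k < card {y \<in> A. x < y}} + (k + 1) \<le> card A"
proof (rule card_large_rank[OF assms(1) _ _ assms(2)])
  have less: "card {z \<in> A. y < z} < card {z \<in> A. x < z}" if "y \<in> A" "x < y" for x y
    using assms(1) that by (intro psubset_card_mono) auto
  show "inj_on (\<lambda>x. card {y \<in> A. x < y}) A"
  proof (rule inj_onI)
    fix x y assume "x \<in> A" "y \<in> A" "card {z \<in> A. x < z} = card {z \<in> A. y < z}"
    then show "x = y" using less[of x y] less[of y x] by (metis less_irrefl linorder_neqE_nat)
  qed
  show "(\<lambda>x. card {y \<in> A. x < y}) ` A \<subseteq> {..<card A}"
    using assms(1) by (auto intro!: psubset_card_mono)
qed

text \<open>Pigeonhole: at most \<open>hook_count X - l - 1\<close> hooks are too far to the right by left end, at most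
  \<open>hook_count X - r - 1\<close> too far to the left by right end, and these do not exhaust all hooks.\<close>

lemma ex_balanced_lower_hook:
  assumes "tangle N X" "hook_count X \<le> l + r + 1" "l < hook_count X" "r < hook_count X"
  shows "\<exists>c d. {Lower c, Lower d} \<in> X \<and> c < d \<and> lower_hooks_left X c \<le> l \<and> lower_hooks_right X d \<le> r"
proof (rule ccontr)
  assume none: "\<not> ?thesis"
  note fin = finite_hooks[OF assms(1)]
  note u = tangle_partner_unique[OF assms(1)] and u' = tangle_partner_unique'[OF assms(1)]
  define A where "A = {c. \<exists>d. {Lower c, Lower d} \<in> X \<and> c < d}"
  define B where "B = {d. \<exists>c. {Lower c, Lower d} \<in> X \<and> c < d}"
  have finA: "finite A" and finB: "finite B" unfolding A_def B_def by (rule fin)+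
  have B: "card B = hook_count X" unfolding B_def by (rule hook_count_lower[OF assms(1), symmetric])
  have "card A = card B"
    unfolding A_def B_def by (rule card_matched) (use u u' in \<open>metis node.inject\<close>)+
  then have A: "card A = hook_count X" using B by simp
  have left: "lower_hooks_left X c = card {y \<in> A. y < c}" for c
    unfolding lower_hooks_left_def A_def by (rule arg_cong[where f = card]) blast
  have right: "lower_hooks_right X d = card {y \<in> B. d < y}" for d
    unfolding lower_hooks_right_def B_def by (rule arg_cong[where f = card]) blast
  have "A \<subseteq> {c \<in> A. l < lower_hooks_left X c} \<union> {c. \<exists>d. {Lower c, Lower d} \<in> X \<and> c < d \<and> r < lower_hooks_right X d}"
    using none unfolding A_def by force
  then have "card A \<le> card ({c \<in> A. l < lower_hooks_left X c} \<union> {c. \<exists>d. {Lower c, Lower d} \<in> X \<and> c < d \<and> r < lower_hooks_right X d})"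
    using finA fin(4) by (intro card_mono) auto
  also have "\<dots> \<le> card {c \<in> A. l < lower_hooks_left X c} + card {c. \<exists>d. {Lower c, Lower d} \<in> X \<and> c < d \<and> r < lower_hooks_right X d}"
    by (rule card_Un_le)
  also have "card {c. \<exists>d. {Lower c, Lower d} \<in> X \<and> c < d \<and> r < lower_hooks_right X d}
      = card {d. \<exists>c. {Lower c, Lower d} \<in> X \<and> c < d \<and> r < lower_hooks_right X d}"
    by (rule card_matched) (use u u' in \<open>metis node.inject\<close>)+
  also have "{d. \<exists>c. {Lower c, Lower d} \<in> X \<and> c < d \<and> r < lower_hooks_right X d} = {d \<in> B. r < lower_hooks_right X d}"
    unfolding B_def by blast
  finally have "card A \<le> card {c \<in> A. l < lower_hooks_left X c} + card {d \<in> B. r < lower_hooks_right X d}" .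
  moreover have "card {c \<in> A. l < lower_hooks_left X c} + (l + 1) \<le> card A"
    unfolding left by (rule card_below_rank[OF finA]) (use A assms in simp)
  moreover have "card {d \<in> B. r < lower_hooks_right X d} + (r + 1) \<le> card B"
    unfolding right by (rule card_above_rank[OF finB]) (use B assms in simp)
  ultimately show False using A B assms(2) by linarith
qed

text \<open>Otherwise the lower nodes beyond \<open>i\<close> have too few partners: the upper nodes beyond \<open>i\<close> include
  \<open>i + 1\<close> and the ends of at least as many hooks.\<close>

lemma lower_hook_spans_right:
  assumes "tangle N X" "1 \<le> i" "i < N" "{Upper i, Upper (i + 1)} \<in> X"
    and hooks: "lower_hooks_right X d \<le> upper_hooks_right X (i + 1)"
    and no_over: "\<And>x w. {Upper x, Lower w} \<in> X \<Longrightarrow> x < i \<Longrightarrow> i < w \<Longrightarrow> d < w \<Longrightarrow> False"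
  shows "i < d"
proof (rule ccontr)
  assume "\<not> i < d"
  note u = tangle_partner_unique[OF assms(1)] and u' = tangle_partner_unique'[OF assms(1)]
    and n = tangle_edgeD[OF assms(1)] and fin = finite_hooks[OF assms(1)]
  let ?r = "upper_hooks_right X (i + 1)"
  let ?P = "{w. \<exists>y. {Upper y, Lower w} \<in> X \<and> i + 1 < y \<and> i < w}"
  let ?Q = "{w. \<exists>z. {Lower w, Lower z} \<in> X \<and> w < z \<and> i < w}"
  let ?R = "{z. \<exists>w. {Lower w, Lower z} \<in> X \<and> w < z \<and> i < z}"
  \<comment> \<open>If \<open>d\<close> is at most \<open>i\<close>, \<open>no_over\<close> forces
    every lower node beyond \<open>i\<close> to go up beyond the hook or to be an end of a lower
    hook.\<close>
  have "{i<..N} \<subseteq> ?P \<union> ?Q \<union> ?R"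
  proof
    fix w assume w: "w \<in> {i<..N}"
    then have "Lower w \<in> nodes N" by simp
    then obtain t where t: "{Lower w, t} \<in> X" by (rule tangle_partnerE[OF assms(1)])
    show "w \<in> ?P \<union> ?Q \<union> ?R"
    proof (cases t)
      case (Upper y)
      then have y: "{Upper y, Lower w} \<in> X" using t by (simp add: insert_commute)
      have "y \<noteq> i" "y \<noteq> i + 1" using vertical_not_hook_end[OF assms(1,4) y] by auto
      moreover have "\<not> y < i" using no_over[OF y] w \<open>\<not> i < d\<close> by auto
      ultimately show ?thesis using y w by auto
    next
      case (Lower z)
      then have "z \<noteq> w" using n(3)[OF t] by auto
      then consider "w < z" | "z < w" by linarith
      moreover have "{Lower z, Lower w} \<in> X" using t Lower by (simp add: insert_commute)
      ultimately show ?thesis using t Lower w by cases auto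
    qed
  qed
  then have "card {i<..N} \<le> card (?P \<union> ?Q \<union> ?R)"
    using fin by (intro card_mono finite_UnI) auto
  also have "\<dots> \<le> card ?P + card ?Q + card ?R"
    by (meson add_le_mono1 card_Un_le order_trans)
  finally have le: "N - i \<le> card ?P + card ?Q + card ?R" by simp
  have "card ?R \<le> lower_hooks_right X d"
    unfolding lower_hooks_right_def by (rule card_mono[OF fin(3)]) (use \<open>\<not> i < d\<close> in auto)
  then have R: "card ?R \<le> ?r" using hooks by simp
  have "card ?Q = card {z. \<exists>w. {Lower w, Lower z} \<in> X \<and> w < z \<and> i < w}"
    by (rule card_matched) (use u u' in \<open>metis node.inject\<close>)+
  \<comment> \<open>A hook that starts beyond \<open>i\<close> also ends there.\<close>
  also have "\<dots> \<le> card ?R" by (rule card_mono[OF fin(3)]) (auto dest: less_trans)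
  finally have Q: "card ?Q \<le> card ?R" .
  let ?P' = "{y. \<exists>w. {Upper y, Lower w} \<in> X \<and> i + 1 < y \<and> i < w}"
  let ?L = "{j. \<exists>k. {Upper j, Upper k} \<in> X \<and> j < k \<and> i + 1 < j}"
  let ?E = "{k. \<exists>j. {Upper j, Upper k} \<in> X \<and> j < k \<and> i + 1 < j}"
  have P: "card ?P = card ?P'"
    by (rule card_matched[symmetric]) (use u u' in \<open>metis node.inject\<close>)+
  have L: "card ?L = ?r" unfolding upper_hooks_right_def ..
  have E: "card ?L = card ?E"
    by (rule card_matched) (use u u' in \<open>metis node.inject\<close>)+
  have "card ?P' + card ?L + card ?E = card (?P' \<union> ?L) + card ?E"
  proof -
    have "?P' \<inter> ?L = {}" using u by fastforce
    then show ?thesis using card_Un_disjoint[OF fin(5,2)] by presburger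
  qed
  also have "\<dots> = card (?P' \<union> ?L \<union> ?E)"
  proof (rule card_Un_disjoint[symmetric])
    show "(?P' \<union> ?L) \<inter> ?E = {}"
    proof (rule equals0I)
      fix k assume "k \<in> (?P' \<union> ?L) \<inter> ?E"
      then obtain j where j: "{Upper k, Upper j} \<in> X" "j < k" by (auto simp: insert_commute)
      from \<open>k \<in> (?P' \<union> ?L) \<inter> ?E\<close> consider w where "{Upper k, Lower w} \<in> X"
        | m where "{Upper k, Upper m} \<in> X" "k < m" by blast
      then show False
      proof cases
        case 1
        from u[OF j(1) this] show False by simp
      next
        case 2
        from u[OF j(1) 2(1)] show False using 2(2) j(2) by simp
      qed
    qed
  qed (intro finite_UnI fin)+
  also have "\<dots> \<le> card {i + 1<..N}"
  proof (rule card_mono)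
    show "?P' \<union> ?L \<union> ?E \<subseteq> {i + 1<..N}" using n(1,2) by fastforce
  qed simp
  \<comment> \<open>\<open>i + 1\<close> belongs to the hook, so one place fewer is available than
    on the lower row: \<open>N - i\<close> would be at most \<open>N - (i + 1)\<close>.\<close>
  finally have "card ?P' + ?r + ?r \<le> N - (i + 1)" using L E by simp
  then show False using le R Q P assms(3) by linarith
qed

text \<open>Mirrored count: the \<open>i\<close> lower nodes up to \<open>i\<close> would need
  partners among, or be balanced by, the \<open>i - 1\<close> upper nodes before \<open>i\<close>,
  as \<open>i\<close> itself belongs to the hook.\<close>

lemma lower_hook_spans_left:
  assumes "tangle N X" "1 \<le> i" "i < N" "{Upper i, Upper (i + 1)} \<in> X"
    and hooks: "lower_hooks_left X c \<le> upper_hooks_left X i"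
    and no_over: "\<And>x w. {Upper x, Lower w} \<in> X \<Longrightarrow> i + 1 < x \<Longrightarrow> w \<le> i \<Longrightarrow> w < c \<Longrightarrow> False"
  shows "c \<le> i"
proof (rule ccontr)
  assume "\<not> c \<le> i"
  note u = tangle_partner_unique[OF assms(1)] and u' = tangle_partner_unique'[OF assms(1)]
    and n = tangle_edgeD[OF assms(1)] and fin = finite_hooks[OF assms(1)]
  let ?l = "upper_hooks_left X i"
  let ?P = "{w. \<exists>y. {Upper y, Lower w} \<in> X \<and> y < i \<and> w \<le> i}"
  let ?Q = "{w. \<exists>z. {Lower w, Lower z} \<in> X \<and> w < z \<and> w \<le> i}"
  let ?R = "{z. \<exists>w. {Lower w, Lower z} \<in> X \<and> w < z \<and> z \<le> i}"
  have "{1..i} \<subseteq> ?P \<union> ?Q \<union> ?R"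
  proof
    fix w assume w: "w \<in> {1..i}"
    then have "Lower w \<in> nodes N" using assms by simp
    then obtain t where t: "{Lower w, t} \<in> X" by (rule tangle_partnerE[OF assms(1)])
    show "w \<in> ?P \<union> ?Q \<union> ?R"
    proof (cases t)
      case (Upper y)
      then have y: "{Upper y, Lower w} \<in> X" using t by (simp add: insert_commute)
      have "y \<noteq> i" "y \<noteq> i + 1" using vertical_not_hook_end[OF assms(1,4) y] by auto
      moreover have "\<not> i + 1 < y" using no_over[OF y] w \<open>\<not> c \<le> i\<close> by auto
      ultimately show ?thesis using y w by auto
    next
      case (Lower z)
      then have "z \<noteq> w" using n(3)[OF t] by auto
      then consider "w < z" | "z < w" by linarith
      moreover have "{Lower z, Lower w} \<in> X" using t Lower by (simp add: insert_commute)
      ultimately show ?thesis using t Lower w by cases auto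
    qed
  qed
  then have "card {1..i} \<le> card (?P \<union> ?Q \<union> ?R)"
    using fin by (intro card_mono finite_UnI) auto
  also have "\<dots> \<le> card ?P + card ?Q + card ?R"
    by (meson add_le_mono1 card_Un_le order_trans)
  finally have le: "i \<le> card ?P + card ?Q + card ?R" by simp
  have "card ?Q \<le> lower_hooks_left X c"
    unfolding lower_hooks_left_def by (rule card_mono[OF fin(4)]) (use \<open>\<not> c \<le> i\<close> in auto)
  then have Q: "card ?Q \<le> ?l" using hooks by simp
  have "card ?R = card {w. \<exists>z. {Lower w, Lower z} \<in> X \<and> w < z \<and> z \<le> i}"
    by (rule card_matched[symmetric]) (use u u' in \<open>metis node.inject\<close>)+
  also have "\<dots> \<le> card ?Q" by (rule card_mono[OF fin(4)]) auto
  finally have R: "card ?R \<le> card ?Q" .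
  let ?P' = "{y. \<exists>w. {Upper y, Lower w} \<in> X \<and> y < i \<and> w \<le> i}"
  let ?L = "{j. \<exists>k. {Upper j, Upper k} \<in> X \<and> j < k \<and> k < i}"
  let ?E = "{k. \<exists>j. {Upper j, Upper k} \<in> X \<and> j < k \<and> k < i}"
  have P: "card ?P = card ?P'"
    by (rule card_matched[symmetric]) (use u u' in \<open>metis node.inject\<close>)+
  have L: "card ?E = ?l" unfolding upper_hooks_left_def ..
  have E: "card ?L = card ?E"
    by (rule card_matched) (use u u' in \<open>metis node.inject\<close>)+
  have "card ?P' + card ?L + card ?E = card (?P' \<union> ?L) + card ?E"
  proof -
    have "?P' \<inter> ?L = {}" using u by fastforce
    then show ?thesis using card_Un_disjoint[OF fin(5,2)] by presburger
  qed
  also have "\<dots> = card (?P' \<union> ?L \<union> ?E)"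
  proof (rule card_Un_disjoint[symmetric])
    show "(?P' \<union> ?L) \<inter> ?E = {}"
    proof (rule equals0I)
      fix k assume "k \<in> (?P' \<union> ?L) \<inter> ?E"
      then obtain j where j: "{Upper k, Upper j} \<in> X" "j < k" by (auto simp: insert_commute)
      from \<open>k \<in> (?P' \<union> ?L) \<inter> ?E\<close> consider w where "{Upper k, Lower w} \<in> X"
        | m where "{Upper k, Upper m} \<in> X" "k < m" by blast
      then show False
      proof cases
        case 1
        from u[OF j(1) this] show False by simp
      next
        case 2
        from u[OF j(1) 2(1)] show False using 2(2) j(2) by simp
      qed
    qed
  qed (intro finite_UnI fin)+
  also have "\<dots> \<le> card {1..<i}"
  proof (rule card_mono)
    show "?P' \<union> ?L \<union> ?E \<subseteq> {1..<i}" using n(1,2) by fastforce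
  qed simp
  finally have "card ?P' + ?l + ?l \<le> i - 1" using L E by simp
  then show False using le R Q P assms(2) by linarith
qed

text \<open>After the cut no vertical edge lies over the outer side of a piece, so the crossing
  identities only compare hook numbers; \<open>left\<close> and \<open>right\<close> then bound the
  crossings by the sizes \<open>i - c\<close> and \<open>d - (i + 1)\<close>.\<close>

lemma lower_hook_descent:
  assumes "tangle N X" "1 \<le> i" "i < N" "{Upper i, Upper (i + 1)} \<in> X" "{Lower c, Lower d} \<in> X" "c \<le> i" "i < d"
    and left: "lower_hooks_left X c \<le> upper_hooks_left X i"
    and right: "lower_hooks_right X d \<le> upper_hooks_right X (i + 1)"
    and no_right: "\<And>x w. {Upper x, Lower w} \<in> X \<Longrightarrow> x < i \<Longrightarrow> d < w \<Longrightarrow> False"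
    and no_left: "\<And>x w. {Upper x, Lower w} \<in> X \<Longrightarrow> i + 1 < x \<Longrightarrow> w < c \<Longrightarrow> False"
  shows "has_descent N X"
proof -
  let ?X' = "rewire X (Upper i) (Upper (i + 1)) (Lower c) (Lower d)"
  have ne: "{Upper i, Upper (i + 1)} \<noteq> {Lower c, Lower d}" by (auto simp: doubleton_eq_iff)
  note tX' = tangle_rewire[OF assms(1,4,5) ne]
  note fin = finite_hooks[OF assms(1)] finite_hooks[OF tX']
  note n = tangle_edgeD[OF assms(1,5)]
  have other: "x \<noteq> i" "x \<noteq> i + 1" "w \<noteq> c" "w \<noteq> d" if "{Upper x, Lower w} \<in> X" for x w
    using vertical_not_hook_end[OF assms(1,4) that]
      tangle_edge_unique[OF assms(1) that assms(5), of "Lower w"] by (auto simp: doubleton_eq_iff)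
  have mem: "{Upper i, Lower c} \<in> ?X'" "{Upper (i + 1), Lower d} \<in> ?X'"
    by (auto simp: rewire_def)
  have old: "{Upper x, Lower w} \<in> X" if "{Upper x, Lower w} \<in> ?X'" "w < c \<or> d < w" "c < d" for x w
    using that by (auto simp: rewire_def doubleton_eq_iff)
  have cd: "c < d" using assms by simp
  show ?thesis
  proof (rule U_descent[OF assms(1-5) ne])
    \<comment> \<open>An edge crossing both pieces starts left of the hook and ends beyond
      \<open>d\<close>, or starts right of it and ends before \<open>c\<close>.\<close>
    show False if xw: "{Upper x, Lower w} \<in> X"
      "crosses N {Upper x, Lower w} {Upper i, Lower c}" "crosses N {Upper x, Lower w} {Upper (i + 1), Lower d}" for x w
      using other[OF xw(1)] xw assms(2,3,6,7) n crosses_vertical_iff[OF assms(1) xw(1), of "Upper i" "Lower c"]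
        crosses_vertical_iff[OF assms(1) xw(1), of "Upper (i + 1)" "Lower d"] no_right[OF xw(1)] no_left[OF xw(1)]
      by (cases "x < i") auto
    have "{w. \<exists>y. {Upper y, Lower w} \<in> ?X' \<and> i < y \<and> w < c} = {}"
    proof (rule equals0I)
      fix w assume "w \<in> {w. \<exists>y. {Upper y, Lower w} \<in> ?X' \<and> i < y \<and> w < c}"
      then obtain y where y: "{Upper y, Lower w} \<in> ?X'" "i < y" "w < c" by blast
      then have "{Upper y, Lower w} \<in> X" using old cd by blast
      then show False using other(2)[of y w] no_left[of y w] y by linarith
    qed
    then have "leftward_over ?X' i c = 0"
      unfolding leftward_over_def by (simp only: card.empty)
    moreover have "lower_hooks_left ?X' c \<le> lower_hooks_left X c"
      unfolding lower_hooks_left_def by (rule card_mono[OF fin(4)]) (auto simp: rewire_def doubleton_eq_iff)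
    moreover have "upper_hooks_left X i \<le> upper_hooks_left ?X' i"
      unfolding upper_hooks_left_def
      by (rule card_mono[OF fin(7)]) (auto simp: rewire_def doubleton_eq_iff)
    moreover note edge_crossings_vertical_left[OF tX' mem(1)] left
    ultimately have w1: "edge_weight N ?X' {Upper i, Lower c} \<le> i - c"
      using assms(6) by (intro edge_weight_vertical_leI) auto
    have "{y. \<exists>w. {Upper y, Lower w} \<in> ?X' \<and> y < i + 1 \<and> d < w} = {}"
    proof (rule equals0I)
      fix y assume "y \<in> {y. \<exists>w. {Upper y, Lower w} \<in> ?X' \<and> y < i + 1 \<and> d < w}"
      then obtain w where w: "{Upper y, Lower w} \<in> ?X'" "y < i + 1" "d < w" by blast
      then have "{Upper y, Lower w} \<in> X" using old cd by blast
      then show False using other(1)[of y w] no_right[of y w] w by linarith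
    qed
    then have "rightward_over ?X' (i + 1) d = 0"
      unfolding rightward_over_def by (simp only: card.empty)
    moreover have "lower_hooks_right ?X' d \<le> lower_hooks_right X d"
      unfolding lower_hooks_right_def by (rule card_mono[OF fin(3)]) (auto simp: rewire_def doubleton_eq_iff)
    moreover have "upper_hooks_right X (i + 1) \<le> upper_hooks_right ?X' (i + 1)"
      unfolding upper_hooks_right_def
      by (rule card_mono[OF fin(8)]) (auto simp: rewire_def doubleton_eq_iff)
    moreover note edge_crossings_vertical_right[OF tX' mem(2)] right
    ultimately have w2: "edge_weight N ?X' {Upper (i + 1), Lower d} \<le> d - (i + 1)"
      using assms(7) by (intro edge_weight_vertical_leI) auto
    have "d - c \<le> edge_weight N X {Lower c, Lower d}"
      by (simp add: edge_weight_def edge_size_pair)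
    then show "edge_weight N ?X' {Upper i, Lower c} + edge_weight N ?X' {Upper (i + 1), Lower d} + 1
        \<le> edge_weight N X {Lower c, Lower d}"
      using w1 w2 assms(6,7) by linarith
  qed
qed

text \<open>Without a descent all upper hooks join neighbours, so besides the one at
  \<open>i\<close> there are \<open>?l\<close> on its left and \<open>?r\<close> on its right. This
  split feeds the pigeonhole, and the absence of violations clears the space over the lower hook it
  finds.\<close>

lemma non_identity_has_descent:
  assumes "tangle N X" "X \<noteq> id_tangle N"
  shows "has_descent N X"
proof (rule ccontr)
  assume none: "\<not> has_descent N X"
  obtain i where i: "1 \<le> i" "i < N" "{Upper i, Upper (i + 1)} \<in> X"
    using ex_adjacent_hook[OF assms(1) none assms(2)] by blast
  note adj = hooks_adjacent[OF assms(1) none]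
  note fin = finite_hooks[OF assms(1)]
  let ?l = "upper_hooks_left X i" and ?r = "upper_hooks_right X (i + 1)"
  let ?L = "{j. \<exists>k. {Upper k, Upper j} \<in> X \<and> k < j \<and> j < i}"
  let ?R = "{j. \<exists>k. {Upper j, Upper k} \<in> X \<and> j < k \<and> i + 1 < j}"
  \<comment> \<open>The additional 1 is the hook at \<open>i\<close> itself, which lies to the right
    of every \<open>a < i\<close>.\<close>
  have right: "?r + 1 \<le> upper_hooks_right X a" if "a < i" for a
  proof -
    have "?r + 1 = card (insert i ?R)" using fin(2) unfolding upper_hooks_right_def by simp
    also have "\<dots> \<le> upper_hooks_right X a"
      unfolding upper_hooks_right_def by (rule card_mono[OF fin(2)]) (use i that in auto)
    finally show ?thesis .
  qed
  have left: "?l + 1 \<le> upper_hooks_left X b" if "i + 1 < b" for b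
  proof -
    have "?l + 1 = card (insert (i + 1) ?L)" using fin(1) unfolding upper_hooks_left_def by simp
    also have "\<dots> \<le> upper_hooks_left X b"
      unfolding upper_hooks_left_def by (rule card_mono[OF fin(1)]) (use i that in auto)
    finally show ?thesis .
  qed
  have "hook_count X \<le> card (insert (i + 1) (?L \<union> Suc ` ?R))"
    unfolding hook_count_def
  proof (rule card_mono)
    show "{j. \<exists>k. {Upper k, Upper j} \<in> X \<and> k < j} \<subseteq> insert (i + 1) (?L \<union> Suc ` ?R)"
    proof
      fix j assume "j \<in> {j. \<exists>k. {Upper k, Upper j} \<in> X \<and> k < j}"
      then obtain k where k: "{Upper k, Upper j} \<in> X" "k < j" by blast
      then have j: "j = k + 1" using adj by blast
      have "j \<noteq> i" using hook_left_end_not_right_end[OF assms(1) k(1), of "i + 1"] i k by auto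
      moreover have "k \<noteq> i + 1" using hook_left_end_not_right_end[OF assms(1) i(3), of j] k by auto
      ultimately consider "j < i" | "j = i + 1" | "i + 1 < k" using j by linarith
      then show "j \<in> insert (i + 1) (?L \<union> Suc ` ?R)"
      proof cases
        case 3
        then have "k \<in> ?R" using k by blast
        then show ?thesis using j by auto
      qed (use k in auto)
    qed
    show "finite (insert (i + 1) (?L \<union> Suc ` ?R))" using fin(1,2) by (intro finite.insertI finite_UnI finite_imageI)
  qed
  also have "\<dots> \<le> card (?L \<union> Suc ` ?R) + 1" by (simp add: card_insert_if fin finite_UnI)
  also have "card (?L \<union> Suc ` ?R) \<le> card ?L + card (Suc ` ?R)" by (rule card_Un_le)
  also have "card (Suc ` ?R) = card ?R" by (simp add: card_image)
  finally have H: "hook_count X \<le> ?l + ?r + 1"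
    unfolding upper_hooks_left_def upper_hooks_right_def by simp
  have Hl: "?l < hook_count X"
  proof -
    have "?l + 1 = card (insert (i + 1) ?L)" using fin(1) unfolding upper_hooks_left_def by simp
    also have "\<dots> \<le> hook_count X"
      unfolding hook_count_def by (rule card_mono[OF fin(1)]) (use i in auto)
    finally show ?thesis by simp
  qed
  have Hr: "?r < hook_count X"
  proof -
    have "?r + 1 = card (insert i ?R)" using fin(2) unfolding upper_hooks_right_def by simp
    also have "\<dots> \<le> card {j. \<exists>k. {Upper j, Upper k} \<in> X \<and> j < k}"
      by (rule card_mono[OF fin(2)]) (use i in auto)
    also have "\<dots> = hook_count X"
      unfolding hook_count_def
      by (rule card_matched) (use tangle_partner_unique[OF assms(1)] tangle_partner_unique'[OF assms(1)] in \<open>metis node.inject\<close>)+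
    finally show ?thesis by simp
  qed
  obtain c d where cd: "{Lower c, Lower d} \<in> X" "c < d" "lower_hooks_left X c \<le> ?l" "lower_hooks_right X d \<le> ?r"
    using ex_balanced_lower_hook[OF assms(1) H Hl Hr] by blast
  have no_right: False if xw: "{Upper x, Lower w} \<in> X" "x < i" "i < w" "d < w" for x w
  proof -
    \<comment> \<open>The leftmost such edge has no rightward edge over it, so
      \<open>no_strict_right\<close> would bound its upper hooks on the right by
      \<open>lower_hooks_right X d\<close>, hence by \<open>?r\<close>; but there are at least
      \<open>?r + 1\<close>.\<close>
    define S where "S = {x. \<exists>w. {Upper x, Lower w} \<in> X \<and> x < i \<and> i < w \<and> d < w}"
    have "finite S" unfolding S_def by (rule fin(5))
    moreover have "S \<noteq> {}" using xw unfolding S_def by blast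
    ultimately have "Min S \<in> S" and min: "\<And>x. x \<in> S \<Longrightarrow> Min S \<le> x" by auto
    then obtain u where u: "{Upper (Min S), Lower u} \<in> X" "Min S < i" "i < u" "d < u"
      unfolding S_def by blast
    have "{y. \<exists>w. {Upper y, Lower w} \<in> X \<and> y < Min S \<and> u < w} = {}"
    proof (rule equals0I)
      fix y assume "y \<in> {y. \<exists>w. {Upper y, Lower w} \<in> X \<and> y < Min S \<and> u < w}"
      then obtain w' where w': "{Upper y, Lower w'} \<in> X" "y < Min S" "u < w'" by blast
      then have "y < i" "i < w'" "d < w'" using u(2-4) by linarith+
      then have "y \<in> S" unfolding S_def using w'(1) by blast
      then show False using min[of y] w'(2) by linarith
    qed
    then have "rightward_over X (Min S) u = 0" unfolding rightward_over_def by (simp only: card.empty)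
    moreover have "lower_hooks_right X u \<le> lower_hooks_right X d"
      unfolding lower_hooks_right_def by (rule card_mono[OF fin(3)]) (use u in auto)
    ultimately show False
      using no_strict_right[OF assms(1) none i u(1-3)] right[OF u(2)] cd(4) by linarith
  qed
  have no_left: False if xw: "{Upper x, Lower w} \<in> X" "i + 1 < x" "w \<le> i" "w < c" for x w
  proof -
    define S where "S = {x. \<exists>w. {Upper x, Lower w} \<in> X \<and> i + 1 < x \<and> w \<le> i \<and> w < c}"
    have "finite S" unfolding S_def by (rule fin(5))
    moreover have "S \<noteq> {}" using xw unfolding S_def by blast
    ultimately have "Max S \<in> S" and max: "\<And>x. x \<in> S \<Longrightarrow> x \<le> Max S" by auto
    then obtain u where u: "{Upper (Max S), Lower u} \<in> X" "i + 1 < Max S" "u \<le> i" "u < c"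
      unfolding S_def by blast
    have "{w. \<exists>y. {Upper y, Lower w} \<in> X \<and> Max S < y \<and> w < u} = {}"
    proof (rule equals0I)
      fix w' assume "w' \<in> {w. \<exists>y. {Upper y, Lower w} \<in> X \<and> Max S < y \<and> w < u}"
      then obtain y where y: "{Upper y, Lower w'} \<in> X" "Max S < y" "w' < u" by blast
      then have "i + 1 < y" "w' \<le> i" "w' < c" using u(2-4) by linarith+
      then have "y \<in> S" unfolding S_def using y(1) by blast
      then show False using max[of y] y(2) by linarith
    qed
    then have "leftward_over X (Max S) u = 0" unfolding leftward_over_def by (simp only: card.empty)
    moreover have "lower_hooks_left X u \<le> lower_hooks_left X c"
      unfolding lower_hooks_left_def by (rule card_mono[OF fin(4)]) (use u in auto)
    ultimately show False
      using no_strict_left[OF assms(1) none i u(1-3)] left[OF u(2)] cd(3) by linarith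
  qed
  have d: "i < d"
    by (rule lower_hook_spans_right[OF assms(1) i cd(4)]) (rule no_right)
  have c: "c \<le> i"
    by (rule lower_hook_spans_left[OF assms(1) i cd(3)]) (rule no_left)
  have "has_descent N X"
    by (rule lower_hook_descent[OF assms(1) i cd(1) c d cd(3,4)])
      (use no_right no_left c d in \<open>meson less_trans less_imp_le less_le_trans\<close>)+
  then show False using none by simp
qed

section \<open>The length of a tangle\<close>

lemma ex_short_factorization:
  assumes "tangle N X"
  shows "\<exists>w. factorization N X w \<and> 2 * length w \<le> total_weight N X"
  using assms
proof (induction "total_weight N X" arbitrary: X rule: less_induct)
  case less
  show ?case
  proof (cases "X = id_tangle N")
    case True
    then show ?thesis by (intro exI[of _ "[]"]) (simp add: factorization_def is_word_def)
  next
    case False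
    obtain p X' where p: "1 \<le> index p" "index p < N" "tangle N X'" "tcomp (prime_tangle N p) X' = X"
      "total_weight N X' + 2 \<le> total_weight N X"
      using non_identity_has_descent[OF less.prems False] unfolding has_descent_def by blast
    obtain w where "factorization N X' w" "2 * length w \<le> total_weight N X'"
      using less.hyps[of X'] p by auto
    then show ?thesis
      using p by (intro exI[of _ "p # w"]) (auto simp: factorization_def is_word_def)
  qed
qed

lemma tangle_length_eq:
  assumes "tangle N X"
  shows "2 * tangle_length N X = total_weight N X"
proof -
  obtain w where w: "factorization N X w" "2 * length w \<le> total_weight N X"
    using ex_short_factorization[OF assms] by blast
  have lower: "total_weight N X \<le> 2 * length v" if "factorization N X v" for v
    using total_weight_word_le[of N v] that unfolding factorization_def by auto
  have len: "2 * length w = total_weight N X" using lower[OF w(1)] w(2) by simp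
  have "tangle_length N X = length w"
    unfolding tangle_length_def
  proof (rule Least_equality)
    show "\<exists>v. factorization N X v \<and> length v = length w" using w(1) by blast
    show "length w \<le> n" if "\<exists>v. factorization N X v \<and> length v = n" for n
      using that lower len by fastforce
  qed
  then show ?thesis using len by simp
qed

lemma tangle_length_eq_formula:
  assumes "tangle N X"
  shows "real (tangle_length N X) = length_formula N X"
  using tangle_length_eq[OF assms] unfolding length_formula_eq by linarith

subsection \<open>Executing programs\<close>

text \<open>Deterministic evaluation of loop-free code, so that simplification can compute its final
  states; loops are handled by \<open>executes_while\<close>.\<close>

fun run :: "com \<Rightarrow> mstate \<Rightarrow> mstate" where
  "run (SetConst r n) (R, M) = (R(r := n), M)"
| "run (Add r a b) (R, M) = (R(r := R a + R b), M)"
| "run (Sub r a b) (R, M) = (R(r := R a - R b), M)"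
| "run (Half r a) (R, M) = (R(r := R a div 2), M)"
| "run (Load r a) (R, M) = (R(r := M (R a)), M)"
| "run (Store a b) (R, M) = (R, M(R a := R b))"
| "run (Seq c1 c2) s = run c2 (run c1 s)"
| "run (IfLess a b c1 c2) (R, M) = (if R a < R b then run c1 (R, M) else run c2 (R, M))"
| "run (WhileLess a b c) s = s"

text \<open>\<open>fits W c s\<close> also excludes loops, on which \<open>run\<close> is meaningless.\<close>

fun fits :: "nat \<Rightarrow> com \<Rightarrow> mstate \<Rightarrow> bool" where
  "fits W (SetConst r n) s \<longleftrightarrow> n \<le> W"
| "fits W (Add r a b) (R, M) \<longleftrightarrow> R a + R b \<le> W"
| "fits W (Seq c1 c2) s \<longleftrightarrow> fits W c1 s \<and> fits W c2 (run c1 s)"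
| "fits W (IfLess a b c1 c2) (R, M) \<longleftrightarrow> (if R a < R b then fits W c1 (R, M) else fits W c2 (R, M))"
| "fits W (WhileLess a b c) s \<longleftrightarrow> False"
| "fits W c s \<longleftrightarrow> True"

fun max_steps :: "com \<Rightarrow> nat" where
  "max_steps (Seq c1 c2) = max_steps c1 + max_steps c2"
| "max_steps (IfLess a b c1 c2) = Suc (max (max_steps c1) (max_steps c2))"
| "max_steps c = 1"

text \<open>An upper bound on the cost, so that branches of different cost need no separate
  accounting.\<close>

definition executes :: "nat \<Rightarrow> com \<Rightarrow> mstate \<Rightarrow> nat \<Rightarrow> mstate \<Rightarrow> bool" where
  "executes W c s n s' \<longleftrightarrow> (\<exists>t\<le>n. exec W c s t s')"

lemma executes_one: "exec W c s 1 s' \<Longrightarrow> executes W c s (Suc 0) s'"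
  unfolding executes_def by auto

lemma executes_run:
  assumes "fits W c s"
  shows "executes W c s (max_steps c) (run c s)"
  using assms
proof (induction c arbitrary: s)
  case (Seq c1 c2)
  then have "executes W c1 s (max_steps c1) (run c1 s)"
    "executes W c2 (run c1 s) (max_steps c2) (run c2 (run c1 s))" by simp_all
  then obtain t1 t2 where "t1 \<le> max_steps c1" "exec W c1 s t1 (run c1 s)"
    "t2 \<le> max_steps c2" "exec W c2 (run c1 s) t2 (run c2 (run c1 s))"
    unfolding executes_def by blast
  then show ?case
    unfolding executes_def by (intro exI[of _ "t1 + t2"]) (auto intro: exec.intros)
next
  case (IfLess a b c1 c2)
  obtain R M where s: "s = (R, M)" by (cases s)
  show ?case
  proof (cases "R a < R b")
    case True
    then have "executes W c1 s (max_steps c1) (run c1 s)" using IfLess s by simp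
    then obtain t where "t \<le> max_steps c1" "exec W c1 s t (run c1 s)"
      unfolding executes_def by blast
    then show ?thesis
      using True s unfolding executes_def by (intro exI[of _ "Suc t"]) (auto intro: exec.intros)
  next
    case False
    then have "executes W c2 s (max_steps c2) (run c2 s)" using IfLess s by simp
    then obtain t where "t \<le> max_steps c2" "exec W c2 s t (run c2 s)"
      unfolding executes_def by blast
    then show ?thesis
      using False s unfolding executes_def by (intro exI[of _ "Suc t"]) (auto intro: exec.intros)
  qed
next
  case (WhileLess a b c)
  then show ?case by simp
next
  case (SetConst r n)
  then show ?case by (cases s) (auto intro!: executes_one exec.intros(1-6))
next
  case (Add r a b)
  then show ?case by (cases s) (auto intro!: executes_one exec.intros(1-6))
next
  case (Sub r a b)
  then show ?case by (cases s) (auto intro!: executes_one exec.intros(1-6))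
next
  case (Half r a)
  then show ?case by (cases s) (auto intro!: executes_one exec.intros(1-6))
next
  case (Load r a)
  then show ?case by (cases s) (auto intro!: executes_one exec.intros(1-6))
next
  case (Store a b)
  then show ?case by (cases s) (auto intro!: executes_one exec.intros(1-6))
qed

lemma executes_mono: "executes W c s m s' \<Longrightarrow> m \<le> n \<Longrightarrow> executes W c s n s'"
  unfolding executes_def by (meson order_trans)

lemma executes_Seq:
  assumes "executes W c1 s m s'" "executes W c2 s' n s''"
  shows "executes W (Seq c1 c2) s (m + n) s''"
  using assms unfolding executes_def by (meson add_le_mono exec.intros(7))

text \<open>The invariant is indexed by the number of finished rounds. A round costs its body plus
  one test, and the failing test adds the final 1.\<close>

lemma executes_while:
  assumes "\<And>k s. k < n \<Longrightarrow> I k s \<Longrightarrow> fst s a < fst s b \<and> (\<exists>s'. executes W c s T s' \<and> I (Suc k) s')"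
    and "\<And>s. I n s \<Longrightarrow> \<not> fst s a < fst s b"
    and "I 0 s"
  shows "\<exists>s'. executes W (WhileLess a b c) s (n * (T + 1) + 1) s' \<and> I n s'"
proof -
  have "\<exists>s'. executes W (WhileLess a b c) s (m * (T + 1) + 1) s' \<and> I n s'"
    if "m \<le> n" "I (n - m) s" for m s
    using that
  proof (induction m arbitrary: s)
    case 0
    then have "\<not> fst s a < fst s b" "I n s" using assms(2) by auto
    then show ?case
      by (cases s) (auto intro!: exI[of _ s] executes_one exec.intros(10))
  next
    case (Suc m)
    then obtain s' where s': "fst s a < fst s b" "executes W c s T s'" "I (Suc (n - Suc m)) s'"
      using assms(1)[of "n - Suc m" s] by auto
    moreover have "Suc (n - Suc m) = n - m" using Suc.prems(1) by simp
    ultimately obtain s'' where s'': "executes W (WhileLess a b c) s' (m * (T + 1) + 1) s''" "I n s''"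
      using Suc.IH[of s'] Suc.prems(1) by auto
    obtain t1 t2 where t: "t1 \<le> T" "exec W c s t1 s'" "t2 \<le> m * (T + 1) + 1"
      "exec W (WhileLess a b c) s' t2 s''"
      using s'(2) s''(1) unfolding executes_def by blast
    obtain R M where s: "s = (R, M)" by (cases s)
    have "exec W (WhileLess a b c) s (Suc (t1 + t2)) s''"
      using exec.intros(11)[of R a b W c M t1 s' t2 s''] t s s'(1) by simp
    moreover have "Suc (t1 + t2) \<le> Suc m * (T + 1) + 1" using t by simp
    ultimately show ?case using s''(2) unfolding executes_def by blast
  qed
  from this[of n s] show ?thesis using assms(3) by simp
qed

section \<open>Inputs as lists of edges and bounds on their numbers\<close>

lemma nth_concat_blocks:
  assumes "\<And>x. x \<in> set xs \<Longrightarrow> length (f x) = m" "j < length xs" "r < m"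
  shows "concat (map f xs) ! (m * j + r) = f (xs ! j) ! r"
  using assms
proof (induction xs arbitrary: j)
  case (Cons x xs)
  then show ?case by (cases j) (auto simp: nth_append add.assoc)
qed simp

lemma length_concat_blocks:
  assumes "\<And>x. x \<in> set xs \<Longrightarrow> length (f x) = m"
  shows "length (concat (map f xs)) = m * length xs"
  using assms by (induction xs) auto

text \<open>The edges partition the \<open>2 * N\<close> nodes into pairs.\<close>

lemma card_tangle:
  assumes "tangle N X"
  shows "card X = N"
proof -
  have two: "card e = 2" if "e \<in> X" for e
    using tangle_edgeE[OF assms that] by (metis card_2_iff)
  have "\<Union>X = nodes N"
    using tangle_edgeE[OF assms] edge_at_in[OF assms] by blast
  moreover have "card (\<Union>X) = (\<Sum>e\<in>X. card e)"
  proof (rule card_Union_disjoint)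
    show "pairwise disjnt X"
      using tangle_edge_unique[OF assms] unfolding pairwise_def disjnt_def by blast
    show "finite e" if "e \<in> X" for e using two[OF that] by (simp add: card_ge_0_finite)
  qed
  moreover have "(\<Sum>e\<in>X. card e) = 2 * card X" using two by simp
  moreover have "card (nodes N) = 2 * N"
    unfolding nodes_def by (subst card_Un_disjoint) (auto simp: card_image inj_on_def)
  ultimately show ?thesis by simp
qed

definition listed_edge :: "(node \<times> node) list \<Rightarrow> nat \<Rightarrow> edge" where
  "listed_edge es j = {fst (es ! j), snd (es ! j)}"

lemma edge_listing_sum:
  assumes "tangle N X" "edge_listing X es"
  shows "length es = N" "(\<Sum>e\<in>X. F e) = (\<Sum>j<N. F (listed_edge es j))"
    "j < N \<Longrightarrow> listed_edge es j \<in> X"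
proof -
  let ?f = "\<lambda>(x, y). {x, y} :: edge"
  have d: "distinct (map ?f es)" "set (map ?f es) = X"
    using assms(2) unfolding edge_listing_def by auto
  have "length (map ?f es) = card X" using distinct_card[OF d(1)] d(2) by simp
  then show len: "length es = N" using card_tangle[OF assms(1)] by simp
  have nth: "map ?f es ! j = listed_edge es j" if "j < N" for j
    using that len by (simp add: listed_edge_def case_prod_beta)
  show "j < N \<Longrightarrow> listed_edge es j \<in> X"
    using nth d(2) len nth_mem[of j "map ?f es"] by simp
  have "(\<Sum>e\<in>X. F e) = (\<Sum>e\<in>set (map ?f es). F e)" using d(2) by simp
  also have "\<dots> = sum_list (map F (map ?f es))"
    using d(1) by (rule sum_list_distinct_conv_sum_set[symmetric])
  also have "\<dots> = (\<Sum>j<N. F (map ?f es ! j))"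
    using len by (simp only: sum_list_sum_nth length_map atLeast0LessThan) simp
  also have "\<dots> = (\<Sum>j<N. F (listed_edge es j))" using nth by (intro sum.cong) auto
  finally show "(\<Sum>e\<in>X. F e) = (\<Sum>j<N. F (listed_edge es j))" .
qed

lemma edge_crossings_listed:
  assumes "tangle N X" "edge_listing X es"
  shows "edge_crossings N X e = (\<Sum>j<N. of_bool (crosses N e (listed_edge es j)))"
proof -
  have "edge_crossings N X e = (\<Sum>f\<in>X. of_bool (crosses N e f))"
    unfolding edge_crossings_def using finite_tangle[OF assms(1)]
    by (simp add: of_bool_def sum.If_cases Int_def)
  then show ?thesis by (simp add: edge_listing_sum(2)[OF assms])
qed

lemma edge_weight_le:
  assumes "tangle N X" "e \<in> X"
  shows "edge_weight N X e \<le> N" "edge_crossings N X e \<le> N" "edge_size e \<le> N"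
proof -
  have "edge_crossings N X e \<le> card X"
    unfolding edge_crossings_def using finite_tangle[OF assms(1)] by (intro card_mono) auto
  then show c: "edge_crossings N X e \<le> N" using card_tangle[OF assms(1)] by simp
  obtain x y where e: "e = {x, y}" "x \<in> nodes N" "y \<in> nodes N"
    using tangle_edgeE[OF assms] by metis
  then show s: "edge_size e \<le> N"
    by (cases x; cases y) (auto simp: edge_size_pair)
  show "edge_weight N X e \<le> N" using c s by (simp add: edge_weight_def)
qed

lemma partial_weight_le:
  assumes "tangle N X" "edge_listing X es" "k \<le> N"
  shows "(\<Sum>j<k. edge_weight N X (listed_edge es j)) \<le> k * N"
proof -
  have "(\<Sum>j<k. edge_weight N X (listed_edge es j)) \<le> (\<Sum>j<k. N)"
    using edge_weight_le(1)[OF assms(1) edge_listing_sum(3)[OF assms(1,2)]] assms(3)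
    by (intro sum_mono) auto
  then show ?thesis by simp
qed

text \<open>\<open>N * N\<close> bounds the accumulated weight; the linear rest leaves room for
  addresses, cyclic positions and constants.\<close>

lemma word_bound: "N * N + 12 * N + 8 \<le> (N + 2) ^ 3" for N :: nat
proof -
  have "(N + 2) ^ 3 = N * N * N + 6 * (N * N) + 12 * N + 8"
    by (simp add: power3_eq_cube algebra_simps)
  then show ?thesis by linarith
qed

text \<open>Halving is exact, since the total weight is twice a length.\<close>

lemma half_total_weight:
  assumes "tangle N X"
  shows "real (total_weight N X div 2) = length_formula N X"
proof -
  have "total_weight N X div 2 = tangle_length N X" using tangle_length_eq[OF assms] by simp
  then show ?thesis using tangle_length_eq_formula[OF assms] by simp
qed

fun row :: "node \<Rightarrow> nat" where
  "row (Upper i) = 0"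
| "row (Lower i) = 1"

lemma encode_node_eq: "encode_node x = [label x, row x]"
  by (cases x) auto

subsection \<open>The formula from the crossing numbers\<close>

text \<open>With truncated subtraction, \<open>x - y + y\<close> is the maximum of \<open>x\<close> and \<open>y\<close>.\<close>

definition sum_step :: com where
  "sum_step = Seq (Load 4 1) (Seq (Add 1 1 3) (Seq (Add 1 1 3) (Seq (Load 5 1)
    (Seq (Add 1 1 3) (Seq (Add 1 1 3) (Seq (Load 6 1) (Seq (Add 1 1 3)
    (Seq (Sub 7 4 5) (Seq (Sub 5 5 4) (Seq (Add 7 7 5)
    (Seq (Sub 7 7 6) (Seq (Add 7 7 6) (Add 0 0 7)))))))))))))"

text \<open>Register 8 is still 0, so \<open>Load 2 8\<close> reads \<open>N\<close> from address 0.
  Each edge occupies five words; the end address \<open>5 * N + 1\<close> is built by doubling, as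
  the machine cannot multiply.\<close>

definition sum_init :: com where
  "sum_init = Seq (SetConst 3 1) (Seq (Load 2 8) (Seq (Add 4 2 2) (Seq (Add 4 4 4)
    (Seq (Add 2 4 2) (Seq (Add 2 2 3) (SetConst 1 1))))))"

definition sum_program :: com where
  "sum_program = Seq sum_init (Seq (WhileLess 1 2 sum_step) (Half 0 0))"

lemma memory_with_crossings:
  assumes "tangle N X" "edge_listing X es"
  defines "M \<equiv> snd (init_state (encode_with_crossings N X es))"
  shows "M 0 = N"
    "j < N \<Longrightarrow> M (5 * j + 1) = label (fst (es ! j))"
    "j < N \<Longrightarrow> M (5 * j + 3) = label (snd (es ! j))"
    "j < N \<Longrightarrow> M (5 * j + 5) = edge_crossings N X (listed_edge es j)"
proof -
  let ?f = "\<lambda>(x, y). encode_node x @ encode_node y @ [edge_crossings N X {x, y}]"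
  have len: "length (?f z) = 5" for z by (simp add: case_prod_beta encode_node_eq)
  note n = edge_listing_sum(1)[OF assms(1,2)]
  show "M 0 = N" by (simp add: M_def init_state_def encode_with_crossings_def)
  have M: "M (Suc (5 * j + r)) = ?f (es ! j) ! r" if "j < N" "r < 5" for j r
  proof -
    have "length (concat (map ?f es)) = 5 * length es" by (rule length_concat_blocks) (rule len)
    moreover have "concat (map ?f es) ! (5 * j + r) = ?f (es ! j) ! r"
      by (rule nth_concat_blocks) (use len that n in auto)
    ultimately show ?thesis
      using that n unfolding M_def init_state_def encode_with_crossings_def by simp
  qed
  show "M (5 * j + 1) = label (fst (es ! j))" if "j < N"
    using M[OF that, of 0] by (simp add: case_prod_beta encode_node_eq)
  show "M (5 * j + 3) = label (snd (es ! j))" if "j < N"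
    using M[OF that, of 2] by (simp add: case_prod_beta encode_node_eq numeral_3_eq_3)
  show "M (5 * j + 5) = edge_crossings N X (listed_edge es j)" if "j < N"
    using M[OF that, of 4] by (simp add: case_prod_beta encode_node_eq listed_edge_def add.commute)
qed

text \<open>Per edge, 14 instructions and a test; the 9 is made of 7 for the start, the last test
  and the halving.\<close>

lemma sum_program_correct:
  assumes "tangle N X" "edge_listing X es"
  shows "\<exists>R M. executes ((N + 2) ^ 3) sum_program (init_state (encode_with_crossings N X es)) (15 * N + 9) (R, M)
    \<and> real (R 0) = length_formula N X"
proof -
  define W where "W = (N + 2) ^ 3"
  define M where "M = snd (init_state (encode_with_crossings N X es))"
  note mem = memory_with_crossings[OF assms, folded M_def]
  define wt where "wt j = edge_weight N X (listed_edge es j)" for j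
  have W: "N * N + 12 * N + 8 \<le> W" unfolding W_def by (rule word_bound)
  define I where "I k s \<longleftrightarrow> snd s = M \<and> fst s 0 = (\<Sum>j<k. wt j) \<and> fst s 1 = 5 * k + 1 \<and>
    fst s 2 = 5 * N + 1 \<and> fst s 3 = 1" for k and s :: mstate
  have init: "init_state (encode_with_crossings N X es) = (\<lambda>_. 0, M)"
    by (simp add: M_def init_state_def)
  have f0: "fits W sum_init (\<lambda>_. 0, M)"
    using W by (simp add: sum_init_def mem(1))
  have r0: "I 0 (run sum_init (\<lambda>_. 0, M))"
    by (simp add: sum_init_def I_def mem(1))
  have "\<exists>s'. executes W (WhileLess 1 2 sum_step) (run sum_init (\<lambda>_. 0, M)) (N * (14 + 1) + 1) s' \<and> I N s'"
  proof (rule executes_while[where I = I])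
    show "\<not> fst s 1 < fst s 2" if "I N s" for s using that by (simp add: I_def)
    show "fst s 1 < fst s 2 \<and> (\<exists>s'. executes W sum_step s 14 s' \<and> I (Suc k) s')" if k: "k < N" "I k s" for k s
    proof -
      obtain R where s: "s = (R, M)" using k(2) by (cases s) (simp add: I_def)
      have R: "R 0 = (\<Sum>j<k. wt j)" "R (Suc 0) = 5 * k + 1" "R 2 = 5 * N + 1" "R 3 = 1"
        using k(2) s by (auto simp: I_def)
      note e = edge_listing_sum(3)[OF assms k(1)]
      have m: "M (Suc (5 * k)) = label (fst (es ! k))"
        "M (Suc (Suc (Suc (5 * k)))) = label (snd (es ! k))"
        "M (Suc (Suc (Suc (Suc (Suc (5 * k)))))) = edge_crossings N X (listed_edge es k)"
        using mem(2-4)[OF k(1)] by (simp_all add: eval_nat_numeral)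
      have size: "edge_size (listed_edge es k) = label (fst (es ! k)) - label (snd (es ! k))
          + (label (snd (es ! k)) - label (fst (es ! k)))"
        unfolding listed_edge_def by (rule edge_size_pair)
      have wk: "wt k = edge_size (listed_edge es k) - edge_crossings N X (listed_edge es k)
          + edge_crossings N X (listed_edge es k)"
        by (simp add: wt_def edge_weight_def)
      have "(\<Sum>j<k. wt j) + wt k \<le> N * N"
      proof -
        have "(\<Sum>j<Suc k. wt j) \<le> Suc k * N"
          unfolding wt_def by (rule partial_weight_le[OF assms]) (use k in simp)
        also have "\<dots> \<le> N * N" using k by (intro mult_le_mono1) simp
        finally show ?thesis by simp
      qed
      note b = this edge_weight_le[OF assms(1) e]
      have "fits W sum_step (R, M)"
        using W b k(1) by (simp add: sum_step_def R m size[symmetric] wk[symmetric])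
      from executes_run[OF this] have "executes W sum_step (R, M) 14 (run sum_step (R, M))"
        by (rule executes_mono) (simp add: sum_step_def)
      moreover have "I (Suc k) (run sum_step (R, M))"
        by (simp add: sum_step_def I_def R m size[symmetric] wk[symmetric])
      moreover have "fst s 1 < fst s 2" using R k(1) s by simp
      ultimately show ?thesis using s by blast
    qed
  qed (rule r0)
  then obtain R M' where w: "executes W (WhileLess 1 2 sum_step) (run sum_init (\<lambda>_. 0, M)) (N * (14 + 1) + 1) (R, M')"
    "I N (R, M')" by fastforce
  have "executes W (Half 0 0) (R, M') 1 (R(0 := R 0 div 2), M')"
    using executes_run[of W "Half 0 0" "(R, M')"] by simp
  from executes_Seq[OF executes_run[OF f0] executes_Seq[OF w(1) this]]
  have "executes W sum_program (\<lambda>_. 0, M) (15 * N + 9) (R(0 := R 0 div 2), M')"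
    unfolding sum_program_def by (rule executes_mono) (simp add: sum_init_def)
  moreover have "R 0 = total_weight N X"
    using w(2) unfolding total_weight_def I_def wt_def edge_listing_sum(2)[OF assms] by simp
  ultimately show ?thesis
    unfolding init W_def[symmetric] using half_total_weight[OF assms(1)] by (intro exI[of _ "R(0 := R 0 div 2)"] exI[of _ M']) simp
qed

subsection \<open>The formula from the edges\<close>

text \<open>Replaces a label in register \<open>l\<close> with row in register \<open>t\<close> by the cyclic position;
  register 9 holds \<open>2 * N + 1\<close> and register 8 holds \<open>0\<close>.\<close>

definition to_position :: "nat \<Rightarrow> nat \<Rightarrow> com" where
  "to_position l t = IfLess 8 t (Sub l 9 l) (Sub l l 8)"

text \<open>Sets register \<open>f\<close> to 1 or 0 according to whether register \<open>c\<close> lies strictly between registers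
  4 and 5, where register 3 holds 1: \<open>1 - (1 - (y - x))\<close> is the truth value of \<open>x < y\<close>.\<close>

definition set_between :: "nat \<Rightarrow> nat \<Rightarrow> com" where
  "set_between f c = Seq (Sub f c 4) (Seq (Sub f 3 f) (Seq (Sub f 3 f)
    (Seq (Sub 14 5 c) (Seq (Sub 14 3 14) (Seq (Sub 14 3 14)
    (Seq (Add f f 14) (Sub f f 3)))))))"

text \<open>An edge crosses when exactly one of its ends lies between the two stored positions. For
  truth values 0 and 1 this exclusive or is the sum of the two truncated differences.\<close>

definition cross_step :: com where
  "cross_step = Seq (Load 11 10) (Seq (Add 10 10 3) (Seq (Load 13 10) (Seq (Add 10 10 3)
    (Seq (to_position 11 13)
    (Seq (Load 12 10) (Seq (Add 10 10 3) (Seq (Load 13 10) (Seq (Add 10 10 3)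
    (Seq (to_position 12 13)
    (Seq (set_between 13 11) (Seq (set_between 15 12)
    (Seq (Sub 14 13 15) (Seq (Sub 15 15 13) (Seq (Add 14 14 15) (Add 7 7 14)))))))))))))))"

text \<open>The labels are loaded twice: one copy gives the size, the other is turned into
  positions. Registers 4 and 5 then receive minimum and maximum, as \<open>x - (x - y)\<close> and
  \<open>x + (y - x)\<close>; the crossing counter and the inner address are reset.\<close>

definition edge_init :: com where
  "edge_init = Seq (Load 4 1) (Seq (Load 11 1) (Seq (Add 1 1 3) (Seq (Load 13 1) (Seq (Add 1 1 3)
    (Seq (Load 5 1) (Seq (Load 12 1) (Seq (Add 1 1 3) (Seq (Load 14 1) (Seq (Add 1 1 3)
    (Seq (Sub 6 4 5) (Seq (Sub 15 5 4) (Seq (Add 6 6 15)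
    (Seq (to_position 11 13) (Seq (to_position 12 14)
    (Seq (Sub 13 11 12) (Seq (Sub 4 11 13) (Seq (Sub 13 12 11) (Seq (Add 5 11 13)
    (Seq (SetConst 7 0) (SetConst 10 1))))))))))))))))))))"

definition edge_finish :: com where
  "edge_finish = Seq (Sub 13 6 7) (Seq (Add 13 13 7) (Add 0 0 13))"

definition edge_step :: com where
  "edge_step = Seq edge_init (Seq (WhileLess 10 2 cross_step) edge_finish)"

definition tangle_init :: com where
  "tangle_init = Seq (SetConst 3 1) (Seq (Load 2 8) (Seq (Add 9 2 2) (Seq (Add 2 9 9)
    (Seq (Add 2 2 3) (Seq (Add 9 9 3) (SetConst 1 1))))))"

definition tangle_program :: com where
  "tangle_program = Seq tangle_init (Seq (WhileLess 1 2 edge_step) (Half 0 0))"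

lemma run_to_position [simp]:
  "run (to_position l t) (R, M) = (R(l := if R 8 < R t then R 9 - R l else R l - R 8), M)"
  by (simp add: to_position_def)

lemma fits_to_position [simp]: "fits W (to_position l t) s"
  by (cases s) (simp add: to_position_def)

lemma max_steps_to_position [simp]: "max_steps (to_position l t) = 2"
  by (simp add: to_position_def)

lemma run_set_between [simp]:
  assumes "R 3 = Suc 0" "f \<notin> {3, 4, 5, 14}" "c \<notin> {3, 4, 5, 14}" "f \<noteq> c"
  shows "run (set_between f c) (R, M) =
    (R(f := of_bool (R 4 < R c \<and> R c < R 5), 14 := of_bool (R c < R 5)), M)"
proof -
  have less: "Suc 0 - (Suc 0 - (y - x)) = of_bool (x < y)" for x y :: nat by auto
  have both: "of_bool P + of_bool Q - Suc 0 = of_bool (P \<and> Q)" for P Q by auto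
  show ?thesis
    using assms by (simp add: set_between_def less both fun_upd_twist)
qed

lemma fits_set_between [simp]:
  assumes "R 3 = Suc 0" "f \<notin> {3, 4, 5, 14}" "c \<notin> {3, 4, 5, 14}" "f \<noteq> c" "2 \<le> W"
  shows "fits W (set_between f c) (R, M)"
proof -
  have less: "Suc 0 - (Suc 0 - (y - x)) = of_bool (x < y)" for x y :: nat by auto
  have "of_bool P + of_bool Q \<le> W" for P Q
    using assms(5) by (auto simp: of_bool_def)
  then show ?thesis
    using assms by (simp add: set_between_def less)
qed

lemma max_steps_set_between [simp]: "max_steps (set_between f c) = 8"
  by (simp add: set_between_def)

lemma position_eq: "(if 0 < row x then Suc (2 * N) - label x else label x) = cyclic_pos N x"
  by (cases x) auto

text \<open>The inner loop also tests an edge against itself; then neither end is strictly between,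
  and the test correctly reports no crossing.\<close>

lemma crosses_listed_edges:
  assumes "tangle N X" "{u, v} \<in> X" "{x, y} \<in> X"
  shows "crosses N {u, v} {x, y} \<longleftrightarrow> separates N u v x \<noteq> separates N u v y"
proof (cases "{u, v} = {x, y}")
  case True
  have "\<not> separates N u v z" if "z \<in> {u, v}" for z using that by (auto simp: separates_def)
  then have "\<not> separates N u v x" "\<not> separates N u v y" using True by blast+
  then show ?thesis using True by simp
next
  case False
  then have "x \<notin> {u, v}" "y \<notin> {u, v}"
    using tangle_edge_unique[OF assms] by blast+
  then show ?thesis
    using crosses_edge_iff[OF assms(1,2)] tangle_edgeD[OF assms(1,3)] by blast
qed

lemma memory_of_tangle:
  assumes "tangle N X" "edge_listing X es"
  defines "M \<equiv> snd (init_state (encode_tangle N es))"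
  shows "M 0 = N"
    "j < N \<Longrightarrow> M (Suc (4 * j)) = label (fst (es ! j))"
    "j < N \<Longrightarrow> M (Suc (Suc (4 * j))) = row (fst (es ! j))"
    "j < N \<Longrightarrow> M (Suc (Suc (Suc (4 * j)))) = label (snd (es ! j))"
    "j < N \<Longrightarrow> M (Suc (Suc (Suc (Suc (4 * j))))) = row (snd (es ! j))"
proof -
  let ?f = "\<lambda>(x, y). encode_node x @ encode_node y"
  have len: "length (?f z) = 4" for z by (simp add: case_prod_beta encode_node_eq)
  note n = edge_listing_sum(1)[OF assms(1,2)]
  show "M 0 = N" by (simp add: M_def init_state_def encode_tangle_def)
  have M: "M (Suc (4 * j + r)) = ?f (es ! j) ! r" if "j < N" "r < 4" for j r
  proof -
    have "length (concat (map ?f es)) = 4 * length es" by (rule length_concat_blocks) (rule len)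
    moreover have "concat (map ?f es) ! (4 * j + r) = ?f (es ! j) ! r"
      by (rule nth_concat_blocks) (use len that n in auto)
    ultimately show ?thesis
      using that n unfolding M_def init_state_def encode_tangle_def by simp
  qed
  show "M (Suc (4 * j)) = label (fst (es ! j))" if "j < N"
    using M[OF that, of 0] by (simp add: case_prod_beta encode_node_eq)
  show "M (Suc (Suc (4 * j))) = row (fst (es ! j))" if "j < N"
    using M[OF that, of 1] by (simp add: case_prod_beta encode_node_eq)
  show "M (Suc (Suc (Suc (4 * j)))) = label (snd (es ! j))" if "j < N"
    using M[OF that, of 2] by (simp add: case_prod_beta encode_node_eq)
  show "M (Suc (Suc (Suc (Suc (4 * j))))) = row (snd (es ! j))" if "j < N"
    using M[OF that, of 3] by (simp add: case_prod_beta encode_node_eq eval_nat_numeral)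
qed

text \<open>An inner round costs 32 instructions and a test. An outer round adds 23 for
  \<open>edge_init\<close>, 3 for \<open>edge_finish\<close>, and the last inner and its own test,
  giving \<open>33 * N + 28\<close>; start, last test and halving make 9.\<close>

lemma tangle_program_correct:
  assumes "tangle N X" "edge_listing X es"
  shows "\<exists>R M. executes ((N + 2) ^ 3) tangle_program (init_state (encode_tangle N es)) (33 * N * N + 28 * N + 9) (R, M)
    \<and> real (R 0) = length_formula N X"
proof -
  define W where "W = (N + 2) ^ 3"
  define M where "M = snd (init_state (encode_tangle N es))"
  note mem = memory_of_tangle[OF assms, folded M_def]
  define wt where "wt j = edge_weight N X (listed_edge es j)" for j
  have W: "N * N + 12 * N + 8 \<le> W" unfolding W_def by (rule word_bound)
  define I where "I k s \<longleftrightarrow> snd s = M \<and> fst s 0 = (\<Sum>j<k. wt j) \<and> fst s 1 = 4 * k + 1 \<and>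
    fst s 2 = 4 * N + 1 \<and> fst s 3 = 1 \<and> fst s 8 = 0 \<and> fst s 9 = 2 * N + 1" for k and s :: mstate
  have init: "init_state (encode_tangle N es) = (\<lambda>_. 0, M)"
    by (simp add: M_def init_state_def)
  have f0: "fits W tangle_init (\<lambda>_. 0, M)"
    using W by (simp add: tangle_init_def mem(1))
  have r0: "I 0 (run tangle_init (\<lambda>_. 0, M))"
    by (simp add: tangle_init_def I_def mem(1))
  have step: "\<exists>s'. executes W edge_step s (33 * N + 27) s' \<and> I (Suc k) s'" if k: "k < N" "I k s" for k s
  proof -
    obtain R where s: "s = (R, M)" using k(2) by (cases s) (simp add: I_def)
    have R: "R 0 = (\<Sum>j<k. wt j)" "R (Suc 0) = Suc (4 * k)" "R 2 = Suc (4 * N)" "R 3 = Suc 0" "R 8 = 0"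
      "R 9 = Suc (2 * N)"
      using k(2) s by (auto simp: I_def)
    define u v where "u = fst (es ! k)" and "v = snd (es ! k)"
    note e = edge_listing_sum(3)[OF assms k(1)]
    have le: "listed_edge es k = {u, v}" by (simp add: listed_edge_def u_def v_def)
    have uv: "{u, v} \<in> X" "u \<in> nodes N" "v \<in> nodes N"
      using e tangle_edgeD[OF assms(1)] unfolding le by auto
    define lo hi where "lo = min (cyclic_pos N u) (cyclic_pos N v)" and "hi = max (cyclic_pos N u) (cyclic_pos N v)"
    have lohi: "cyclic_pos N u - (cyclic_pos N u - cyclic_pos N v) = lo"
      "cyclic_pos N u + (cyclic_pos N v - cyclic_pos N u) = hi"
      unfolding lo_def hi_def by auto
    have hi: "hi \<le> 2 * N"
      using uv(2,3) unfolding hi_def by (cases u; cases v) auto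
    have size: "edge_size {u, v} = label u - label v + (label v - label u)"
      by (rule edge_size_pair)
    have sizeN: "edge_size {u, v} \<le> N" using edge_weight_le(3)[OF assms(1) uv(1)] .
    note m = mem(2-5)[OF k(1), folded u_def v_def]
    define J where "J j s \<longleftrightarrow> snd s = M \<and> fst s 0 = (\<Sum>j<k. wt j) \<and> fst s 1 = 4 * Suc k + 1 \<and>
      fst s 2 = 4 * N + 1 \<and> fst s 3 = 1 \<and> fst s 8 = 0 \<and> fst s 9 = 2 * N + 1 \<and>
      fst s 4 = lo \<and> fst s 5 = hi \<and> fst s 6 = edge_size {u, v} \<and>
      fst s 7 = (\<Sum>i<j. of_bool (crosses N {u, v} (listed_edge es i))) \<and> fst s 10 = 4 * j + 1"
      for j and s :: mstate
    have f1: "fits W edge_init (R, M)"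
      using W k(1) sizeN hi by (simp add: edge_init_def R m size[symmetric] position_eq lohi cong: if_cong split del: if_split)
    have J0: "J 0 (run edge_init (R, M))"
      by (simp add: edge_init_def J_def R m size[symmetric] position_eq lohi cong: if_cong split del: if_split)
    have "\<exists>s'. executes W (WhileLess 10 2 cross_step) (run edge_init (R, M)) (N * (32 + 1) + 1) s' \<and> J N s'"
    proof (rule executes_while[where I = J])
      show "\<not> fst s 10 < fst s 2" if "J N s" for s using that by (simp add: J_def)
      show "fst s 10 < fst s 2 \<and> (\<exists>s'. executes W cross_step s 32 s' \<and> J (Suc j) s')" if j: "j < N" "J j s" for j s
      proof -
        obtain Q where s: "s = (Q, M)" using j(2) by (cases s) (simp add: J_def)
        have Q: "Q 0 = (\<Sum>j<k. wt j)" "Q (Suc 0) = 4 * Suc k + 1" "Q 2 = Suc (4 * N)" "Q 3 = Suc 0" "Q 8 = 0"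
          "Q 9 = Suc (2 * N)" "Q 4 = lo" "Q 5 = hi" "Q 6 = edge_size {u, v}"
          "Q 7 = (\<Sum>i<j. of_bool (crosses N {u, v} (listed_edge es i)))" "Q 10 = Suc (4 * j)"
          using j(2) s by (auto simp: J_def)
        define x y where "x = fst (es ! j)" and "y = snd (es ! j)"
        have xy: "{x, y} \<in> X" "listed_edge es j = {x, y}"
          using edge_listing_sum(3)[OF assms j(1)] by (simp_all add: listed_edge_def x_def y_def)
        note mj = mem(2-5)[OF j(1), folded x_def y_def]
        have sep: "lo < cyclic_pos N z \<and> cyclic_pos N z < hi \<longleftrightarrow> separates N u v z" for z
          by (simp add: separates_def lo_def hi_def)
        have xor: "of_bool (separates N u v x) - of_bool (separates N u v y)
            + (of_bool (separates N u v y) - of_bool (separates N u v x)) = (of_bool (crosses N {u, v} {x, y}) :: nat)"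
          using crosses_listed_edges[OF assms(1) uv(1) xy(1)] by simp
        have count: "(\<Sum>i<j. of_bool (crosses N {u, v} (listed_edge es i)) :: nat) \<le> N"
        proof -
          have "(\<Sum>i<j. of_bool (crosses N {u, v} (listed_edge es i)) :: nat) \<le> (\<Sum>i<j. 1)"
            by (intro sum_mono) auto
          then show ?thesis using j(1) by simp
        qed
        have "fits W cross_step (Q, M) \<and> J (Suc j) (run cross_step (Q, M))"
          using W j(1) count by (simp add: cross_step_def J_def Q mj position_eq sep xor xy(2) cong: if_cong split del: if_split)
        then have f: "fits W cross_step (Q, M)" and J: "J (Suc j) (run cross_step (Q, M))" by auto
        from executes_run[OF f] have "executes W cross_step (Q, M) 32 (run cross_step (Q, M))"
          by (rule executes_mono) (simp add: cross_step_def)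
        moreover have "fst s 10 < fst s 2" using Q j(1) s by simp
        ultimately show ?thesis using s J by blast
      qed
    qed (rule J0)
    then obtain Q M' where w: "executes W (WhileLess 10 2 cross_step) (run edge_init (R, M)) (N * (32 + 1) + 1) (Q, M')"
      "J N (Q, M')" by fastforce
    have Q: "M' = M" "Q 0 = (\<Sum>j<k. wt j)" "Q (Suc 0) = Suc (4 * Suc k)" "Q 2 = Suc (4 * N)" "Q 3 = Suc 0" "Q 8 = 0"
      "Q 9 = Suc (2 * N)" "Q 6 = edge_size {u, v}" "Q 7 = edge_crossings N X {u, v}"
      using w(2) by (auto simp: J_def edge_crossings_listed[OF assms])
    have wk: "wt k = edge_size {u, v} - edge_crossings N X {u, v} + edge_crossings N X {u, v}"
      by (simp add: wt_def edge_weight_def le)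
    have "(\<Sum>j<k. wt j) + wt k \<le> N * N"
    proof -
      have "(\<Sum>j<Suc k. wt j) \<le> Suc k * N"
        unfolding wt_def by (rule partial_weight_le[OF assms]) (use k in simp)
      also have "\<dots> \<le> N * N" using k by (intro mult_le_mono1) simp
      finally show ?thesis by simp
    qed
    note b = this edge_weight_le[OF assms(1) uv(1)]
    have f2: "fits W edge_finish (Q, M')"
      using W b by (simp add: edge_finish_def Q wk[symmetric])
    have I2: "I (Suc k) (run edge_finish (Q, M'))"
      by (simp add: edge_finish_def I_def Q wk[symmetric])
    from executes_Seq[OF executes_run[OF f1] executes_Seq[OF w(1) executes_run[OF f2]]]
    have "executes W edge_step (R, M) (33 * N + 27) (run edge_finish (Q, M'))"
      unfolding edge_step_def by (rule executes_mono) (simp add: edge_init_def edge_finish_def)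
    then show ?thesis using I2 s by blast
  qed
  have "\<exists>s'. executes W (WhileLess 1 2 edge_step) (run tangle_init (\<lambda>_. 0, M)) (N * (33 * N + 27 + 1) + 1) s' \<and> I N s'"
  proof (rule executes_while[where I = I])
    show "\<not> fst s 1 < fst s 2" if "I N s" for s using that by (simp add: I_def)
    show "fst s 1 < fst s 2 \<and> (\<exists>s'. executes W edge_step s (33 * N + 27) s' \<and> I (Suc k) s')" if "k < N" "I k s" for k s
      using step[OF that] that by (simp add: I_def)
  qed (rule r0)
  then obtain R M' where w: "executes W (WhileLess 1 2 edge_step) (run tangle_init (\<lambda>_. 0, M)) (N * (33 * N + 27 + 1) + 1) (R, M')"
    "I N (R, M')" by fastforce
  have "executes W (Half 0 0) (R, M') 1 (R(0 := R 0 div 2), M')"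
    using executes_run[of W "Half 0 0" "(R, M')"] by simp
  from executes_Seq[OF executes_run[OF f0] executes_Seq[OF w(1) this]]
  have "executes W tangle_program (\<lambda>_. 0, M) (33 * N * N + 28 * N + 9) (R(0 := R 0 div 2), M')"
    unfolding tangle_program_def by (rule executes_mono) (simp add: tangle_init_def algebra_simps)
  moreover have "R 0 = total_weight N X"
    using w(2) unfolding total_weight_def I_def wt_def edge_listing_sum(2)[OF assms] by simp
  ultimately show ?thesis
    unfolding init W_def[symmetric] using half_total_weight[OF assms(1)]
    by (intro exI[of _ "R(0 := R 0 div 2)"] exI[of _ M']) simp
qed

section \<open>Asymptotic time bounds\<close>

lemma computable_in_timeI:
  assumes "\<And>N xs r. P N xs r \<Longrightarrow> \<exists>R M. executes ((N + 2) ^ d) c (init_state xs) (time N) (R, M) \<and> real (R 0) = r"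
    and "(\<lambda>N. real (time N)) \<in> O(g)"
  shows "computable_in_time P g"
  unfolding computable_in_time_def
  by (intro exI[of _ c] exI[of _ d] exI[of _ time]) (use assms in \<open>fastforce simp: executes_def\<close>)

lemma tangle_formula_quadratic: "computable_in_time formula_from_tangle (\<lambda>N. real N ^ 2)"
proof (rule computable_in_timeI[where c = tangle_program and d = 3 and time = "\<lambda>N. 33 * N * N + 28 * N + 9"])
  show "\<exists>R M. executes ((N + 2) ^ 3) tangle_program (init_state xs) (33 * N * N + 28 * N + 9) (R, M) \<and> real (R 0) = r"
    if "formula_from_tangle N xs r" for N xs r
    using that tangle_program_correct unfolding formula_from_tangle_def by blast
  show "(\<lambda>N. real (33 * N * N + 28 * N + 9)) \<in> O(\<lambda>N. real N ^ 2)"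
  \<comment> \<open>70 is 33 + 28 + 9, since \<open>N\<close> and 1 are at most \<open>N * N\<close>
    for positive \<open>N\<close>.\<close>
  proof (rule landau_o.bigI[where c = 70])
    have "33 * N * N + 28 * N + 9 \<le> 70 * (N * N)" if "1 \<le> N" for N :: nat
    proof -
      have "N \<le> N * N" using that by simp
      then show ?thesis using that by (simp only: mult.assoc)
    qed
    then have "real (33 * N * N + 28 * N + 9) \<le> real (70 * (N * N))" if "1 \<le> N" for N
      using that unfolding of_nat_le_iff by blast
    then show "\<forall>\<^sub>F N in sequentially. norm (real (33 * N * N + 28 * N + 9)) \<le> 70 * norm (real N ^ 2)"
      by (intro eventually_sequentiallyI[of 1]) (simp add: power2_eq_square)
  qed simp
qed

lemma tangle_formula_linear: "computable_in_time formula_from_crossings (\<lambda>N. real N)"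
proof (rule computable_in_timeI[where c = sum_program and d = 3 and time = "\<lambda>N. 15 * N + 9"])
  show "\<exists>R M. executes ((N + 2) ^ 3) sum_program (init_state xs) (15 * N + 9) (R, M) \<and> real (R 0) = r"
    if "formula_from_crossings N xs r" for N xs r
    using that sum_program_correct unfolding formula_from_crossings_def by blast
  show "(\<lambda>N. real (15 * N + 9)) \<in> O(\<lambda>N. real N)"
    by (rule landau_o.bigI[where c = 24]) (auto intro: eventually_sequentiallyI[of 1])
qed

theorem mainTheorem2:
  assumes "rewriting_reaches_minimal"
    and "crossings_are_T_primes"
  shows "(\<forall>N X. tangle N X \<longrightarrow> real (tangle_length N X) = length_formula N X) \<and>
    computable_in_time formula_from_tangle (\<lambda>N. real N ^ 2) \<and>
    computable_in_time formula_from_crossings (\<lambda>N. real N)"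
  using tangle_length_eq_formula tangle_formula_quadratic tangle_formula_linear by blast

end
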